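(* For every $\Sigma^1_1$ set $P \subseteq \mathbb{N}$ there exist a finite alphabet $S$ and a cellular automaton $f$ on the full shift $S^{\mathbb{Z}}$ such that $P$ is many-one reducible to the language of the asymptotic set $\mathcal{A}(f)$. In particular, there exists a cellular automaton on a full shift whose asymptotic set has a $\Sigma^1_1$-complete language.
   Context: A cellular automaton on $X = S^{\mathbb{Z}}$ ($S$ finite, product topology) is a continuous map $f: X\to X$ commuting with the shift. The asymptotic set of $f$ is $\mathcal{A}(f) = \bigcup_{x \in X} \bigcap_{n \in \mathbb{N}} \overline{\bigcup_{k \geq n} \{f^k(x)\}}$. The language of a (not necessarily closed) set $Y \subseteq S^{\mathbb{Z}}$ is the set of words $w \in S^*$ with $w = y_{[0,k-1]}$ for some $y \in Y$, $k \in \mathbb{N}$; it is viewed as a subset of $\mathbb{N}$ via a computable bijection $S^* \cong \mathbb{N}$. A set $P \subseteq \mathbb{N}$ is $\Sigma^1_1$ if $w \in P \iff (\exists C \subseteq \mathbb{N})(\forall m \in \mathbb{N})(\exists \ell \in \mathbb{N}) R(C,m,\ell,w)$ for some recursive predicate $R$; it is $\Sigma^1_1$-complete if it is $\Sigma^1_1$ and every $\Sigma^1_1$ set many-one (computably) reduces to it. *)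

theory Defs
  imports "HOL-Analysis.Analysis"
begin

datatype rf =
    Zero
  | Succ
  | Proj nat
  | Orc
  | Comp rf "rf list"
  | Prim rf rf
  | Mn rf

definition arg :: "nat list \<Rightarrow> nat \<Rightarrow> nat" where
  "arg xs i = (if i < length xs then xs ! i else 0)"

inductive reval :: "nat set \<Rightarrow> rf \<Rightarrow> nat list \<Rightarrow> nat \<Rightarrow> bool" for C where
  zero: "reval C Zero xs 0"
| succ: "reval C Succ xs (Suc (arg xs 0))"
| proj: "reval C (Proj i) xs (arg xs i)"
| orc: "reval C Orc xs (if arg xs 0 \<in> C then 1 else 0)"
| comp: "list_all2 (\<lambda>g y. reval C g xs y) gs ys \<Longrightarrow> reval C f ys z \<Longrightarrow> reval C (Comp f gs) xs z"
| prim0: "reval C f xs z \<Longrightarrow> reval C (Prim f g) (0 # xs) z"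
| primS: "reval C (Prim f g) (n # xs) y \<Longrightarrow> reval C g (y # n # xs) z
          \<Longrightarrow> reval C (Prim f g) (Suc n # xs) z"
| mn: "reval C g (y # xs) 0 \<Longrightarrow> (\<forall>z<y. \<exists>v. v \<noteq> 0 \<and> reval C g (z # xs) v)
          \<Longrightarrow> reval C (Mn g) xs y"

definition recursive_pred :: "(nat set \<Rightarrow> nat \<Rightarrow> nat \<Rightarrow> nat \<Rightarrow> bool) \<Rightarrow> bool" where
  "recursive_pred R \<longleftrightarrow> (\<exists>e. \<forall>C m l w. reval C e [m, l, w] (if R C m l w then 1 else 0))"

definition computable :: "(nat \<Rightarrow> nat) \<Rightarrow> bool" where
  "computable g \<longleftrightarrow> (\<exists>e. \<forall>n. reval {} e [n] (g n))"

definition sigma11 :: "nat set \<Rightarrow> bool" where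
  "sigma11 P \<longleftrightarrow> (\<exists>R. recursive_pred R \<and>
     (\<forall>w. w \<in> P \<longleftrightarrow> (\<exists>C. \<forall>m. \<exists>l. R C m l w)))"

definition many_one_reducible :: "nat set \<Rightarrow> nat set \<Rightarrow> bool" where
  "many_one_reducible P Q \<longleftrightarrow> (\<exists>g. computable g \<and> (\<forall>n. n \<in> P \<longleftrightarrow> g n \<in> Q))"

definition sigma11_complete :: "nat set \<Rightarrow> bool" where
  "sigma11_complete Q \<longleftrightarrow> sigma11 Q \<and> (\<forall>P. sigma11 P \<longrightarrow> many_one_reducible P Q)"

text \<open>The alphabet is S = {0..<k} (k \<ge> 1); configurations are maps int \<Rightarrow> nat with values
  in S, carrying the product topology (nat is discrete).\<close>

definition full_shift :: "nat \<Rightarrow> (int \<Rightarrow> nat) set" where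
  "full_shift k = {x. \<forall>i. x i < k}"

definition shift :: "(int \<Rightarrow> nat) \<Rightarrow> (int \<Rightarrow> nat)" where
  "shift x = (\<lambda>i. x (i + 1))"

definition cellular_automaton :: "nat \<Rightarrow> ((int \<Rightarrow> nat) \<Rightarrow> (int \<Rightarrow> nat)) \<Rightarrow> bool" where
  "cellular_automaton k f \<longleftrightarrow> 1 \<le> k \<and> f ` full_shift k \<subseteq> full_shift k \<and>
     continuous_on (full_shift k) f \<and> (\<forall>x \<in> full_shift k. f (shift x) = shift (f x))"

definition asymptotic_set :: "nat \<Rightarrow> ((int \<Rightarrow> nat) \<Rightarrow> (int \<Rightarrow> nat)) \<Rightarrow> (int \<Rightarrow> nat) set" where
  "asymptotic_set k f = (\<Union>x \<in> full_shift k. \<Inter>n. closure {(f ^^ j) x | j. j \<ge> n})"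

definition language :: "(int \<Rightarrow> nat) set \<Rightarrow> nat list set" where
  "language Y = {map (\<lambda>i. y (int i)) [0..<n] | y n. y \<in> Y}"

text \<open>Computable bijection between words over {0..<k} and nat (bijective base-k numeration).\<close>
fun word_code :: "nat \<Rightarrow> nat list \<Rightarrow> nat" where
  "word_code k [] = 0"
| "word_code k (a # w) = Suc a + k * word_code k w"

definition lang_code :: "nat \<Rightarrow> nat list set \<Rightarrow> nat set" where
  "lang_code k L = word_code k ` L"

end

theory Submission
  imports Defs "HOL-Library.Nat_Bijection"
begin

text \<open>
  A \<open>\<Sigma>\<^sup>1\<^sub>1\<close> set can be presented by the question whether some set \<open>T\<close> of numbers satisfies
  \<open>\<forall>m. \<exists>l. \<phi>(T, n, m, l)\<close> for a quantifier-free formula \<open>\<phi>\<close> over pairing and successor; one fixed \<open>\<phi>\<close> is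
  universal, since \<open>T\<close> can contain the evaluations of arbitrary programs and \<open>\<phi>\<close> only checks single
  evaluation rules.

  The cellular automaton simulates a counter machine whose oracle \<open>T\<close> is written in the initial
  configuration. For \<open>M = 1, 2, \<dots>\<close> the machine searches, for every \<open>m \<le> M\<close>, a witness \<open>l\<close>, and after each
  round it displays the input \<open>n\<close> at the origin. The display recurs if and only if all searches succeed.
  Counters are positions of marks, and signals are arranged such that after a bounded time any
  configuration in which the display recurs has carried out a genuine run of the machine with arbitrary
  initial counter values. As every round checks all \<open>m \<le> M\<close> anew, these initial values do not matter.

  Conversely, by compactness a word belongs to the language of the asymptotic set iff it recurs at the
  origin along some orbit, and this is a \<open>\<Sigma>\<^sup>1\<^sub>1\<close> condition.
\<close>

section \<open>Quantifier-free formulas over pairing\<close>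

text \<open>The obstacle is that an automaton on a full shift also runs on ill-formed
  configurations, so nothing may be assumed about the initial one beyond the recurrence of the
  displayed word. An origin cell that keeps recurring has been one all along; this forces its left
  neighbour to be \<open>Out\<close> forever and makes the right half-line autonomous. There, no
  older right-moving signal can interfere with a head emitted at the origin. The display itself pins
  down all registers but one, and that one becomes known through its first increment.

  The set quantifier comes from the free choice of the configuration: the oracle track consists of
  marks that no instruction changes. Inputs are kept positive and oracle queries are shifted past
  the input, so that the displayed word depends on the input alone, neither on the oracle nor on the
  bound M reached so far.\<close>

abbreviation pr :: "nat \<Rightarrow> nat \<Rightarrow> nat" where "pr a b \<equiv> prod_encode (a, b)"
abbreviation pfst :: "nat \<Rightarrow> nat" where "pfst z \<equiv> fst (prod_decode z)"
abbreviation psnd :: "nat \<Rightarrow> nat" where "psnd z \<equiv> snd (prod_decode z)"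

datatype tm = TN | TM | TL | TZ | TS tm | TP tm tm | TF tm | TG tm
datatype fm = Eq tm tm | In tm | Nand fm fm

fun tval :: "nat \<Rightarrow> nat \<Rightarrow> nat \<Rightarrow> tm \<Rightarrow> nat" where
  "tval n m l TN = n"
| "tval n m l TM = m"
| "tval n m l TL = l"
| "tval n m l TZ = 0"
| "tval n m l (TS a) = Suc (tval n m l a)"
| "tval n m l (TP a b) = pr (tval n m l a) (tval n m l b)"
| "tval n m l (TF a) = pfst (tval n m l a)"
| "tval n m l (TG a) = psnd (tval n m l a)"

fun fval :: "nat set \<Rightarrow> nat \<Rightarrow> nat \<Rightarrow> nat \<Rightarrow> fm \<Rightarrow> bool" where
  "fval T n m l (Eq a b) = (tval n m l a = tval n m l b)"
| "fval T n m l (In a) = (tval n m l a \<in> T)"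
| "fval T n m l (Nand f g) = (\<not> (fval T n m l f \<and> fval T n m l g))"

definition Neg :: "fm \<Rightarrow> fm" where "Neg f = Nand f f"
definition And :: "fm \<Rightarrow> fm \<Rightarrow> fm" where "And f g = Neg (Nand f g)"
definition Or :: "fm \<Rightarrow> fm \<Rightarrow> fm" where "Or f g = Nand (Neg f) (Neg g)"
definition Imp :: "fm \<Rightarrow> fm \<Rightarrow> fm" where "Imp f g = Nand f (Neg g)"
definition Conj :: "fm list \<Rightarrow> fm" where "Conj fs = foldr And fs (Eq TZ TZ)"
definition Disj :: "fm list \<Rightarrow> fm" where "Disj fs = Neg (Conj (map Neg fs))"

lemma fval_connectives [simp]:
  "fval T n m l (Neg f) \<longleftrightarrow> \<not> fval T n m l f"
  "fval T n m l (And f g) \<longleftrightarrow> fval T n m l f \<and> fval T n m l g"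
  "fval T n m l (Or f g) \<longleftrightarrow> fval T n m l f \<or> fval T n m l g"
  "fval T n m l (Imp f g) \<longleftrightarrow> (fval T n m l f \<longrightarrow> fval T n m l g)"
  by (auto simp: Neg_def And_def Or_def Imp_def)

lemma fval_Conj [simp]: "fval T n m l (Conj fs) \<longleftrightarrow> (\<forall>f\<in>set fs. fval T n m l f)"
  by (induction fs) (auto simp: Conj_def)

lemma fval_Disj [simp]: "fval T n m l (Disj fs) \<longleftrightarrow> (\<exists>f\<in>set fs. fval T n m l f)"
  by (auto simp: Disj_def)

definition tnum :: "nat \<Rightarrow> tm" where "tnum c = (TS ^^ c) TZ"

lemma tval_tnum [simp]: "tval n m l (tnum c) = c"
  by (induction c) (auto simp: tnum_def)

text \<open>Lets the single variables m and l stand for whole blocks of quantified numbers.\<close>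

definition tproj :: "tm \<Rightarrow> nat \<Rightarrow> tm" where "tproj a i = TF ((TG ^^ i) a)"

definition pproj :: "nat \<Rightarrow> nat \<Rightarrow> nat" where "pproj z i = pfst ((psnd ^^ i) z)"

lemma tval_tproj [simp]: "tval n m l (tproj a i) = pproj (tval n m l a) i"
proof -
  have "tval n m l ((TG ^^ i) a) = (psnd ^^ i) (tval n m l a)"
    by (induction i) auto
  then show ?thesis by (simp add: tproj_def pproj_def)
qed

definition ptuple :: "nat list \<Rightarrow> nat" where "ptuple as = foldr pr as 0"

lemma pproj_ptuple: "i < length as \<Longrightarrow> pproj (ptuple as) i = as ! i"
proof (induction as arbitrary: i)
  case (Cons a as)
  show ?case
  proof (cases i)
    case 0 then show ?thesis by (simp add: pproj_def ptuple_def)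
  next
    case (Suc j)
    have "pproj (ptuple (a # as)) (Suc j) = pproj (ptuple as) j"
      by (simp add: pproj_def ptuple_def funpow_swap1)
        (metis funpow_swap1 prod_encode_inverse snd_conv)
    with Suc Cons show ?thesis by simp
  qed
qed simp

text \<open>Every statement stored in the set variable gets one tag and three arguments, so that
  statements of different kinds never collide and one injectivity rule settles all
  comparisons.\<close>

definition fact4 :: "nat \<Rightarrow> nat \<Rightarrow> nat \<Rightarrow> nat \<Rightarrow> nat" where
  "fact4 k a b c = pr k (pr a (pr b c))"

lemma fact4_eq [simp]: "fact4 k a b c = fact4 k' a' b' c' \<longleftrightarrow> k = k' \<and> a = a' \<and> b = b' \<and> c = c'"
  by (simp add: fact4_def)

definition tfact :: "nat \<Rightarrow> tm \<Rightarrow> tm \<Rightarrow> tm \<Rightarrow> tm" where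
  "tfact k a b c = TP (tnum k) (TP a (TP b c))"

lemma tval_tfact [simp]:
  "tval n m l (tfact k a b c) = fact4 k (tval n m l a) (tval n m l b) (tval n m l c)"
  by (simp add: tfact_def fact4_def)

section \<open>A universal formula\<close>

text \<open>Encoded statements about evaluation: \<open>Ev e xs y\<close> (program \<open>e\<close> maps \<open>xs\<close> to \<open>y\<close>), \<open>Ls gs xs ys\<close>
  (the same for a list of programs), \<open>Ag xs i y\<close> (\<open>y\<close> is argument \<open>i\<close> of \<open>xs\<close>), \<open>Bl g xs y\<close> (\<open>g\<close> is nonzero
  below \<open>y\<close>), \<open>Oc c\<close> (the oracle contains \<open>c\<close>), \<open>Top e w m\<close> (every \<open>m' \<ge> m\<close> has an \<open>l\<close> with value 1).
  A set of statements is supported if each member follows from other members by one evaluation rule. No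
  well-foundedness is required: an induction on a true evaluation shows that a supported set contains
  no wrong value for it, and only total programs are ever asked for.\<close>

abbreviation "Ev \<equiv> fact4 0"
abbreviation "Ls \<equiv> fact4 6"
abbreviation "Ag \<equiv> fact4 2"
abbreviation "Bl \<equiv> fact4 3"
abbreviation "Top \<equiv> fact4 4"
abbreviation "Oc c \<equiv> fact4 5 c 0 0"
abbreviation pcons :: "nat \<Rightarrow> nat \<Rightarrow> nat" where "pcons x xs \<equiv> Suc (pr x xs)"

inductive supp :: "nat set \<Rightarrow> nat \<Rightarrow> bool" for T where
  sZ: "supp T (Ev (pr 0 0) xs 0)"
| sS: "Ag xs 0 y \<in> T \<Longrightarrow> supp T (Ev (pr 1 0) xs (Suc y))"
| sP: "Ag xs i y \<in> T \<Longrightarrow> supp T (Ev (pr 2 i) xs y)"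
| sO1: "Ag xs 0 c \<in> T \<Longrightarrow> Oc c \<in> T \<Longrightarrow> supp T (Ev (pr 3 0) xs 1)"
| sO0: "Ag xs 0 c \<in> T \<Longrightarrow> Oc c \<notin> T \<Longrightarrow> supp T (Ev (pr 3 0) xs 0)"
| sC: "Ls gs xs ys \<in> T \<Longrightarrow> Ev f ys z \<in> T \<Longrightarrow> supp T (Ev (pr 4 (pr f gs)) xs z)"
| sR0: "Ev f xs z \<in> T \<Longrightarrow> supp T (Ev (pr 5 (pr f g)) (pcons 0 xs) z)"
| sRS: "Ev (pr 5 (pr f g)) (pcons n xs) y \<in> T \<Longrightarrow> Ev g (pcons y (pcons n xs)) z \<in> T
    \<Longrightarrow> supp T (Ev (pr 5 (pr f g)) (pcons (Suc n) xs) z)"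
| sM: "Ev g (pcons y xs) 0 \<in> T \<Longrightarrow> Bl g xs y \<in> T \<Longrightarrow> supp T (Ev (pr 6 g) xs y)"
| sB0: "supp T (Bl g xs 0)"
| sBS: "Ev g (pcons y xs) (Suc v) \<in> T \<Longrightarrow> Bl g xs y \<in> T \<Longrightarrow> supp T (Bl g xs (Suc y))"
| sL0: "supp T (Ls 0 xs 0)"
| sLS: "Ev g xs y \<in> T \<Longrightarrow> Ls gs xs ys \<in> T \<Longrightarrow> supp T (Ls (pcons g gs) xs (pcons y ys))"
| sA: "supp T (Ag 0 i 0)"
| sA0: "supp T (Ag (pcons x xs) 0 x)"
| sAS: "Ag xs i y \<in> T \<Longrightarrow> supp T (Ag (pcons x xs) (Suc i) y)"
| sT: "Ev e (pcons m (pcons l (pcons w 0))) 1 \<in> T \<Longrightarrow> Top e w (Suc m) \<in> T \<Longrightarrow> supp T (Top e w m)"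
| sO: "supp T (Oc c)"

text \<open>The tags are those expected by the rules of \<open>supp\<close>. Since
  \<open>list_encode\<close> is built from \<open>pcons\<close>, encoded lists decompose exactly as
  in these rules.\<close>

fun code :: "rf \<Rightarrow> nat" where
  "code Zero = pr 0 0"
| "code Succ = pr 1 0"
| "code (Proj i) = pr 2 i"
| "code Orc = pr 3 0"
| "code (Comp f gs) = pr 4 (pr (code f) (list_encode (map code gs)))"
| "code (Prim f g) = pr 5 (pr (code f) (code g))"
| "code (Mn g) = pr 6 (code g)"

lemma arg_Nil [simp]: "arg [] i = 0" by (simp add: arg_def)
lemma arg_Cons_0 [simp]: "arg (x # xs) 0 = x" by (simp add: arg_def)
lemma arg_Cons_Suc [simp]: "arg (x # xs) (Suc i) = arg xs i" by (simp add: arg_def)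

context
  fixes T :: "nat set"
  assumes T: "\<And>t. t \<in> T \<Longrightarrow> supp T t"
begin

lemma supported_Ag: "Ag (list_encode xs) i y \<in> T \<Longrightarrow> y = arg xs i"
proof (induction xs arbitrary: i)
  case Nil
  from T[OF Nil] show ?case by cases auto
next
  case (Cons x xs)
  from T[OF Cons.prems] show ?case using Cons.IH by cases auto
qed

lemma supported_Bl: "Bl g xs y \<in> T \<Longrightarrow> z < y \<Longrightarrow> \<exists>v. Ev g (pcons z xs) (Suc v) \<in> T"
proof (induction y)
  case (Suc y)
  from T[OF Suc.prems(1)] show ?case using Suc by cases (auto simp: less_Suc_eq)
qed simp

text \<open>The hypothesis has the form in which the induction for \<open>supported_Ev\<close>
  delivers uniqueness for the component programs.\<close>

lemma supported_Ls:
  assumes "list_all2 (\<lambda>g y. \<forall>y'. Ev (code g) xs y' \<in> T \<longrightarrow> y' = y) gs ys"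
    and "Ls (list_encode (map code gs)) xs ys' \<in> T"
  shows "ys' = list_encode ys"
  using assms
proof (induction gs ys arbitrary: ys' rule: list_all2_induct)
  case Nil
  then have "Ls 0 xs ys' \<in> T" by simp
  from T[OF this] show ?case by cases auto
next
  case (Cons g gs y ys)
  then have "Ls (pcons (code g) (list_encode (map code gs))) xs ys' \<in> T" by simp
  from T[OF this] show ?case using Cons by cases auto
qed

text \<open>Induction on the genuine evaluation, with the oracle read off from T itself. Only
  uniqueness is claimed; T may contain no value at all.\<close>

lemma supported_Ev:
  "reval {c. Oc c \<in> T} e xs y \<Longrightarrow> Ev (code e) (list_encode xs) y' \<in> T \<Longrightarrow> y' = y"
proof (induction arbitrary: y' rule: reval.induct)
  case (zero xs)
  from T[OF zero[simplified]] show ?case by cases auto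
next
  case (succ xs)
  from T[OF succ[simplified]] show ?case by cases (auto dest: supported_Ag)
next
  case (proj i xs)
  from T[OF proj[simplified]] show ?case by cases (auto dest: supported_Ag)
next
  case (orc xs)
  from T[OF orc[simplified]] show ?case by cases (auto dest: supported_Ag)
next
  case (comp xs gs ys f z)
  have all: "list_all2 (\<lambda>g y. \<forall>y'. Ev (code g) (list_encode xs) y' \<in> T \<longrightarrow> y' = y) gs ys"
    using comp.IH(1) by (auto elim!: list.rel_mono_strong)
  from T[OF comp.prems[simplified]] show ?case
    using comp.IH(2) by cases (auto dest: supported_Ls[OF all])
next
  case (prim0 f xs z g)
  from T[OF prim0.prems[simplified]] show ?case using prim0.IH by cases auto
next
  case (primS f g n xs y z)
  from T[OF primS.prems[simplified]] show ?case using primS.IH by cases auto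
next
  case (mn g y xs)
  from T[OF mn.prems[simplified]] show ?case
  proof cases
    case sM
    then have a: "Ev (code g) (list_encode (y' # xs)) 0 \<in> T" and b: "Bl (code g) (list_encode xs) y' \<in> T"
      by auto
    \<comment> \<open>A result that is too small would need value 0 where the true value is nonzero;
      one that is too large would, by \<open>supported_Bl\<close>, need a nonzero value where the
      true one is 0.\<close>
    have "\<not> y' < y" using mn.IH(2) a by blast
    moreover have "\<not> y < y'"
    proof
      assume "y < y'"
      from supported_Bl[OF b this] obtain v where "Ev (code g) (list_encode (y # xs)) (Suc v) \<in> T" by auto
      with mn.IH(1) show False by blast
    qed
    ultimately show ?thesis by simp
  qed auto
qed

end

inductive_set true_facts :: "nat set \<Rightarrow> rf \<Rightarrow> nat \<Rightarrow> nat set" for C e w where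
  "reval C g xs y \<Longrightarrow> Ev (code g) (list_encode xs) y \<in> true_facts C e w"
| "list_all2 (\<lambda>g y. reval C g xs y) gs ys \<Longrightarrow>
    Ls (list_encode (map code gs)) (list_encode xs) (list_encode ys) \<in> true_facts C e w"
| "Ag (list_encode xs) i (arg xs i) \<in> true_facts C e w"
| "\<forall>z<y. \<exists>v. v \<noteq> 0 \<and> reval C g (z # xs) v \<Longrightarrow> Bl (code g) (list_encode xs) y \<in> true_facts C e w"
| "Top (code e) w m \<in> true_facts C e w"
| "c \<in> C \<Longrightarrow> Oc c \<in> true_facts C e w"

text \<open>The absence of an oracle statement is the one negative premise among the rules of
  \<open>supp\<close>, so here an exact characterisation is required.\<close>

lemma Oc_true_facts: "Oc c \<in> true_facts C e w \<longleftrightarrow> c \<in> C"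
  by (auto intro: true_facts.intros elim: true_facts.cases)

text \<open>The last rule of a true evaluation has true premises, and these belong to the set
  again.\<close>

lemma supp_true_facts:
  assumes "\<And>m. \<exists>l. reval C e [m, l, w] 1" and "t \<in> true_facts C e w"
  shows "supp (true_facts C e w) t"
  using assms(2)
proof cases
  case (1 g xs y)
  note tf = true_facts.intros[where C = C and e = e and w = w]
  from 1(2) show ?thesis
  proof cases
    case zero then show ?thesis by (auto simp: 1(1) intro: supp.intros)
  next
    case succ then show ?thesis by (auto simp: 1(1) simp del: One_nat_def intro: supp.intros tf)
  next
    case proj then show ?thesis by (auto simp: 1(1) intro: supp.intros tf)
  next
    case orc
    show ?thesis
    proof (cases "arg xs 0 \<in> C")
      case True
      have "supp (true_facts C e w) (Ev (pr 3 0) (list_encode xs) 1)"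
        by (rule sO1[of _ "arg xs 0"]) (auto intro: tf True)
      with orc True show ?thesis by (simp add: 1(1))
    next
      case False
      have "supp (true_facts C e w) (Ev (pr 3 0) (list_encode xs) 0)"
        by (rule sO0[of _ "arg xs 0"]) (auto intro: tf simp: Oc_true_facts False)
      with orc False show ?thesis by (simp add: 1(1))
    qed
  next
    case comp then show ?thesis by (auto simp: 1(1) intro: supp.intros tf)
  next
    case (prim0 f xs' g')
    have "supp (true_facts C e w) (Ev (pr 5 (pr (code f) (code g'))) (pcons 0 (list_encode xs')) y)"
      by (rule sR0) (rule tf(1), rule prim0)
    with prim0 show ?thesis by (simp add: 1(1))
  next
    case (primS f g' n xs' y')
    have "supp (true_facts C e w) (Ev (pr 5 (pr (code f) (code g'))) (pcons (Suc n) (list_encode xs')) y)"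
      by (rule sRS[where y = y']) (use tf(1)[OF primS(3)] tf(1)[OF primS(4)] in auto)
    with primS show ?thesis by (simp add: 1(1))
  next
    case (mn g')
    have "supp (true_facts C e w) (Ev (pr 6 (code g')) (list_encode xs) y)"
      by (rule sM) (use tf(1)[OF mn(2)] tf(4)[OF mn(3)] in auto)
    with mn show ?thesis by (simp add: 1(1))
  qed
next
  case (2 xs gs ys)
  from 2(2) show ?thesis
    by cases (auto simp: 2(1) intro: supp.intros true_facts.intros)
next
  case (3 xs i)
  then show ?thesis
    by (cases xs; cases i) (auto intro: supp.intros true_facts.intros)
next
  case (4 y g xs)
  show ?thesis
  proof (cases y)
    case 0 then show ?thesis using 4 by (auto intro: supp.intros)
  next
    case (Suc y')
    with 4 obtain v where "reval C g (y' # xs) (Suc v)" by (metis lessI not0_implies_Suc)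
    then have "Ev (code g) (pcons y' (list_encode xs)) (Suc v) \<in> true_facts C e w"
      using true_facts.intros(1)[of C g "y' # xs" "Suc v"] by simp
    moreover have "Bl (code g) (list_encode xs) y' \<in> true_facts C e w"
      using 4 Suc by (auto intro: true_facts.intros)
    ultimately show ?thesis using 4 Suc by (auto intro: supp.intros)
  qed
next
  case (5 m)
  obtain l where "reval C e [m, l, w] 1" using assms(1) by blast
  then have "Ev (code e) (pcons m (pcons l (pcons w 0))) 1 \<in> true_facts C e w"
    using true_facts.intros(1)[of C e "[m, l, w]" 1] by simp
  then show ?thesis unfolding 5 by (auto intro: supp.intros true_facts.intros)
next
  case (6 c)
  then show ?thesis by (auto intro: supp.intros)
qed

text \<open>Backwards, the oracle consists of the c with \<open>Oc c\<close> in T. Climbing through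
  \<open>sT\<close> yields for every m a statement that e has value 1; e is total, so a genuine
  value exists, and \<open>supported_Ev\<close> equates the two.\<close>

lemma sigma11_iff_supported:
  assumes R: "\<And>C m l w. reval C e [m, l, w] (if R C m l w then 1 else 0)"
  shows "(\<exists>C. \<forall>m. \<exists>l. R C m l w) \<longleftrightarrow> (\<exists>T. Top (code e) w 0 \<in> T \<and> (\<forall>t\<in>T. supp T t))"
proof
  assume "\<exists>C. \<forall>m. \<exists>l. R C m l w"
  then obtain C where C: "\<And>m. \<exists>l. R C m l w" by blast
  have "\<exists>l. reval C e [m, l, w] 1" for m using C[of m] R[of C m _ w] by (metis (full_types))
  then have "\<forall>t\<in>true_facts C e w. supp (true_facts C e w) t" by (auto intro: supp_true_facts)
  then show "\<exists>T. Top (code e) w 0 \<in> T \<and> (\<forall>t\<in>T. supp T t)"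
    by (auto intro: true_facts.intros)
next
  assume "\<exists>T. Top (code e) w 0 \<in> T \<and> (\<forall>t\<in>T. supp T t)"
  then obtain T where top: "Top (code e) w 0 \<in> T" and T: "\<And>t. t \<in> T \<Longrightarrow> supp T t" by blast
  have step: "\<exists>l. Ev (code e) (list_encode [m, l, w]) 1 \<in> T \<and> Top (code e) w (Suc m) \<in> T"
    if "Top (code e) w m \<in> T" for m
    using T[OF that] by cases auto
  have "Top (code e) w m \<in> T" for m by (induction m) (use top step in auto)
  then have "\<exists>l. Ev (code e) (list_encode [m, l, w]) 1 \<in> T" for m using step by blast
  then have "\<exists>l. R {c. Oc c \<in> T} m l w" for m
    using supported_Ev[OF T R[of _ m _ w]] by (metis zero_neq_one)
  then show "\<exists>C. \<forall>m. \<exists>l. R C m l w" by blast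
qed

section \<open>Evaluation rules as clauses of a formula\<close>

definition clause :: "tm \<Rightarrow> tm list \<Rightarrow> fm" where
  "clause h bs = And (Eq TM h) (Conj (map In bs))"

lemma fval_clause [simp]: "fval T n m l (clause h bs) \<longleftrightarrow>
    m = tval n m l h \<and> (\<forall>b\<in>set bs. tval n m l b \<in> T)"
  by (auto simp: clause_def)

abbreviation tcons :: "tm \<Rightarrow> tm \<Rightarrow> tm" where "tcons a b \<equiv> TS (TP a b)"
abbreviation Xv :: "nat \<Rightarrow> tm" where "Xv \<equiv> tproj TL"

text \<open>One disjunct per rule of \<open>supp\<close>, in the same order: m is the encoded
  conclusion and the \<open>Xv i\<close> are the variables of the rule. No rule needs more than six
  of them.\<close>

definition supp_fm :: fm where
  "supp_fm = Disj
    [clause (tfact 0 (TP TZ TZ) (Xv 0) TZ) [],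
     clause (tfact 0 (TP (tnum 1) TZ) (Xv 0) (TS (Xv 1))) [tfact 2 (Xv 0) TZ (Xv 1)],
     clause (tfact 0 (TP (tnum 2) (Xv 2)) (Xv 0) (Xv 1)) [tfact 2 (Xv 0) (Xv 2) (Xv 1)],
     clause (tfact 0 (TP (tnum 3) TZ) (Xv 0) (tnum 1)) [tfact 2 (Xv 0) TZ (Xv 1), tfact 5 (Xv 1) TZ TZ],
     And (clause (tfact 0 (TP (tnum 3) TZ) (Xv 0) TZ) [tfact 2 (Xv 0) TZ (Xv 1)])
       (Neg (In (tfact 5 (Xv 1) TZ TZ))),
     clause (tfact 0 (TP (tnum 4) (TP (Xv 0) (Xv 1))) (Xv 2) (Xv 3))
       [tfact 6 (Xv 1) (Xv 2) (Xv 4), tfact 0 (Xv 0) (Xv 4) (Xv 3)],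
     clause (tfact 0 (TP (tnum 5) (TP (Xv 0) (Xv 1))) (tcons TZ (Xv 2)) (Xv 3))
       [tfact 0 (Xv 0) (Xv 2) (Xv 3)],
     clause (tfact 0 (TP (tnum 5) (TP (Xv 0) (Xv 1))) (tcons (TS (Xv 4)) (Xv 2)) (Xv 3))
       [tfact 0 (TP (tnum 5) (TP (Xv 0) (Xv 1))) (tcons (Xv 4) (Xv 2)) (Xv 5),
        tfact 0 (Xv 1) (tcons (Xv 5) (tcons (Xv 4) (Xv 2))) (Xv 3)],
     clause (tfact 0 (TP (tnum 6) (Xv 0)) (Xv 1) (Xv 2))
       [tfact 0 (Xv 0) (tcons (Xv 2) (Xv 1)) TZ, tfact 3 (Xv 0) (Xv 1) (Xv 2)],
     clause (tfact 3 (Xv 0) (Xv 1) TZ) [],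
     clause (tfact 3 (Xv 0) (Xv 1) (TS (Xv 2)))
       [tfact 0 (Xv 0) (tcons (Xv 2) (Xv 1)) (TS (Xv 3)), tfact 3 (Xv 0) (Xv 1) (Xv 2)],
     clause (tfact 6 TZ (Xv 0) TZ) [],
     clause (tfact 6 (tcons (Xv 0) (Xv 1)) (Xv 2) (tcons (Xv 3) (Xv 4)))
       [tfact 0 (Xv 0) (Xv 2) (Xv 3), tfact 6 (Xv 1) (Xv 2) (Xv 4)],
     clause (tfact 2 TZ (Xv 0) TZ) [],
     clause (tfact 2 (tcons (Xv 0) (Xv 1)) TZ (Xv 0)) [],
     clause (tfact 2 (tcons (Xv 0) (Xv 1)) (TS (Xv 2)) (Xv 3)) [tfact 2 (Xv 1) (Xv 2) (Xv 3)],
     clause (tfact 4 (Xv 0) (Xv 1) (Xv 2))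
       [tfact 0 (Xv 0) (tcons (Xv 2) (tcons (Xv 3) (tcons (Xv 1) TZ))) (tnum 1),
        tfact 4 (Xv 0) (Xv 1) (TS (Xv 2))],
     clause (tfact 5 (Xv 0) TZ TZ) []]"

lemma pproj_ptuple6:
  "pproj (ptuple [a, b, c, d, e, f]) 0 = a" "pproj (ptuple [a, b, c, d, e, f]) (Suc 0) = b"
  "pproj (ptuple [a, b, c, d, e, f]) 2 = c" "pproj (ptuple [a, b, c, d, e, f]) 3 = d"
  "pproj (ptuple [a, b, c, d, e, f]) 4 = e" "pproj (ptuple [a, b, c, d, e, f]) 5 = f"
  by (simp_all add: pproj_ptuple)

lemma supp_iff: "supp T m \<longleftrightarrow> (\<exists>l. fval T n m l supp_fm)"
proof
  have wit: "\<exists>l. fval T n m l supp_fm" if "fval T n m (ptuple [a, b, c, d, e, f]) supp_fm"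
    for a b c d e f using that by blast
  assume "supp T m"
  then show "\<exists>l. fval T n m l supp_fm"
  proof cases
    case (sZ xs)
    show ?thesis by (rule wit[of xs]) (simp add: supp_fm_def pproj_ptuple6 sZ)
  next
    case (sS xs y)
    show ?thesis by (rule wit[of xs y]) (simp add: supp_fm_def pproj_ptuple6 sS)
  next
    case (sP xs i y)
    show ?thesis by (rule wit[of xs y i]) (simp add: supp_fm_def pproj_ptuple6 sP)
  next
    case (sO1 xs c)
    show ?thesis by (rule wit[of xs c]) (use sO1 in \<open>simp add: supp_fm_def pproj_ptuple6\<close>)
  next
    case (sO0 xs c)
    show ?thesis by (rule wit[of xs c]) (use sO0 in \<open>simp add: supp_fm_def pproj_ptuple6\<close>)
  next
    case (sC gs xs ys f z)
    show ?thesis by (rule wit[of f gs xs z ys]) (use sC in \<open>simp add: supp_fm_def pproj_ptuple6\<close>)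
  next
    case (sR0 f xs z g)
    show ?thesis by (rule wit[of f g xs z]) (use sR0 in \<open>simp add: supp_fm_def pproj_ptuple6\<close>)
  next
    case (sRS f g n xs y z)
    show ?thesis by (rule wit[of f g xs z n y]) (use sRS in \<open>simp add: supp_fm_def pproj_ptuple6\<close>)
  next
    case (sM g y xs)
    show ?thesis by (rule wit[of g xs y]) (use sM in \<open>simp add: supp_fm_def pproj_ptuple6\<close>)
  next
    case (sB0 g xs)
    show ?thesis by (rule wit[of g xs]) (use sB0 in \<open>simp add: supp_fm_def pproj_ptuple6\<close>)
  next
    case (sBS g y xs v)
    show ?thesis by (rule wit[of g xs y v]) (use sBS in \<open>simp add: supp_fm_def pproj_ptuple6\<close>)
  next
    case (sL0 xs)
    show ?thesis by (rule wit[of xs]) (use sL0 in \<open>simp add: supp_fm_def pproj_ptuple6\<close>)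
  next
    case (sLS g xs y gs ys)
    show ?thesis by (rule wit[of g gs xs y ys]) (use sLS in \<open>simp add: supp_fm_def pproj_ptuple6\<close>)
  next
    case (sA i)
    show ?thesis by (rule wit[of i]) (use sA in \<open>simp add: supp_fm_def pproj_ptuple6\<close>)
  next
    case (sA0 x xs)
    show ?thesis by (rule wit[of x xs]) (use sA0 in \<open>simp add: supp_fm_def pproj_ptuple6\<close>)
  next
    case (sAS xs i y x)
    show ?thesis by (rule wit[of x xs i y]) (use sAS in \<open>simp add: supp_fm_def pproj_ptuple6\<close>)
  next
    case (sT e m l w)
    show ?thesis by (rule wit[of e w m l]) (use sT in \<open>simp add: supp_fm_def pproj_ptuple6\<close>)
  next
    case (sO c)
    show ?thesis by (rule wit[of c]) (use sO in \<open>simp add: supp_fm_def pproj_ptuple6\<close>)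
  qed
next
  assume "\<exists>l. fval T n m l supp_fm"
  then obtain l where "fval T n m l supp_fm" ..
  then show "supp T m"
    unfolding supp_fm_def fval_Disj
    by (auto simp del: One_nat_def intro: supp.intros)
qed

text \<open>The variable m serves twice, for the root statement r and for the members of T. The root
  is passed as \<open>Suc r\<close> to keep the machine's input positive, which lets the display
  leave the origin cell free of marks.\<close>

definition univ_fm :: fm where
  "univ_fm = And (Imp (Eq (TS TM) TN) (In TM)) (Imp (In TM) supp_fm)"

lemma supported_iff_univ_fm:
  "(r \<in> T \<and> (\<forall>t\<in>T. supp T t)) \<longleftrightarrow> (\<forall>m. \<exists>l. fval T (Suc r) m l univ_fm)"
  unfolding univ_fm_def by (auto simp: supp_iff[of T _ "Suc r"])

section \<open>Recursive functions\<close>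

text \<open>Total and uniform in the oracle, as \<open>recursive_pred\<close> demands.\<close>

definition definable :: "nat \<Rightarrow> (nat set \<Rightarrow> nat list \<Rightarrow> nat) \<Rightarrow> bool" where
  "definable a F \<longleftrightarrow> (\<exists>e. \<forall>C xs. length xs = a \<longrightarrow> reval C e xs (F C xs))"

lemma definable_cong:
  assumes "definable a F" and "\<And>C xs. length xs = a \<Longrightarrow> F C xs = G C xs"
  shows "definable a G"
  using assms unfolding definable_def by metis

lemma definable_comp:
  assumes F: "definable (length Gs) F" and Gs: "\<forall>G\<in>set Gs. definable a G"
  shows "definable a (\<lambda>C xs. F C (map (\<lambda>G. G C xs) Gs))"
proof -
  obtain f where f: "\<And>C xs. length xs = length Gs \<Longrightarrow> reval C f xs (F C xs)"
    using F unfolding definable_def by blast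
  obtain h where h: "\<And>G C xs. G \<in> set Gs \<Longrightarrow> length xs = a \<Longrightarrow> reval C (h G) xs (G C xs)"
    using Gs unfolding definable_def by metis
  have "reval C (Comp f (map h Gs)) xs (F C (map (\<lambda>G. G C xs) Gs))" if "length xs = a" for C xs
    by (rule reval.comp[where ys = "map (\<lambda>G. G C xs) Gs"])
      (use h that f in \<open>auto simp: list_all2_conv_all_nth\<close>)
  then show ?thesis unfolding definable_def by blast
qed

lemma definable_comp1:
  assumes "definable 1 (\<lambda>C xs. F (xs ! 0))" "definable a G"
  shows "definable a (\<lambda>C xs. F (G C xs))"
  using definable_comp[of "[G]" "\<lambda>C xs. F (xs ! 0)" a] assms by simp

lemma definable_comp2:
  assumes "definable 2 (\<lambda>C xs. F (xs ! 0) (xs ! 1))" "definable a G" "definable a H"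
  shows "definable a (\<lambda>C xs. F (G C xs) (H C xs))"
  using definable_comp[of "[G, H]" "\<lambda>C xs. F (xs ! 0) (xs ! 1)" a] assms
  by (simp add: numeral_2_eq_2)

lemma definable_proj: "i < a \<Longrightarrow> definable a (\<lambda>C xs. xs ! i)"
  unfolding definable_def by (intro exI[of _ "Proj i"]) (metis arg_def reval.proj)

lemma definable_Suc:
  assumes "definable a G" shows "definable a (\<lambda>C xs. Suc (G C xs))"
proof (rule definable_comp1[OF _ assms])
  have "reval C Succ xs (Suc (xs ! 0))" if "length xs = 1" for C xs
    using reval.succ[of C xs] that by (simp add: arg_def)
  then show "definable 1 (\<lambda>C xs. Suc (xs ! 0))"
    unfolding definable_def by blast
qed

lemma definable_const: "definable a (\<lambda>C xs. c)"
proof (induction c)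
  case 0 show ?case unfolding definable_def by (auto intro: reval.zero)
qed (rule definable_Suc)

lemma definable_oracle:
  assumes "definable a G"
  shows "definable a (\<lambda>C xs. if G C xs \<in> C then 1 else 0)"
proof -
  have "reval C Orc xs (if xs ! 0 \<in> C then 1 else 0)" if "length xs = 1" for C xs
    using reval.orc[of C xs] that by (simp add: arg_def)
  then have "definable (length [G]) (\<lambda>C xs. if xs ! 0 \<in> C then 1 else 0)"
    unfolding definable_def by (intro exI[of _ Orc]) simp
  from definable_comp[OF this, of a] assms show ?thesis by simp
qed

lemma definable_rec:
  assumes F: "definable a F" and N: "definable a N" and G: "definable (Suc (Suc a)) G"
    and H0: "\<And>C xs. length xs = a \<Longrightarrow> H C xs 0 = F C xs"
    and HS: "\<And>C xs n. length xs = a \<Longrightarrow> H C xs (Suc n) = G C (H C xs n # n # xs)"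
  shows "definable a (\<lambda>C xs. H C xs (N C xs))"
proof -
  obtain f where f: "\<And>C xs. length xs = a \<Longrightarrow> reval C f xs (F C xs)"
    using F unfolding definable_def by blast
  obtain g where g: "\<And>C xs. length xs = Suc (Suc a) \<Longrightarrow> reval C g xs (G C xs)"
    using G unfolding definable_def by blast
  have "reval C (Prim f g) (n # xs) (H C xs n)" if "length xs = a" for C xs n
  proof (induction n)
    case 0 show ?case using f[OF that] H0[OF that] by (auto intro: reval.prim0)
  next
    case (Suc n)
    have "reval C g (H C xs n # n # xs) (H C xs (Suc n))" unfolding HS[OF that] by (rule g) (simp add: that)
    with Suc show ?case by (rule reval.primS)
  qed
  then have "definable (Suc a) (\<lambda>C ys. H C (tl ys) (hd ys))"
    unfolding definable_def
    by (intro exI[of _ "Prim f g"]) (metis length_Suc_conv list.sel(1) list.sel(3))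
  \<comment> \<open>\<open>Prim\<close> recurses on the head of its argument list; projections
    rebuild the parameters behind it.\<close>
  then have "definable (length (N # map (\<lambda>i C xs. xs ! i) [0..<a])) (\<lambda>C ys. H C (tl ys) (hd ys))"
    by simp
  from definable_comp[OF this, of a] N
  have "definable a (\<lambda>C xs. H C (map (\<lambda>i. xs ! i) [0..<a]) (N C xs))"
    by (auto simp: definable_proj comp_def)
  then show ?thesis by (rule definable_cong) (metis map_nth)
qed

lemma definable_add:
  assumes "definable a G" "definable a H" shows "definable a (\<lambda>C xs. G C xs + H C xs)"
proof (rule definable_comp2[OF _ assms])
  show "definable 2 (\<lambda>C xs. xs ! 0 + xs ! 1)"
    by (rule definable_rec[where H = "\<lambda>C xs n. n + xs ! 1" and N = "\<lambda>C xs. xs ! 0"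
          and F = "\<lambda>C xs. xs ! 1" and G = "\<lambda>C xs. Suc (xs ! 0)"])
      (auto intro!: definable_proj definable_Suc)
qed

lemma definable_sub:
  assumes "definable a G" "definable a H" shows "definable a (\<lambda>C xs. G C xs - H C xs)"
proof (rule definable_comp2[OF _ assms])
  have pred: "definable 1 (\<lambda>C xs. xs ! 0 - Suc 0)"
    by (rule definable_rec[where H = "\<lambda>C xs n. n - Suc 0" and N = "\<lambda>C xs. xs ! 0"
          and F = "\<lambda>C xs. 0" and G = "\<lambda>C xs. xs ! 1"])
      (auto intro: definable_proj definable_const)
  show "definable 2 (\<lambda>C xs. xs ! 0 - xs ! 1)"
    by (rule definable_rec[where H = "\<lambda>C xs n. xs ! 0 - n" and N = "\<lambda>C xs. xs ! 1"
          and F = "\<lambda>C xs. xs ! 0" and G = "\<lambda>C xs. xs ! 0 - Suc 0"])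
      (auto intro!: definable_proj definable_comp1[where F = "\<lambda>n. n - Suc 0", OF pred])
qed

lemma definable_mult_const:
  assumes "definable a G" shows "definable a (\<lambda>C xs. k * G C xs)"
proof (rule definable_comp1[OF _ assms])
  show "definable 1 (\<lambda>C xs. k * xs ! 0)"
    by (rule definable_rec[where H = "\<lambda>C xs n. k * n" and N = "\<lambda>C xs. xs ! 0"
          and F = "\<lambda>C xs. 0" and G = "\<lambda>C xs. k + xs ! 0"])
      (auto intro: definable_proj definable_const definable_add)
qed

lemma definable_triangle:
  assumes "definable a G" shows "definable a (\<lambda>C xs. triangle (G C xs))"
proof (rule definable_comp1[OF _ assms])
  show "definable 1 (\<lambda>C xs. triangle (xs ! 0))"
    by (rule definable_rec[where H = "\<lambda>C xs n. triangle n" and N = "\<lambda>C xs. xs ! 0"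
          and F = "\<lambda>C xs. 0" and G = "\<lambda>C xs. xs ! 0 + Suc (xs ! 1)"])
      (auto intro!: definable_proj definable_const definable_add definable_Suc)
qed

lemma definable_prod_encode:
  assumes "definable a G" "definable a H" shows "definable a (\<lambda>C xs. pr (G C xs) (H C xs))"
  unfolding prod_encode_def using assms by (auto intro!: definable_add definable_triangle)

lemma definable_eq:
  assumes "definable a G" "definable a H" shows "definable a (\<lambda>C xs. if G C xs = H C xs then 1 else 0)"
proof -
  have "definable a (\<lambda>C xs. 1 - ((G C xs - H C xs) + (H C xs - G C xs)))"
    using assms by (intro definable_sub definable_add definable_const)
  then show ?thesis by (rule definable_cong) auto
qed

text \<open>The index of the Cantor diagonal through z, that is, the largest d with
  \<open>triangle d\<close> at most z, in a form to which \<open>definable_rec\<close>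
  applies.\<close>

primrec diag :: "nat \<Rightarrow> nat" where
  "diag 0 = 0"
| "diag (Suc z) = diag z + (if triangle (Suc (diag z)) = Suc z then 1 else 0)"

lemma diag_bounds: "triangle (diag z) \<le> z \<and> z < triangle (Suc (diag z))"
  by (induction z) auto

text \<open>As \<open>prod_encode (a, b)\<close> is \<open>triangle (a + b) + a\<close>, the first
  component is the offset of z on its diagonal.\<close>

lemma prod_decode_diag:
  "prod_decode z = (z - triangle (diag z), diag z - (z - triangle (diag z)))"
proof -
  have "z - triangle (diag z) \<le> diag z" and "triangle (diag z) \<le> z"
    using diag_bounds[of z] by auto
  then have "prod_encode (z - triangle (diag z), diag z - (z - triangle (diag z))) = z"
    by (simp add: prod_encode_def)
  then show ?thesis by (metis prod_encode_inverse)
qed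

lemma definable_diag:
  assumes "definable a G" shows "definable a (\<lambda>C xs. diag (G C xs))"
proof (rule definable_comp1[OF _ assms])
  show "definable 1 (\<lambda>C xs. diag (xs ! 0))"
    by (rule definable_rec[where H = "\<lambda>C xs n. diag n" and N = "\<lambda>C xs. xs ! 0" and F = "\<lambda>C xs. 0"
          and G = "\<lambda>C xs. xs ! 0 + (if triangle (Suc (xs ! 0)) = Suc (xs ! 1) then 1 else 0)"])
      (auto intro!: definable_proj definable_const definable_add definable_Suc definable_eq
        definable_triangle simp del: triangle_Suc)
qed

lemma definable_pfst:
  assumes "definable a G" shows "definable a (\<lambda>C xs. pfst (G C xs))"
  unfolding prod_decode_diag using assms
  by (auto intro!: definable_sub definable_triangle definable_diag)

lemma definable_psnd:
  assumes "definable a G" shows "definable a (\<lambda>C xs. psnd (G C xs))"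
  unfolding prod_decode_diag using assms
  by (auto intro!: definable_sub definable_triangle definable_diag)

lemma definable_tval:
  "definable 3 (\<lambda>C xs. tval (xs ! 2) (xs ! 0) (xs ! 1) s)"
  by (induction s)
    (auto intro!: definable_proj definable_const definable_Suc definable_prod_encode
      definable_pfst definable_psnd)

lemma definable_fval:
  "definable 3 (\<lambda>C xs. if fval C (xs ! 2) (xs ! 0) (xs ! 1) f then 1 else 0)"
proof (induction f)
  case (Eq s t)
  show ?case using definable_eq[OF definable_tval definable_tval, of s t] by simp
next
  case (In s)
  show ?case using definable_oracle[OF definable_tval, of s] by simp
next
  case (Nand f g)
  have "definable 3 (\<lambda>C xs. 1 - (1 - ((1 - (if fval C (xs ! 2) (xs ! 0) (xs ! 1) f then 1 else 0))
      + (1 - (if fval C (xs ! 2) (xs ! 0) (xs ! 1) g then 1 else 0)))))"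
    by (intro definable_sub definable_add definable_const Nand)
  then show ?case by (rule definable_cong) auto
qed

lemma sigma11_fm:
  assumes "\<And>n. n \<in> P \<longleftrightarrow> (\<exists>C. \<forall>m. \<exists>l. fval C n m l \<phi>)"
  shows "sigma11 P"
proof -
  obtain e where e: "\<And>C xs. length xs = 3 \<Longrightarrow>
      reval C e xs (if fval C (xs ! 2) (xs ! 0) (xs ! 1) \<phi> then 1 else 0)"
    using definable_fval[of \<phi>] unfolding definable_def by blast
  have "reval C e [m, l, w] (if fval C w m l \<phi> then 1 else 0)" for C m l w
    using e[of "[m, l, w]" C] by (simp add: numeral_2_eq_2)
  then have "recursive_pred (\<lambda>C m l w. fval C w m l \<phi>)"
    unfolding recursive_pred_def by blast
  with assms show ?thesis unfolding sigma11_def by blast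
qed

lemma computable_if_definable: "definable 1 (\<lambda>C xs. g (xs ! 0)) \<Longrightarrow> computable g"
  unfolding definable_def computable_def by (metis One_nat_def length_Cons list.size(3) nth_Cons_0)

section \<open>The language of an asymptotic set\<close>

lemma compact_full_shift: "compact (full_shift k)"
proof -
  have "compactin (product_topology (\<lambda>i::int. euclidean :: nat topology) UNIV) (PiE UNIV (\<lambda>i. {..<k}))"
    by (subst compactin_PiE) (auto simp: finite_imp_compact)
  moreover have "PiE UNIV (\<lambda>i::int. {..<k}) = full_shift k"
    by (auto simp: full_shift_def PiE_def Pi_def)
  ultimately show ?thesis by (simp add: euclidean_product_topology)
qed

text \<open>The cylinder U of w is clopen. Openness turns a limit point in U into visits to U;
  closedness and compactness turn infinitely many visits into a limit point in U.\<close>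

lemma language_asymptotic_iff:
  assumes f: "f ` full_shift k \<subseteq> full_shift k"
  shows "w \<in> language (asymptotic_set k f) \<longleftrightarrow>
    (\<exists>x\<in>full_shift k. \<forall>n. \<exists>j\<ge>n. \<forall>i<length w. (f ^^ j) x (int i) = w ! i)" (is "_ \<longleftrightarrow> ?R")
proof -
  define U where "U = {z :: int \<Rightarrow> nat. \<forall>i<length w. z (int i) = w ! i}"
  have U: "U = (\<Inter>i\<in>{..<length w}. (\<lambda>z. z (int i)) -` {w ! i})" by (auto simp: U_def)
  have "open U" unfolding U
    by (intro open_INT ballI open_vimage) (auto simp: open_discrete)
  have "closed U" unfolding U
    by (intro closed_INT ballI closed_vimage) auto
  have orbit: "(f ^^ j) x \<in> full_shift k" if "x \<in> full_shift k" for x j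
    using that f by (induction j) auto
  show ?thesis
  proof
    assume "w \<in> language (asymptotic_set k f)"
    then obtain y n x where w: "w = map (\<lambda>i. y (int i)) [0..<n]" and x: "x \<in> full_shift k"
      and y: "\<And>n. y \<in> closure {(f ^^ j) x | j. j \<ge> n}"
      unfolding language_def asymptotic_set_def by blast
    have "y \<in> U" by (simp add: U_def w)
    have "\<exists>j\<ge>n. (f ^^ j) x \<in> U" for n
      using open_Int_closure_eq_empty[OF \<open>open U\<close>, of "{(f ^^ j) x | j. j \<ge> n}"] y[of n] \<open>y \<in> U\<close> by blast
    then show ?R using x by (auto simp: U_def)
  next
    assume ?R
    then obtain x where x: "x \<in> full_shift k" and rec: "\<And>n. \<exists>j\<ge>n. (f ^^ j) x \<in> U"
      unfolding U_def by auto
    \<comment> \<open>Only visits to U are collected, so that a common limit point lies in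
      U.\<close>
    define B where "B n = closure {(f ^^ j) x | j. j \<ge> n \<and> (f ^^ j) x \<in> U}" for n
    have "full_shift k \<inter> \<Inter> (B ` UNIV) \<noteq> {}"
    proof (rule compact_imp_fip_image[OF compact_full_shift])
      show "closed (B n)" for n by (simp add: B_def)
      fix I :: "nat set" assume "finite I"
      then obtain b where b: "\<And>i. i \<in> I \<Longrightarrow> i \<le> b" using finite_nat_set_iff_bounded_le by auto
      obtain j where j: "j \<ge> b" "(f ^^ j) x \<in> U" using rec by blast
      have "(f ^^ j) x \<in> B i" if "i \<in> I" for i
        unfolding B_def using j b[OF that] by (intro closure_subset[THEN subsetD]) auto
      then show "full_shift k \<inter> \<Inter> (B ` I) \<noteq> {}" using orbit[OF x, of j] by blast
    qed
    then obtain y where y: "\<And>n. y \<in> B n" by blast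
    have "B n \<subseteq> closure {(f ^^ j) x | j. j \<ge> n}" for n
      unfolding B_def by (rule closure_mono) auto
    then have "y \<in> asymptotic_set k f" using y x unfolding asymptotic_set_def by blast
    moreover have "B 0 \<subseteq> U"
      unfolding B_def by (rule closure_minimal) (auto simp: \<open>closed U\<close>)
    then have "y \<in> U" using y by blast
    then have "w = map (\<lambda>i. y (int i)) [0..<length w]" by (auto simp: U_def intro: nth_equalityI)
    ultimately show "w \<in> language (asymptotic_set k f)" unfolding language_def by blast
  qed
qed

section \<open>Radius-one rules and codes of words\<close>

definition radius1 :: "(nat \<Rightarrow> nat \<Rightarrow> nat \<Rightarrow> nat) \<Rightarrow> (int \<Rightarrow> nat) \<Rightarrow> int \<Rightarrow> nat" where
  "radius1 \<rho> x i = \<rho> (x (i - 1)) (x i) (x (i + 1))"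

lemma funpow_radius1_Suc: "(radius1 \<rho> ^^ Suc t) x i =
    \<rho> ((radius1 \<rho> ^^ t) x (i - 1)) ((radius1 \<rho> ^^ t) x i) ((radius1 \<rho> ^^ t) x (i + 1))"
  by (simp add: radius1_def)

lemma cellular_automaton_radius1:
  assumes "1 \<le> k" and "\<And>a b c. a < k \<Longrightarrow> b < k \<Longrightarrow> c < k \<Longrightarrow> \<rho> a b c < k"
  shows "cellular_automaton k (radius1 \<rho>)"
proof -
  have "continuous_on (full_shift k) (\<lambda>x. radius1 \<rho> x i)" for i
  proof -
    have "continuous_on (full_shift k) (\<lambda>x. ((x (i - 1), x i), x (i + 1)))"
      by (intro continuous_on_Pair) (auto intro: continuous_on_subset[OF continuous_on_product_coordinates])
    moreover have "continuous_on UNIV (\<lambda>((a, b), c). \<rho> a b c)"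
    proof -
      have "open (S :: ((nat \<times> nat) \<times> nat) set)" for S
      proof -
        have "S = (\<Union>p\<in>S. ({fst (fst p)} \<times> {snd (fst p)}) \<times> {snd p})" by auto
        also have "open \<dots>" by (intro open_UN ballI open_Times open_discrete)
        finally show ?thesis .
      qed
      then show ?thesis by (simp add: continuous_on_open_vimage)
    qed
    ultimately have "continuous_on (full_shift k) ((\<lambda>((a, b), c). \<rho> a b c) \<circ> (\<lambda>x. ((x (i - 1), x i), x (i + 1))))"
      by (intro continuous_on_compose) (auto intro: continuous_on_subset)
    then show ?thesis by (simp add: o_def radius1_def)
  qed
  then have "continuous_on (full_shift k) (radius1 \<rho>)"
    by (rule continuous_on_coordinatewise_then_product)
  then show ?thesis
    using assms unfolding cellular_automaton_def
    by (auto simp: full_shift_def radius1_def shift_def algebra_simps)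
qed

text \<open>The residue modulo k recovers the first letter. Outside the alphabet this fails: the
  one-letter word k and the word 0, 0 both have code k + 1. Hence letters have to be tracked
  wherever codes are compared.\<close>

lemma word_code_inj:
  assumes "1 \<le> k" "set v \<subseteq> {..<k}" "set w \<subseteq> {..<k}" "word_code k v = word_code k w"
  shows "v = w"
  using assms(2-)
proof (induction v arbitrary: w)
  case Nil then show ?case by (cases w) auto
next
  case (Cons a v)
  then obtain b w' where w: "w = b # w'" by (cases w) auto
  with Cons.prems have eq: "a + k * word_code k v = b + k * word_code k w'" and "a < k" "b < k" by auto
  from arg_cong[OF eq, of "\<lambda>n. n mod k"] \<open>a < k\<close> \<open>b < k\<close> have "a = b" by simp
  with eq \<open>a < k\<close> have "word_code k v = word_code k w'" by simp
  with Cons w \<open>a = b\<close> show ?case by simp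
qed

text \<open>\<open>Cl t u v a\<close> records symbol \<open>a\<close> at time \<open>t\<close> and position \<open>u - v\<close>, \<open>Mt t i q\<close> says that the word
  with code \<open>q\<close> is visible at time \<open>t\<close> from position \<open>i\<close> on, \<open>Ml q z\<close> means \<open>z = k * q\<close> and \<open>Ge t n\<close> means
  \<open>n \<le> t\<close>. Guessing the whole space-time diagram makes all remaining conditions local.\<close>

abbreviation "Cl t u v a \<equiv> fact4 0 t (pr u v) a"
abbreviation "Mt \<equiv> fact4 6"
abbreviation "Ml q z \<equiv> fact4 2 q z 0"
abbreviation "Ge j i \<equiv> fact4 3 j i 0"

text \<open>\<open>tot\<close> concerns time 0 only, since \<open>step\<close> determines the later
  rows. For the auxiliary statements only soundness is required, by reduction to smaller ones; the
  instances that must be present are asserted by \<open>recur\<close>.\<close>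

locale ca_local =
  fixes k :: nat and \<rho> :: "nat \<Rightarrow> nat \<Rightarrow> nat \<Rightarrow> nat" and C :: "nat set" and N :: nat
  assumes tot: "\<exists>a<k. Cl 0 u v a \<in> C"
    and uniq: "Cl t u v a \<in> C \<Longrightarrow> Cl t u v b \<in> C \<Longrightarrow> a = b"
    and diag: "Cl t u v a \<in> C \<Longrightarrow> Cl t (Suc u) (Suc v) a \<in> C"
    and step: "a < k \<Longrightarrow> b < k \<Longrightarrow> c < k \<Longrightarrow> Cl t u (Suc v) a \<in> C \<Longrightarrow> Cl t u v b \<in> C \<Longrightarrow>
      Cl t (Suc u) v c \<in> C \<Longrightarrow> Cl (Suc t) u v (\<rho> a b c) \<in> C"
    and match: "Mt t i q \<in> C \<Longrightarrow> q = 0 \<or> (\<exists>r z. \<exists>a<k. q = Suc a + z \<and> Ml r z \<in> C \<and> Cl t i 0 a \<in> C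
      \<and> Mt t (Suc i) r \<in> C)"
    and mult: "Ml r z \<in> C \<Longrightarrow> (r = 0 \<and> z = 0) \<or> (\<exists>r' z'. r = Suc r' \<and> z = k + z' \<and> Ml r' z' \<in> C)"
    and recur: "\<exists>t. Mt t 0 N \<in> C \<and> Ge t n \<in> C"
    and geq: "Ge t n \<in> C \<Longrightarrow> n = 0 \<or> (\<exists>t' n'. t = Suc t' \<and> n = Suc n' \<and> Ge t' n' \<in> C)"

inductive_set ca_facts :: "nat \<Rightarrow> (nat \<Rightarrow> nat \<Rightarrow> nat \<Rightarrow> nat) \<Rightarrow> (int \<Rightarrow> nat) \<Rightarrow> nat set" for k \<rho> x where
  "a = (radius1 \<rho> ^^ t) x (int u - int v) \<Longrightarrow> Cl t u v a \<in> ca_facts k \<rho> x"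
| "z = k * r \<Longrightarrow> Ml r z \<in> ca_facts k \<rho> x"
| "n \<le> t \<Longrightarrow> Ge t n \<in> ca_facts k \<rho> x"
| "q = word_code k w \<Longrightarrow> \<forall>j<length w. (radius1 \<rho> ^^ t) x (int (i + j)) = w ! j \<Longrightarrow>
    Mt t i q \<in> ca_facts k \<rho> x"

lemma ca_facts_iff:
  "Cl t u v a \<in> ca_facts k \<rho> x \<longleftrightarrow> a = (radius1 \<rho> ^^ t) x (int u - int v)"
  "Ml r z \<in> ca_facts k \<rho> x \<longleftrightarrow> z = k * r"
  "Ge t n \<in> ca_facts k \<rho> x \<longleftrightarrow> n \<le> t"
  "Mt t i q \<in> ca_facts k \<rho> x \<longleftrightarrow>
    (\<exists>w. q = word_code k w \<and> (\<forall>j<length w. (radius1 \<rho> ^^ t) x (int (i + j)) = w ! j))"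
  by (auto intro: ca_facts.intros elim!: ca_facts.cases)

lemma funpow_radius1_full_shift:
  assumes "\<And>a b c. a < k \<Longrightarrow> b < k \<Longrightarrow> c < k \<Longrightarrow> \<rho> a b c < k" "x \<in> full_shift k"
  shows "(radius1 \<rho> ^^ t) x i < k"
  using assms by (induction t arbitrary: i) (auto simp: full_shift_def radius1_def)

text \<open>Backwards, row 0 of the guessed diagram yields a configuration, and \<open>uniq\<close>
  makes every recorded symbol the one that the automaton really produces.\<close>

lemma lang_code_iff_ca_local:
  assumes k: "1 \<le> k" and \<rho>: "\<And>a b c. a < k \<Longrightarrow> b < k \<Longrightarrow> c < k \<Longrightarrow> \<rho> a b c < k"
  shows "N \<in> lang_code k (language (asymptotic_set k (radius1 \<rho>))) \<longleftrightarrow> (\<exists>C. ca_local k \<rho> C N)"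
    (is "?L \<longleftrightarrow> ?R")
proof -
  have stable: "radius1 \<rho> ` full_shift k \<subseteq> full_shift k"
    using \<rho> by (auto simp: full_shift_def radius1_def)
  show ?thesis
  proof
    assume ?L
    then obtain w x where N: "N = word_code k w" and x: "x \<in> full_shift k"
      and rec: "\<And>n. \<exists>j\<ge>n. \<forall>i<length w. (radius1 \<rho> ^^ j) x (int i) = w ! i"
      unfolding lang_code_def using language_asymptotic_iff[OF stable] by blast
    note bnd = funpow_radius1_full_shift[OF \<rho> x]
    have "ca_local k \<rho> (ca_facts k \<rho> x) N"
    proof (unfold_locales, unfold ca_facts_iff)
      fix u v show "\<exists>a<k. a = (radius1 \<rho> ^^ 0) x (int u - int v)" using bnd[where t = 0] by auto
    next
      fix t i q assume "\<exists>w. q = word_code k w \<and> (\<forall>j<length w. (radius1 \<rho> ^^ t) x (int (i + j)) = w ! j)"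
      then obtain w where w: "q = word_code k w" "\<And>j. j<length w \<Longrightarrow> (radius1 \<rho> ^^ t) x (int (i + j)) = w ! j" by blast
      show "q = 0 \<or> (\<exists>r z. \<exists>a<k. q = Suc a + z \<and> z = k * r \<and> a = (radius1 \<rho> ^^ t) x (int i - int 0) \<and>
        (\<exists>w. r = word_code k w \<and> (\<forall>j<length w. (radius1 \<rho> ^^ t) x (int (Suc i + j)) = w ! j)))"
      proof (cases w)
        case Nil then show ?thesis using w by simp
      next
        case (Cons a w')
        have "(radius1 \<rho> ^^ t) x (int i) = a" using w(2)[of 0] Cons by simp
        moreover have "(radius1 \<rho> ^^ t) x (int (Suc i + j)) = w' ! j" if "j < length w'" for j
          using w(2)[of "Suc j"] Cons that by simp
        moreover have "a < k" using calculation(1) bnd by auto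
        ultimately show ?thesis using w Cons
          by (intro disjI2 exI[of _ "word_code k w'"] exI[of _ "k * word_code k w'"] exI[of _ a]) auto
      qed
    next
      fix r z assume "z = k * r"
      then show "(r = 0 \<and> z = 0) \<or> (\<exists>r' z'. r = Suc r' \<and> z = k + z' \<and> z' = k * r')"
        by (cases r) auto
    next
      fix n show "\<exists>t. (\<exists>w. N = word_code k w \<and> (\<forall>j<length w. (radius1 \<rho> ^^ t) x (int (0 + j)) = w ! j)) \<and> n \<le> t"
        using rec[of n] N by auto
    next
      fix t n :: nat assume "n \<le> t"
      then show "n = 0 \<or> (\<exists>t' n'. t = Suc t' \<and> n = Suc n' \<and> n' \<le> t')" by (cases n; cases t) auto
    next
      fix t u v a b c
      assume "a = (radius1 \<rho> ^^ t) x (int u - int (Suc v))" "b = (radius1 \<rho> ^^ t) x (int u - int v)"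
        "c = (radius1 \<rho> ^^ t) x (int (Suc u) - int v)"
      moreover have "int u - int (Suc v) = int u - int v - 1" "int (Suc u) - int v = int u - int v + 1" by auto
      ultimately show "\<rho> a b c = (radius1 \<rho> ^^ Suc t) x (int u - int v)"
        by (simp only: funpow_radius1_Suc)
    qed simp_all
    then show ?R by blast
  next
    assume ?R
    then obtain C where C: "ca_local k \<rho> C N" ..
    interpret ca_local k \<rho> C N by fact
    have diag: "Cl t (u + d) (v + d) a \<in> C" if "Cl t u v a \<in> C" for t u v a d
      using that by (induction d) (auto intro: diag)
    \<comment> \<open>Position i is represented by the pair in which one component is 0;
      \<open>diag\<close> carries the symbol to all other representations.\<close>
    define x where "x i = (SOME a. a < k \<and> Cl 0 (nat i) (nat (- i)) a \<in> C)" for i :: int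
    have x: "x i < k \<and> Cl 0 (nat i) (nat (- i)) (x i) \<in> C" for i
      unfolding x_def by (rule someI_ex) (use tot in blast)
    have xs: "x \<in> full_shift k" using x by (auto simp: full_shift_def)
    note bnd = funpow_radius1_full_shift[OF \<rho> xs]
    have Cl: "Cl t u v ((radius1 \<rho> ^^ t) x (int u - int v)) \<in> C" for t u v
    proof (induction t arbitrary: u v)
      case 0
      have "nat (int u - int v) + min u v = u" "nat (- (int u - int v)) + min u v = v" by auto
      then show ?case using diag[of 0 _ _ _ "min u v"] x[of "int u - int v"] by (metis funpow_0)
    next
      case (Suc t)
      have "Cl t u (Suc v) ((radius1 \<rho> ^^ t) x (int u - int v - 1)) \<in> C"
        "Cl t (Suc u) v ((radius1 \<rho> ^^ t) x (int u - int v + 1)) \<in> C"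
        using Suc[of u "Suc v"] Suc[of "Suc u" v] by (simp_all add: algebra_simps)
      from step[OF bnd bnd bnd this(1) Suc this(2)] show ?case by (simp only: funpow_radius1_Suc)
    qed
    have Ml: "Ml r z \<in> C \<Longrightarrow> z = k * r" for r z
    proof (induction r arbitrary: z)
      case 0 then show ?case using mult[of 0 z] by auto
    next
      case (Suc r)
      then obtain z' where "z = k + z'" "Ml r z' \<in> C" using mult[of "Suc r" z] by auto
      with Suc.IH show ?case by simp
    qed
    have Ge: "Ge t n \<in> C \<Longrightarrow> n \<le> t" for t n
    proof (induction n arbitrary: t)
      case (Suc n)
      then obtain t' where "t = Suc t'" "Ge t' n \<in> C" using geq[of t "Suc n"] by auto
      with Suc.IH show ?case by simp
    qed simp
    have Mt: "Mt t i q \<in> C \<Longrightarrow> \<exists>w. q = word_code k w \<and> set w \<subseteq> {..<k} \<and>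
        (\<forall>j<length w. (radius1 \<rho> ^^ t) x (int (i + j)) = w ! j)" for t i q
    proof (induction q arbitrary: i rule: less_induct)
      case (less q)
      from match[OF less.prems] consider "q = 0" | r z a where "a < k" "q = Suc a + z" "Ml r z \<in> C"
        "Cl t i 0 a \<in> C" "Mt t (Suc i) r \<in> C"
        by blast
      then show ?case
      proof cases
        case 1 then show ?thesis by (intro exI[of _ "[]"]) auto
      next
        case 2
        have q: "q = Suc a + k * r" using 2 Ml by auto
        \<comment> \<open>The remaining word has a smaller code because k is positive; the induction
          rests on this.\<close>
        have "r \<le> k * r" using k by (cases k) auto
        then have "r < q" unfolding q by linarith
        from less.IH[OF this 2(5)] obtain w where w: "r = word_code k w" "set w \<subseteq> {..<k}"
          "\<And>j. j<length w \<Longrightarrow> (radius1 \<rho> ^^ t) x (int (Suc i + j)) = w ! j" by blast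
        have "(radius1 \<rho> ^^ t) x (int i) = a" using uniq[OF Cl[of t i 0] 2(4)] by simp
        then have "(radius1 \<rho> ^^ t) x (int (i + j)) = (a # w) ! j" if "j < length (a # w)" for j
          using that w(3)[of "j - 1"] by (cases j) auto
        then show ?thesis using q w 2(1) by (intro exI[of _ "a # w"]) auto
      qed
    qed
    have disp: "\<exists>t\<ge>n. \<exists>w. N = word_code k w \<and> set w \<subseteq> {..<k} \<and>
        (\<forall>j<length w. (radius1 \<rho> ^^ t) x (int j) = w ! j)" for n
    proof -
      obtain t where "Mt t 0 N \<in> C" "Ge t n \<in> C" using recur by blast
      with Ge[of t n] Mt[of t 0 N] show ?thesis by auto
    qed
    \<comment> \<open>The words read at later times also have code N and letters below k, so they
      all equal this w.\<close>
    obtain w where w: "N = word_code k w" "set w \<subseteq> {..<k}" using disp[of 0] by blast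
    have "\<forall>n. \<exists>j\<ge>n. \<forall>i<length w. (radius1 \<rho> ^^ j) x (int i) = w ! i"
      using disp word_code_inj[OF k w(2)] w(1) by metis
    then have "w \<in> language (asymptotic_set k (radius1 \<rho>))"
      using language_asymptotic_iff[OF stable] xs by blast
    then show ?L using w(1) by (auto simp: lang_code_def)
  qed
qed

section \<open>The local conditions as a formula\<close>

abbreviation Mv :: "nat \<Rightarrow> tm" where "Mv \<equiv> tproj TM"
abbreviation "tCl t u v a \<equiv> tfact 0 t (TP u v) a"
definition tplus :: "nat \<Rightarrow> tm \<Rightarrow> tm" where "tplus c s = (TS ^^ c) s"

lemma tval_tplus [simp]: "tval n m l (tplus c s) = c + tval n m l s"
  by (induction c) (auto simp: tplus_def)

text \<open>The conditions of \<open>ca_local\<close> in order. One l has to satisfy all conjuncts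
  at once, so different conjuncts use disjoint components of l. In the recurrence conjunct the time
  bound is m itself, not a component of it.\<close>

definition ca_fm :: "nat \<Rightarrow> (nat \<Rightarrow> nat \<Rightarrow> nat \<Rightarrow> nat) \<Rightarrow> fm" where
  "ca_fm k \<rho> = Conj
    [Disj (map (\<lambda>a. In (tCl TZ (Mv 0) (Mv 1) (tnum a))) [0..<k]),
     Imp (In (tCl (Mv 0) (Mv 1) (Mv 2) (Mv 3))) (Imp (In (tCl (Mv 0) (Mv 1) (Mv 2) (Mv 4))) (Eq (Mv 3) (Mv 4))),
     Imp (In (tCl (Mv 0) (Mv 1) (Mv 2) (Mv 3))) (In (tCl (Mv 0) (TS (Mv 1)) (TS (Mv 2)) (Mv 3))),
     Conj (map (\<lambda>(a, b, c). Imp (In (tCl (Mv 0) (Mv 1) (TS (Mv 2)) (tnum a)))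
        (Imp (In (tCl (Mv 0) (Mv 1) (Mv 2) (tnum b))) (Imp (In (tCl (Mv 0) (TS (Mv 1)) (Mv 2) (tnum c)))
        (In (tCl (TS (Mv 0)) (Mv 1) (Mv 2) (tnum (\<rho> a b c)))))))
        (List.product [0..<k] (List.product [0..<k] [0..<k]))),
     Imp (In (tfact 6 (Mv 0) (Mv 1) (Mv 2))) (Or (Eq (Mv 2) TZ)
        (Disj (map (\<lambda>a. Conj [Eq (Mv 2) (tplus (Suc a) (Xv 1)), In (tfact 2 (Xv 0) (Xv 1) TZ),
          In (tCl (Mv 0) (Mv 1) TZ (tnum a)), In (tfact 6 (Mv 0) (TS (Mv 1)) (Xv 0))]) [0..<k]))),
     Imp (In (tfact 2 (Mv 0) (Mv 1) TZ)) (Or (And (Eq (Mv 0) TZ) (Eq (Mv 1) TZ))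
        (Conj [Eq (Mv 0) (TS (Xv 2)), Eq (Mv 1) (tplus k (Xv 3)), In (tfact 2 (Xv 2) (Xv 3) TZ)])),
     And (In (tfact 6 (Xv 4) TZ TN)) (In (tfact 3 (Xv 4) TM TZ)),
     Imp (In (tfact 3 (Mv 0) (Mv 1) TZ)) (Or (Eq (Mv 1) TZ)
        (Conj [Eq (Mv 0) (TS (Xv 5)), Eq (Mv 1) (TS (Xv 6)), In (tfact 3 (Xv 5) (Xv 6) TZ)]))]"

lemma pproj_ptuple5:
  "pproj (ptuple [a, b, c, d, e]) 0 = a" "pproj (ptuple [a, b, c, d, e]) (Suc 0) = b"
  "pproj (ptuple [a, b, c, d, e]) 2 = c" "pproj (ptuple [a, b, c, d, e]) 3 = d"
  "pproj (ptuple [a, b, c, d, e]) 4 = e"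
  by (simp_all add: pproj_ptuple)

lemma pproj_ptuple7:
  "pproj (ptuple [a, b, c, d, e, f, g]) 0 = a" "pproj (ptuple [a, b, c, d, e, f, g]) (Suc 0) = b"
  "pproj (ptuple [a, b, c, d, e, f, g]) 2 = c" "pproj (ptuple [a, b, c, d, e, f, g]) 3 = d"
  "pproj (ptuple [a, b, c, d, e, f, g]) 4 = e" "pproj (ptuple [a, b, c, d, e, f, g]) 5 = f"
  "pproj (ptuple [a, b, c, d, e, f, g]) 6 = g"
  by (simp_all add: pproj_ptuple)

lemma ca_local_iff_fm: "ca_local k \<rho> C N \<longleftrightarrow> (\<forall>m. \<exists>l. fval C N m l (ca_fm k \<rho>))"
proof
  assume "ca_local k \<rho> C N"
  then interpret ca_local k \<rho> C N .
  show "\<forall>m. \<exists>l. fval C N m l (ca_fm k \<rho>)"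
  proof
    fix m
    define t u v where tuv: "t = pproj m 0" "u = pproj m 1" "v = pproj m 2"
    have "\<exists>l0 l1. Mt t u v \<in> C \<longrightarrow> v = 0 \<or> (\<exists>a<k. v = Suc a + l1 \<and> Ml l0 l1 \<in> C \<and> Cl t u 0 a \<in> C
      \<and> Mt t (Suc u) l0 \<in> C)"
      using match[of t u v] by blast
    then obtain l0 l1 where 1: "Mt t u v \<in> C \<longrightarrow> v = 0 \<or> (\<exists>a<k. v = Suc a + l1 \<and> Ml l0 l1 \<in> C
      \<and> Cl t u 0 a \<in> C \<and> Mt t (Suc u) l0 \<in> C)" by blast
    have "\<exists>l2 l3. Ml t u \<in> C \<longrightarrow> (t = 0 \<and> u = 0) \<or> (t = Suc l2 \<and> u = k + l3 \<and> Ml l2 l3 \<in> C)"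
      using mult[of t u] by blast
    then obtain l2 l3 where 2: "Ml t u \<in> C \<longrightarrow> (t = 0 \<and> u = 0) \<or> (t = Suc l2 \<and> u = k + l3 \<and> Ml l2 l3 \<in> C)"
      by blast
    obtain l4 where 3: "Mt l4 0 N \<in> C" "Ge l4 m \<in> C" using recur by blast
    have "\<exists>l5 l6. Ge t u \<in> C \<longrightarrow> u = 0 \<or> (t = Suc l5 \<and> u = Suc l6 \<and> Ge l5 l6 \<in> C)"
      using geq[of t u] by blast
    then obtain l5 l6 where 4: "Ge t u \<in> C \<longrightarrow> u = 0 \<or> (t = Suc l5 \<and> u = Suc l6 \<and> Ge l5 l6 \<in> C)" by blast
    have "fval C N m (ptuple [l0, l1, l2, l3, l4, l5, l6]) (ca_fm k \<rho>)"
      unfolding ca_fm_def fval_Conj list.set ball_simps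
      apply (intro conjI)
      subgoal using tot[of t u] by (auto simp: tuv)
      subgoal using uniq[of t u v] by (auto simp: tuv)
      subgoal using diag[of t u v] by (auto simp: tuv)
      subgoal using step[of _ _ _ t u v] by (auto simp: tuv)
      subgoal using 1 by (auto simp: tuv pproj_ptuple7)
      subgoal using 2 by (auto simp: tuv pproj_ptuple7)
      subgoal using 3 by (auto simp: tuv pproj_ptuple7)
      subgoal using 4 by (auto simp: tuv pproj_ptuple7)
      subgoal by simp
      done
    then show "\<exists>l. fval C N m l (ca_fm k \<rho>)" ..
  qed
next
  assume H: "\<forall>m. \<exists>l. fval C N m l (ca_fm k \<rho>)"
  have inst: "\<exists>l. fval C N (ptuple [a, b, c, d, e]) l (ca_fm k \<rho>)" for a b c d e using H by blast
  show "ca_local k \<rho> C N"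
  proof
    fix u v show "\<exists>a<k. Cl 0 u v a \<in> C"
      using inst[of u v 0 0 0] by (auto simp: ca_fm_def pproj_ptuple5)
  next
    fix t u v a b assume "Cl t u v a \<in> C" "Cl t u v b \<in> C"
    then show "a = b"
      using inst[of t u v a b] by (auto simp: ca_fm_def pproj_ptuple5)
  next
    fix t u v a assume "Cl t u v a \<in> C"
    then show "Cl t (Suc u) (Suc v) a \<in> C"
      using inst[of t u v a 0] by (auto simp: ca_fm_def pproj_ptuple5)
  next
    fix t u v a b c assume "a < k" "b < k" "c < k" "Cl t u (Suc v) a \<in> C" "Cl t u v b \<in> C" "Cl t (Suc u) v c \<in> C"
    then show "Cl (Suc t) u v (\<rho> a b c) \<in> C"
      using inst[of t u v 0 0] by (force simp: ca_fm_def pproj_ptuple5)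
  next
    fix t i q assume "Mt t i q \<in> C"
    then show "q = 0 \<or> (\<exists>r z. \<exists>a<k. q = Suc a + z \<and> Ml r z \<in> C \<and> Cl t i 0 a \<in> C \<and> Mt t (Suc i) r \<in> C)"
      using inst[of t i q 0 0] by (simp add: ca_fm_def pproj_ptuple5 Bex_def) blast
  next
    fix r z assume "Ml r z \<in> C"
    then show "(r = 0 \<and> z = 0) \<or> (\<exists>r' z'. r = Suc r' \<and> z = k + z' \<and> Ml r' z' \<in> C)"
      using inst[of r z 0 0 0] by (simp add: ca_fm_def pproj_ptuple5 Bex_def) blast
  next
    fix n show "\<exists>t. Mt t 0 N \<in> C \<and> Ge t n \<in> C"
      using H[rule_format, of n] by (auto simp: ca_fm_def)
  next
    fix t n assume "Ge t n \<in> C"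
    then show "n = 0 \<or> (\<exists>t' n'. t = Suc t' \<and> n = Suc n' \<and> Ge t' n' \<in> C)"
      using inst[of t n 0 0 0] by (simp add: ca_fm_def pproj_ptuple5 Bex_def) blast
  qed
qed

theorem sigma11_language_radius1:
  assumes "1 \<le> k" and "\<And>a b c. a < k \<Longrightarrow> b < k \<Longrightarrow> c < k \<Longrightarrow> \<rho> a b c < k"
  shows "sigma11 (lang_code k (language (asymptotic_set k (radius1 \<rho>))))"
  by (rule sigma11_fm[where \<phi> = "ca_fm k \<rho>"]) (simp add: lang_code_iff_ca_local[OF assms] ca_local_iff_fm)

section \<open>Counter machines\<close>

text \<open>There is no decrement: in the automaton a register grows by moving a mark one cell
  outward, or it is reset by a new mark at the origin. Loops are controlled by equality
  tests.\<close>

datatype instr = Inc nat | Rst nat | Jeq nat nat nat | Jin nat nat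

fun target :: "instr \<Rightarrow> nat" where
  "target (Jeq a b l) = l" | "target (Jin r l) = l" | "target _ = 0"

fun test :: "nat set \<Rightarrow> instr \<Rightarrow> (nat \<Rightarrow> nat) \<Rightarrow> bool" where
  "test A (Jeq a b l) s = (s a = s b)" | "test A (Jin r l) s = (s r \<in> A)" | "test A _ s = False"

fun upd :: "instr \<Rightarrow> (nat \<Rightarrow> nat) \<Rightarrow> (nat \<Rightarrow> nat)" where
  "upd (Inc r) s = s(r := Suc (s r))" | "upd (Rst r) s = s(r := 0)" | "upd _ s = s"

text \<open>Jumps out of the program lead to 0, so that labels stay in a finite range.\<close>

definition nxt :: "instr list \<Rightarrow> nat \<Rightarrow> bool \<Rightarrow> nat" where
  "nxt prog l b = (let t = if b then target (prog ! l) else Suc l in if t < length prog then t else 0)"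

definition mstep :: "instr list \<Rightarrow> nat set \<Rightarrow> nat \<times> (nat \<Rightarrow> nat) \<Rightarrow> nat \<times> (nat \<Rightarrow> nat)" where
  "mstep prog A c = (nxt prog (fst c) (test A (prog ! fst c) (snd c)), upd (prog ! fst c) (snd c))"

text \<open>Label 0 is the moment of display. Stopping there cuts an infinite run of
  \<open>mstep\<close> into rounds.\<close>

definition mrel :: "instr list \<Rightarrow> nat set \<Rightarrow> nat \<times> (nat \<Rightarrow> nat) \<Rightarrow> nat \<times> (nat \<Rightarrow> nat) \<Rightarrow> bool" where
  "mrel prog A c c' \<longleftrightarrow> fst c \<noteq> 0 \<and> c' = mstep prog A c"

section \<open>Bounded-loop commands and their compilation\<close>

datatype com = CSkip | CInc nat | CRst nat | CSeq com com | CFor nat nat com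
  | CIfEq nat nat com com | CIfIn nat com com

text \<open>Loops are bounded, so commands always terminate; unbounded search appears only in
  \<open>main_prog\<close>. In a well-formed loop the counter j is raised before each pass, so it
  takes the values from 1 to the bound. An empty body therefore copies register b to j.\<close>

fun csem :: "nat set \<Rightarrow> com \<Rightarrow> (nat \<Rightarrow> nat) \<Rightarrow> (nat \<Rightarrow> nat)" where
  "csem A CSkip s = s"
| "csem A (CInc r) s = s(r := Suc (s r))"
| "csem A (CRst r) s = s(r := 0)"
| "csem A (CSeq c d) s = csem A d (csem A c s)"
| "csem A (CFor j b c) s = ((\<lambda>s. csem A c (s(j := Suc (s j)))) ^^ s b) (s(j := 0))"
| "csem A (CIfEq a b c d) s = (if s a = s b then csem A c s else csem A d s)"
| "csem A (CIfIn r c d) s = (if s r \<in> A then csem A c s else csem A d s)"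

fun wr :: "com \<Rightarrow> nat set" where
  "wr CSkip = {}"
| "wr (CInc r) = {r}"
| "wr (CRst r) = {r}"
| "wr (CSeq c d) = wr c \<union> wr d"
| "wr (CFor j b c) = insert j (wr c)"
| "wr (CIfEq a b c d) = wr c \<union> wr d"
| "wr (CIfIn r c d) = wr c \<union> wr d"

fun regs :: "com \<Rightarrow> nat set" where
  "regs CSkip = {}"
| "regs (CInc r) = {r}"
| "regs (CRst r) = {r}"
| "regs (CSeq c d) = regs c \<union> regs d"
| "regs (CFor j b c) = {j, b} \<union> regs c"
| "regs (CIfEq a b c d) = {a, b} \<union> regs c \<union> regs d"
| "regs (CIfIn r c d) = {r} \<union> regs c \<union> regs d"

fun wfc :: "com \<Rightarrow> bool" where
  "wfc (CSeq c d) = (wfc c \<and> wfc d)"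
| "wfc (CFor j b c) = (j \<noteq> b \<and> j \<notin> wr c \<and> b \<notin> wr c \<and> wfc c)"
| "wfc (CIfEq a b c d) = (wfc c \<and> wfc d)"
| "wfc (CIfIn r c d) = (wfc c \<and> wfc d)"
| "wfc _ = True"

lemma csem_unchanged: "r \<notin> wr c \<Longrightarrow> csem A c s r = s r"
proof (induction c arbitrary: s)
  case (CFor j b c)
  have "((\<lambda>s. csem A c (s(j := Suc (s j)))) ^^ n) t r = t r" for n t
    by (induction n) (use CFor in auto)
  then show ?case using CFor by simp
qed auto

fun compile :: "com \<Rightarrow> nat \<Rightarrow> instr list" where
  "compile CSkip pc = []"
| "compile (CInc r) pc = [Inc r]"
| "compile (CRst r) pc = [Rst r]"
| "compile (CSeq c d) pc = (let p = compile c pc in p @ compile d (pc + length p))"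
| "compile (CFor j b c) pc = (let p = compile c (pc + 3) in
    [Rst j, Jeq j b (pc + length p + 4), Inc j] @ p @ [Jeq j j (pc + 1)])"
| "compile (CIfEq a b c d) pc = (let q = compile d (pc + 1); p = compile c (pc + length q + 2) in
    Jeq a b (pc + length q + 2) # q @ Jeq a a (pc + length q + 2 + length p) # p)"
| "compile (CIfIn r c d) pc = (let q = compile d (pc + 1); p = compile c (pc + length q + 2) in
    Jin r (pc + length q + 2) # q @ Jeq r r (pc + length q + 2 + length p) # p)"

definition code_at :: "instr list \<Rightarrow> nat \<Rightarrow> instr list \<Rightarrow> bool" where
  "code_at prog pc p \<longleftrightarrow> pc + length p \<le> length prog \<and> (\<forall>i<length p. prog ! (pc + i) = p ! i)"

lemma code_at_append [simp]:
  "code_at prog pc (p @ q) \<longleftrightarrow> code_at prog pc p \<and> code_at prog (pc + length p) q"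
proof
  assume l: "code_at prog pc (p @ q)"
  have "prog ! (pc + i) = p ! i" if "i < length p" for i
    using l that unfolding code_at_def by (metis nth_append length_append trans_less_add1)
  moreover have "prog ! (pc + length p + i) = q ! i" if "i < length q" for i
    using l that unfolding code_at_def
    by (metis nth_append_length_plus length_append nat_add_left_cancel_less add.assoc)
  ultimately show "code_at prog pc p \<and> code_at prog (pc + length p) q"
    using l by (auto simp: code_at_def)
next
  assume r: "code_at prog pc p \<and> code_at prog (pc + length p) q"
  have "prog ! (pc + i) = (p @ q) ! i" if "i < length (p @ q)" for i
  proof (cases "i < length p")
    case True then show ?thesis using r by (simp add: code_at_def nth_append)
  next
    case False
    then obtain k where k: "i = length p + k" by (metis le_Suc_ex not_less)
    then show ?thesis using r that by (simp add: code_at_def add.assoc)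
  qed
  with r show "code_at prog pc (p @ q)" by (auto simp: code_at_def)
qed

lemma code_at_Cons [simp]:
  "code_at prog pc (x # q) \<longleftrightarrow> pc < length prog \<and> prog ! pc = x \<and> code_at prog (Suc pc) q"
  using code_at_append[of prog pc "[x]" q] by (auto simp: code_at_def)

lemma mrel_Inc: "prog ! pc = Inc r \<Longrightarrow> 0 < pc \<Longrightarrow> Suc pc < length prog \<Longrightarrow>
    mrel prog A (pc, s) (Suc pc, s(r := Suc (s r)))"
  by (simp add: mrel_def mstep_def nxt_def)

lemma mrel_Rst: "prog ! pc = Rst r \<Longrightarrow> 0 < pc \<Longrightarrow> Suc pc < length prog \<Longrightarrow>
    mrel prog A (pc, s) (Suc pc, s(r := 0))"
  by (simp add: mrel_def mstep_def nxt_def)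

lemma mrel_Jeq: "prog ! pc = Jeq a b l \<Longrightarrow> 0 < pc \<Longrightarrow> s a = s b \<Longrightarrow> l < length prog \<Longrightarrow>
    mrel prog A (pc, s) (l, s)"
  by (simp add: mrel_def mstep_def nxt_def)

lemma mrel_Jne: "prog ! pc = Jeq a b l \<Longrightarrow> 0 < pc \<Longrightarrow> s a \<noteq> s b \<Longrightarrow> Suc pc < length prog \<Longrightarrow>
    mrel prog A (pc, s) (Suc pc, s)"
  by (simp add: mrel_def mstep_def nxt_def)

lemma mrel_Jin: "prog ! pc = Jin r l \<Longrightarrow> 0 < pc \<Longrightarrow> s r \<in> A \<Longrightarrow> l < length prog \<Longrightarrow>
    mrel prog A (pc, s) (l, s)"
  by (simp add: mrel_def mstep_def nxt_def)

lemma mrel_Jnin: "prog ! pc = Jin r l \<Longrightarrow> 0 < pc \<Longrightarrow> s r \<notin> A \<Longrightarrow> Suc pc < length prog \<Longrightarrow>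
    mrel prog A (pc, s) (Suc pc, s)"
  by (simp add: mrel_def mstep_def nxt_def)

text \<open>The start must be positive because \<open>mrel\<close> is stuck at label 0, and the end
  must lie inside the program because \<open>nxt\<close> sends other labels to 0.\<close>

lemma compile_correct:
  assumes "wfc c" "code_at prog pc (compile c pc)" "0 < pc" "pc + length (compile c pc) < length prog"
  shows "(mrel prog A)\<^sup>*\<^sup>* (pc, s) (pc + length (compile c pc), csem A c s)"
  using assms
proof (induction c arbitrary: pc s)
  case CSkip then show ?case by simp
next
  case (CInc r) then show ?case by (auto intro!: r_into_rtranclp mrel_Inc simp: code_at_def simp del: fun_upd_apply)
next
  case (CRst r) then show ?case by (auto intro!: r_into_rtranclp mrel_Rst simp: code_at_def simp del: fun_upd_apply)
next
  case (CSeq c d)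
  let ?p = "compile c pc"
  have "(mrel prog A)\<^sup>*\<^sup>* (pc, s) (pc + length ?p, csem A c s)"
    by (rule CSeq.IH) (use CSeq.prems in \<open>auto simp: Let_def\<close>)
  also have "(mrel prog A)\<^sup>*\<^sup>* (pc + length ?p, csem A c s)
      (pc + length ?p + length (compile d (pc + length ?p)), csem A d (csem A c s))"
    by (rule CSeq.IH) (use CSeq.prems in \<open>auto simp: Let_def\<close>)
  finally show ?case by (simp add: Let_def add.assoc)
next
  case (CFor j b c)
  let ?p = "compile c (pc + 3)"
  let ?g = "\<lambda>s. csem A c (s(j := Suc (s j)))"
  define t where "t n = (?g ^^ n) (s(j := 0))" for n
  have tj: "t n j = n" and tb: "t n b = s b" for n
    by (induction n) (use CFor.prems in \<open>auto simp: t_def csem_unchanged\<close>)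
  have tS: "t (Suc n) = csem A c ((t n)(j := Suc (t n j)))" for n by (simp add: t_def)
  have len: "length (compile (CFor j b c) pc) = length ?p + 4" by (simp add: Let_def)
  have at: "prog ! pc = Rst j" "prog ! Suc pc = Jeq j b (pc + length ?p + 4)"
    "prog ! Suc (Suc pc) = Inc j" "code_at prog (pc + 3) ?p" "prog ! (pc + 3 + length ?p) = Jeq j j (pc + 1)"
    using CFor.prems(2) by (auto simp: Let_def numeral_3_eq_3)
  have loop: "(mrel prog A)\<^sup>*\<^sup>* (pc + 1, t n) (pc + 1, t (Suc n))" if "n < s b" for n
  proof -
    have "(mrel prog A)\<^sup>*\<^sup>* (pc + 1, t n) (pc + 1, t n)" by simp
    also have "(mrel prog A) (pc + 1, t n) (Suc (Suc pc), t n)"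
      using mrel_Jne[of prog "Suc pc" j b _ "t n"] at CFor.prems(3,4) that len by (simp add: tj tb)
    also have "(mrel prog A) (Suc (Suc pc), t n) (pc + 3, (t n)(j := Suc (t n j)))"
      using mrel_Inc[of prog "Suc (Suc pc)" j] at CFor.prems(3,4) len by (simp add: numeral_3_eq_3)
    also have "(mrel prog A)\<^sup>*\<^sup>* (pc + 3, (t n)(j := Suc (t n j))) (pc + 3 + length ?p, t (Suc n))"
      unfolding tS by (rule CFor.IH) (use at CFor.prems len in auto)
    also have "(mrel prog A) (pc + 3 + length ?p, t (Suc n)) (pc + 1, t (Suc n))"
      using mrel_Jeq[OF at(5)] CFor.prems(3,4) len by simp
    finally show ?thesis by simp
  qed
  have "(mrel prog A)\<^sup>*\<^sup>* (pc, s) (pc, s)" by simp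
  also have "(mrel prog A) (pc, s) (pc + 1, t 0)"
    using mrel_Rst[OF at(1)] CFor.prems(3,4) len by (simp add: t_def)
  also have "(mrel prog A)\<^sup>*\<^sup>* (pc + 1, t 0) (pc + 1, t n)" if "n \<le> s b" for n
    using that by (induction n) (auto dest: loop intro: rtranclp_trans simp: Suc_le_eq)
  from this[of "s b"] have "(mrel prog A)\<^sup>*\<^sup>* (pc + 1, t 0) (pc + 1, t (s b))" by simp
  also have "(mrel prog A) (pc + 1, t (s b)) (pc + length ?p + 4, t (s b))"
    using mrel_Jeq[of prog "Suc pc" j b _ "t (s b)"] at CFor.prems(3,4) len by (simp add: tj tb)
  finally show ?case unfolding len by (simp add: t_def add.assoc)
next
  case (CIfEq a b c d)
  let ?q = "compile d (pc + 1)"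
  let ?e = "pc + length ?q + 2"
  let ?p = "compile c ?e"
  have len: "length (compile (CIfEq a b c d) pc) = length ?q + 2 + length ?p" by (simp add: Let_def)
  have at: "prog ! pc = Jeq a b ?e" "code_at prog (pc + 1) ?q"
    "prog ! (pc + 1 + length ?q) = Jeq a a (?e + length ?p)" "code_at prog ?e ?p"
    using CIfEq.prems(2) by (auto simp: Let_def)
  show ?case
  proof (cases "s a = s b")
    case True
    have "(mrel prog A)\<^sup>*\<^sup>* (pc, s) (pc, s)" by simp
    also have "(mrel prog A) (pc, s) (?e, s)" using mrel_Jeq[OF at(1)] True CIfEq.prems(3,4) len by simp
    also have "(mrel prog A)\<^sup>*\<^sup>* (?e, s) (?e + length ?p, csem A c s)"
      by (rule CIfEq.IH) (use CIfEq.prems at len in auto)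
    finally show ?thesis using True unfolding len by (simp add: add.assoc)
  next
    case False
    have "(mrel prog A)\<^sup>*\<^sup>* (pc, s) (pc, s)" by simp
    also have "(mrel prog A) (pc, s) (pc + 1, s)" using mrel_Jne[OF at(1)] False CIfEq.prems(3,4) len by simp
    also have "(mrel prog A)\<^sup>*\<^sup>* (pc + 1, s) (pc + 1 + length ?q, csem A d s)"
      by (rule CIfEq.IH) (use CIfEq.prems at len in auto)
    also have "(mrel prog A) (pc + 1 + length ?q, csem A d s) (?e + length ?p, csem A d s)"
      using mrel_Jeq[OF at(3)] CIfEq.prems(3,4) len by simp
    finally show ?thesis using False unfolding len by (simp add: add.assoc)
  qed
next
  case (CIfIn r c d)
  let ?q = "compile d (pc + 1)"
  let ?e = "pc + length ?q + 2"
  let ?p = "compile c ?e"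
  have len: "length (compile (CIfIn r c d) pc) = length ?q + 2 + length ?p" by (simp add: Let_def)
  have at: "prog ! pc = Jin r ?e" "code_at prog (pc + 1) ?q"
    "prog ! (pc + 1 + length ?q) = Jeq r r (?e + length ?p)" "code_at prog ?e ?p"
    using CIfIn.prems(2) by (auto simp: Let_def)
  show ?case
  proof (cases "s r \<in> A")
    case True
    have "(mrel prog A)\<^sup>*\<^sup>* (pc, s) (pc, s)" by simp
    also have "(mrel prog A) (pc, s) (?e, s)" using mrel_Jin[OF at(1)] True CIfIn.prems(3,4) len by simp
    also have "(mrel prog A)\<^sup>*\<^sup>* (?e, s) (?e + length ?p, csem A c s)"
      by (rule CIfIn.IH) (use CIfIn.prems at len in auto)
    finally show ?thesis using True unfolding len by (simp add: add.assoc)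
  next
    case False
    have "(mrel prog A)\<^sup>*\<^sup>* (pc, s) (pc, s)" by simp
    also have "(mrel prog A) (pc, s) (pc + 1, s)" using mrel_Jnin[OF at(1)] False CIfIn.prems(3,4) len by simp
    also have "(mrel prog A)\<^sup>*\<^sup>* (pc + 1, s) (pc + 1 + length ?q, csem A d s)"
      by (rule CIfIn.IH) (use CIfIn.prems at len in auto)
    also have "(mrel prog A) (pc + 1 + length ?q, csem A d s) (?e + length ?p, csem A d s)"
      using mrel_Jeq[OF at(3)] CIfIn.prems(3,4) len by simp
    finally show ?thesis using False unfolding len by (simp add: add.assoc)
  qed
qed

section \<open>Commands for terms and formulas\<close>

abbreviation cseq :: "com list \<Rightarrow> com" where "cseq cs \<equiv> foldr CSeq cs CSkip"

text \<open>Walks \<open>s d\<close> steps along the diagonals of the Cantor enumeration, keeping the current first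
  component in \<open>d + 2\<close> and the index of the diagonal in \<open>d + 1\<close>.\<close>

definition unpair_com :: "nat \<Rightarrow> com" where
  "unpair_com d = cseq [CRst (d + 1), CRst (d + 2),
    CFor (d + 3) d (CIfEq (d + 2) (d + 1) (CSeq (CInc (d + 1)) (CRst (d + 2))) (CInc (d + 2)))]"

text \<open>Registers 0, 3 and 4 hold n, m and l; the result goes to d, and only registers from d on
  are written. Pairing adds \<open>triangle (a + b)\<close> to a by a nested loop. The second
  projection is the index of the diagonal minus the first component.\<close>

fun cexp :: "tm \<Rightarrow> nat \<Rightarrow> com" where
  "cexp TN d = CFor d 0 CSkip"
| "cexp TM d = CFor d 3 CSkip"
| "cexp TL d = CFor d 4 CSkip"
| "cexp TZ d = CRst d"
| "cexp (TS a) d = CSeq (cexp a d) (CInc d)"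
| "cexp (TP a b) d = cseq [cexp a d, cexp b (d + 1), CFor (d + 2) d CSkip,
    CFor (d + 3) (d + 1) (CInc (d + 2)), CFor (d + 3) (d + 2) (CFor (d + 4) (d + 3) (CInc d))]"
| "cexp (TF a) d = cseq [cexp a d, unpair_com d, CFor d (d + 2) CSkip]"
| "cexp (TG a) d = cseq [cexp a d, unpair_com d, CRst d, CRst (d + 4),
    CFor (d + 3) (d + 1) (CIfEq (d + 4) (d + 2) (CInc d) (CInc (d + 4)))]"

text \<open>Truth values are 1 and 0 in register d. Membership of e is looked up at e + n + 1, since
  the oracle track begins right behind the displayed cells.\<close>

fun cfm :: "fm \<Rightarrow> nat \<Rightarrow> com" where
  "cfm (Eq a b) d = cseq [cexp a d, cexp b (d + 1),
    CIfEq d (d + 1) (CSeq (CRst d) (CInc d)) (CRst d)]"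
| "cfm (In a) d = cseq [cexp a d, CFor (d + 1) 0 CSkip, CInc (d + 1), CFor (d + 2) d (CInc (d + 1)),
    CIfIn (d + 1) (CSeq (CRst d) (CInc d)) (CRst d)]"
| "cfm (Nand f g) d = cseq [cfm f d, cfm g (d + 1), CRst (d + 2),
    CIfEq d (d + 2) (CInc d) (CIfEq (d + 1) (d + 2) CSkip (CRst d))]"

lemma wr_cexp: "wr (cexp t d) \<subseteq> {d..}"
  by (induction t arbitrary: d) (fastforce simp: unpair_com_def)+

lemma wr_cfm: "wr (cfm f d) \<subseteq> {d..}"
proof (induction f arbitrary: d)
  case (Eq a b) then show ?case using wr_cexp[of a d] wr_cexp[of b "d + 1"] by fastforce
next
  case (In a) then show ?case using wr_cexp[of a d] by fastforce
next
  case (Nand f g) then show ?case by fastforce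
qed

lemma wfc_cexp: "5 \<le> d \<Longrightarrow> wfc (cexp t d)"
  by (induction t arbitrary: d) (auto simp: unpair_com_def)

lemma wfc_cfm: "5 \<le> d \<Longrightarrow> wfc (cfm f d)"
  by (induction f arbitrary: d) (auto simp: wfc_cexp)

lemma csem_copy [simp]: "d \<noteq> a \<Longrightarrow> csem A (CFor d a CSkip) s = s(d := s a)"
proof -
  assume "d \<noteq> a"
  have "((\<lambda>s. s(d := Suc (s d))) ^^ n) (s(d := 0)) = s(d := n)" for n
    by (induction n) auto
  then show ?thesis by simp
qed

lemma csem_for_inc:
  assumes "j \<noteq> b" "j \<noteq> r" "b \<noteq> r"
  shows "csem A (CFor j b (CInc r)) s = s(j := s b, r := s r + s b)"
proof -
  have "((\<lambda>s. csem A (CInc r) (s(j := Suc (s j)))) ^^ n) (s(j := 0)) = s(j := n, r := s r + n)" for n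
    by (induction n) (use assms in \<open>auto simp: fun_eq_iff\<close>)
  then show ?thesis using assms by simp
qed

lemma csem_for_triangle:
  assumes "distinct [i, j, b, r]"
  shows "csem A (CFor i b (CFor j i (CInc r))) s r = s r + triangle (s b)"
    "x \<notin> {i, j, r} \<Longrightarrow> csem A (CFor i b (CFor j i (CInc r))) s x = s x"
proof -
  have "((\<lambda>s. csem A (CFor j i (CInc r)) (s(i := Suc (s i)))) ^^ n) (s(i := 0)) i = n \<and>
    ((\<lambda>s. csem A (CFor j i (CInc r)) (s(i := Suc (s i)))) ^^ n) (s(i := 0)) r = s r + triangle n" for n
    by (induction n) (use assms in \<open>auto simp: csem_for_inc simp del: csem.simps\<close>)
  then show "csem A (CFor i b (CFor j i (CInc r))) s r = s r + triangle (s b)" by simp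
  show "x \<notin> {i, j, r} \<Longrightarrow> csem A (CFor i b (CFor j i (CInc r))) s x = s x"
    by (rule csem_unchanged) auto
qed

text \<open>One step of the Cantor enumeration, as performed by the loop body of
  \<open>unpair_com\<close>.\<close>

lemma prod_decode_Suc:
  "prod_decode (Suc n) = (if psnd n = 0 then (0, Suc (pfst n)) else (Suc (pfst n), psnd n - 1))"
proof -
  obtain x y where xy: "prod_decode n = (x, y)" by fastforce
  then have n: "n = prod_encode (x, y)" by (metis prod_decode_inverse)
  have "Suc n = prod_encode (if y = 0 then (0, Suc x) else (Suc x, y - 1))"
    unfolding n by (cases y) (auto simp: prod_encode_def)
  then have "prod_decode (Suc n) = (if y = 0 then (0, Suc x) else (Suc x, y - 1))"
    by (metis prod_encode_inverse)
  then show ?thesis by (simp add: xy)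
qed

lemma csem_unpair:
  shows "csem A (unpair_com d) s (d + 2) = pfst (s d)"
    "csem A (unpair_com d) s (d + 1) = pfst (s d) + psnd (s d)"
    "x < d + 1 \<Longrightarrow> csem A (unpair_com d) s x = s x"
proof -
  let ?body = "CIfEq (d + 2) (d + 1) (CSeq (CInc (d + 1)) (CRst (d + 2))) (CInc (d + 2))"
  let ?t = "s(d + 1 := 0, d + 2 := 0, d + 3 := 0)"
  have "((\<lambda>s. csem A ?body (s(d + 3 := Suc (s (d + 3))))) ^^ n) ?t (d + 2) = pfst n \<and>
    ((\<lambda>s. csem A ?body (s(d + 3 := Suc (s (d + 3))))) ^^ n) ?t (d + 1) = pfst n + psnd n" for n
  proof (induction n)
    case 0 show ?case by (simp add: prod_decode_def prod_decode_aux.simps)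
  next
    case (Suc n) then show ?case by (auto simp: prod_decode_Suc)
  qed
  from this[of "s d"]
  show "csem A (unpair_com d) s (d + 2) = pfst (s d)"
    "csem A (unpair_com d) s (d + 1) = pfst (s d) + psnd (s d)"
    by (simp_all add: unpair_com_def)
  show "x < d + 1 \<Longrightarrow> csem A (unpair_com d) s x = s x"
    by (rule csem_unchanged) (auto simp: unpair_com_def)
qed

text \<open>The first passes raise c from 0 to the value of x; all remaining passes raise y.\<close>

lemma csem_for_diff:
  assumes "distinct [j, b, y, c, x]" "s y = 0" "s c = 0" "s x \<le> s b"
  shows "csem A (CFor j b (CIfEq c x (CInc y) (CInc c))) s y = s b - s x"
proof -
  define t where
    "t n = ((\<lambda>s. csem A (CIfEq c x (CInc y) (CInc c)) (s(j := Suc (s j)))) ^^ n) (s(j := 0))" for n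
  have tS: "t (Suc n) = (if t n c = t n x then (t n)(j := Suc (t n j), y := Suc (t n y))
      else (t n)(j := Suc (t n j), c := Suc (t n c)))" for n
  proof -
    have "x \<noteq> j" "c \<noteq> j" "y \<noteq> j" using assms(1) by auto
    then have "csem A (CIfEq c x (CInc y) (CInc c)) (u(j := Suc (u j))) =
      (if u c = u x then u(j := Suc (u j), y := Suc (u y)) else u(j := Suc (u j), c := Suc (u c)))" for u
      by simp
    then show ?thesis by (simp only: t_def funpow.simps o_apply)
  qed
  have "t n x = s x \<and> t n y = n - s x \<and> t n c = min n (s x)" for n
  proof (induction n)
    case 0 then show ?case using assms by (auto simp: t_def)
  next
    case (Suc n)
    then show ?case using assms(1) by (auto simp: tS min_def split: if_splits) arith+
  qed
  then show ?thesis by (simp add: t_def)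
qed

lemma csem_cexp_low: "r < d \<Longrightarrow> csem A (cexp t d) s r = s r"
  by (rule csem_unchanged) (use wr_cexp[of t d] in auto)

lemma csem_cfm_low: "r < d \<Longrightarrow> csem A (cfm f d) s r = s r"
  by (rule csem_unchanged) (use wr_cfm[of f d] in auto)

lemma csem_cexp: "5 \<le> d \<Longrightarrow> csem A (cexp t d) s d = tval (s 0) (s 3) (s 4) t"
proof (induction t arbitrary: d s)
  case (TP a b)
  let ?s = "csem A (cexp b (d + 1)) (csem A (cexp a d) s)"
  have a: "?s d = tval (s 0) (s 3) (s 4) a" using TP by (simp add: csem_cexp_low)
  have b: "?s (d + 1) = tval (s 0) (s 3) (s 4) b" using TP by (simp add: csem_cexp_low)
  have "csem A (cexp (TP a b) d) s d = ?s d + triangle (?s d + ?s (d + 1))"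
    by (simp add: csem_for_triangle csem_for_inc del: csem.simps(5))
  then show ?case by (simp only: a b tval.simps) (simp add: prod_encode_def)
next
  case (TF a)
  show ?case using TF by (simp add: csem_unpair[simplified] del: csem.simps(5))
next
  case (TG a)
  let ?s = "csem A (unpair_com d) (csem A (cexp a d) s)"
  let ?t = "?s(d := 0, d + 4 := 0)"
  let ?c = "CFor (d + 3) (d + 1) (CIfEq (d + 4) (d + 2) (CInc d) (CInc (d + 4)))"
  have "csem A (cexp (TG a) d) s = csem A ?c ?t" by simp
  moreover have "csem A ?c ?t d = ?t (d + 1) - ?t (d + 2)"
    by (rule csem_for_diff) (auto simp: csem_unpair[simplified])
  ultimately have "csem A (cexp (TG a) d) s d = ?t (d + 1) - ?t (d + 2)" by simp
  then show ?case using TG by (simp add: csem_unpair[simplified])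
qed (auto simp del: csem.simps(5) simp: csem_copy csem.simps(1-4))

lemma csem_cfm:
  "5 \<le> d \<Longrightarrow> csem A (cfm f d) s d = (if fval {e. e + s 0 + 1 \<in> A} (s 0) (s 3) (s 4) f then 1 else 0)"
proof (induction f arbitrary: d s)
  case (Eq a b)
  then show ?case by (simp add: csem_cexp csem_cexp_low)
next
  case (In a)
  then show ?case
    by (simp add: csem_cexp csem_cexp_low csem_for_inc del: csem.simps(5))
      (simp add: add.commute)
next
  case (Nand f g)
  then show ?case by (simp add: csem_cfm_low)
qed

section \<open>The recurrent program\<close>

lemma mrel_terminal: "\<not> mrel prog A (0, s) c"
  by (simp add: mrel_def)

text \<open>\<open>mrel\<close> is deterministic and stuck at label 0, so a run to label 0 passes
  through every state reachable from its start.\<close>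

lemma mrel_halt_after_star:
  assumes "(mrel prog A)\<^sup>*\<^sup>* a b" "(mrel prog A ^^ n) a (0, s)"
  shows "\<exists>m\<le>n. (mrel prog A ^^ m) b (0, s)"
  using assms
proof (induction arbitrary: n rule: converse_rtranclp_induct)
  case base then show ?case by blast
next
  case (step a c)
  then obtain k where n: "n = Suc k"
    using mrel_terminal by (cases n) auto
  with step.prems obtain c' where "mrel prog A a c'" "(mrel prog A ^^ k) c' (0, s)"
    by (metis relpowp_Suc_D2)
  then have "(mrel prog A ^^ k) c (0, s)" using step.hyps by (simp add: mrel_def)
  from step.IH[OF this] n show ?case by (meson le_SucI)
qed

text \<open>The strict decrease makes the length of a supposed halting run an induction measure for
  divergence.\<close>

lemma mrel_halt_after_plus:
  assumes "(mrel prog A)\<^sup>+\<^sup>+ a b" "(mrel prog A ^^ n) a (0, s)"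
  shows "\<exists>m<n. (mrel prog A ^^ m) b (0, s)"
proof -
  obtain c where c: "mrel prog A a c" "(mrel prog A)\<^sup>*\<^sup>* c b" using assms(1) by (meson tranclpD)
  obtain k where n: "n = Suc k" using c(1) assms(2) mrel_terminal by (cases n) auto
  with assms(2) obtain c' where "mrel prog A a c'" "(mrel prog A ^^ k) c' (0, s)"
    by (metis relpowp_Suc_D2)
  then have "(mrel prog A ^^ k) c (0, s)" using c by (simp add: mrel_def)
  from mrel_halt_after_star[OF c(2) this] n show ?thesis by (meson le_imp_less_Suc)
qed

lemma mrel_star_funpow:
  assumes "(mrel prog A)\<^sup>*\<^sup>* a b" shows "\<exists>k. b = (mstep prog A ^^ k) a"
  using assms
proof (induction rule: rtranclp_induct)
  case base then show ?case by (metis funpow_0)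
next
  case (step b c)
  then show ?case by (metis mrel_def funpow.simps(2) comp_apply)
qed

text \<open>The run is cut at its first visit to label 0, beyond which \<open>mrel\<close> does not
  continue.\<close>

lemma funpow_halt_mrel:
  assumes "fst ((mstep prog A ^^ k) a) = 0"
  shows "\<exists>s. (mrel prog A)\<^sup>*\<^sup>* a (0, s)"
proof -
  define n where "n = (LEAST k. fst ((mstep prog A ^^ k) a) = 0)"
  have n: "fst ((mstep prog A ^^ n) a) = 0" unfolding n_def using assms by (rule LeastI)
  have "(mrel prog A)\<^sup>*\<^sup>* a ((mstep prog A ^^ m) a)" if "m \<le> n" for m
    using that
  proof (induction m)
    case (Suc m)
    then have "fst ((mstep prog A ^^ m) a) \<noteq> 0" using not_less_Least[of m "\<lambda>k. fst ((mstep prog A ^^ k) a) = 0"]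
      unfolding n_def by simp
    then have "mrel prog A ((mstep prog A ^^ m) a) ((mstep prog A ^^ Suc m) a)" by (simp add: mrel_def)
    with Suc show ?case by auto
  qed simp
  from this[of n] n show ?thesis by (metis order_refl prod.collapse)
qed

text \<open>Register 0 holds the input and is never written, register 1 bounds the instances checked so far,
  register 2 is reserved for the oracle track, registers 3 and 4 hold the current instance and witness.\<close>

definition eval_code :: "fm \<Rightarrow> instr list" where
  "eval_code \<phi> = compile (cfm \<phi> 5) 3"

text \<open>Register 6 is included because \<open>main_prog\<close> uses it as a zero for
  comparison.\<close>

definition nregs :: "fm \<Rightarrow> nat" where
  "nregs \<phi> = Suc (Max (insert 6 (regs (cfm \<phi> 5))))"

text \<open>Filling all work registers with the input makes every round end with the same
  display.\<close>

definition clean_com :: "fm \<Rightarrow> com" where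
  "clean_com \<phi> = cseq (map (\<lambda>r. CFor r 0 CSkip) [3..<nregs \<phi>])"

text \<open>Label 1 starts a round, label 2 the search for one instance, label 3 the test of one
  witness. At q the truth value in register 5 is compared with 0; a failure goes to q + 5 for the
  next witness, and q + 7 ends the round. Having \<open>Inc 1\<close> at label 0 makes the first
  trip after a display determine register 1.\<close>

definition main_prog :: "fm \<Rightarrow> instr list" where
  "main_prog \<phi> = (let q = 3 + length (eval_code \<phi>) in
    [Inc 1, Rst 3, Rst 4] @ eval_code \<phi> @
    [Rst 6, Jeq 5 6 (q + 5), Jeq 3 1 (q + 7), Inc 3, Jeq 3 3 2, Inc 4, Jeq 4 4 3] @
    compile (clean_com \<phi>) (q + 7) @ [Jeq 0 0 0])"

lemma wfc_clean: "wfc (clean_com \<phi>)"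
proof -
  have "\<forall>r\<in>set rs. 0 < r \<Longrightarrow> wfc (cseq (map (\<lambda>r. CFor r 0 CSkip) rs))" for rs :: "nat list"
    by (induction rs) auto
  then show ?thesis by (auto simp: clean_com_def)
qed

lemma csem_clean:
  "csem A (clean_com \<phi>) s r = (if 3 \<le> r \<and> r < nregs \<phi> then s 0 else s r)"
proof -
  have "\<forall>r\<in>set rs. 0 < r \<Longrightarrow> csem A (cseq (map (\<lambda>r. CFor r 0 CSkip) rs)) s r = (if r \<in> set rs then s 0 else s r)"
    for rs :: "nat list" and s
    by (induction rs arbitrary: s) (auto simp del: csem.simps(5))
  from this[of "[3..<nregs \<phi>]"] show ?thesis by (auto simp: clean_com_def)
qed

section \<open>Rounds of the program\<close>

locale main_run =
  fixes \<phi> :: fm and A :: "nat set" and p :: nat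
begin

abbreviation "pg \<equiv> main_prog \<phi>"
abbreviation "q \<equiv> 3 + length (eval_code \<phi>)"
abbreviation "rel \<equiv> mrel pg A"
abbreviation "holds i v \<equiv> fval {e. e + p + 1 \<in> A} p i v \<phi>"

lemma code:
  "pg ! 0 = Inc 1" "pg ! 1 = Rst 3" "pg ! 2 = Rst 4" "code_at pg 3 (eval_code \<phi>)"
  "pg ! q = Rst 6" "pg ! (q + 1) = Jeq 5 6 (q + 5)" "pg ! (q + 2) = Jeq 3 1 (q + 7)"
  "pg ! (q + 3) = Inc 3" "pg ! (q + 4) = Jeq 3 3 2" "pg ! (q + 5) = Inc 4" "pg ! (q + 6) = Jeq 4 4 3"
  "code_at pg (q + 7) (compile (clean_com \<phi>) (q + 7))"
  "pg ! (q + 7 + length (compile (clean_com \<phi>) (q + 7))) = Jeq 0 0 0"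
  "length pg = q + 8 + length (compile (clean_com \<phi>) (q + 7))"
proof -
  have "code_at pg 0 pg" by (simp add: code_at_def)
  moreover have "pg = [Inc 1, Rst 3, Rst 4] @ eval_code \<phi> @
    [Rst 6, Jeq 5 6 (q + 5), Jeq 3 1 (q + 7), Inc 3, Jeq 3 3 2, Inc 4, Jeq 4 4 3] @
    compile (clean_com \<phi>) (q + 7) @ [Jeq 0 0 0]" by (simp add: main_prog_def Let_def)
  ultimately have "code_at pg 0 ([Inc 1, Rst 3, Rst 4] @ eval_code \<phi> @
    [Rst 6, Jeq 5 6 (q + 5), Jeq 3 1 (q + 7), Inc 3, Jeq 3 3 2, Inc 4, Jeq 4 4 3] @
    compile (clean_com \<phi>) (q + 7) @ [Jeq 0 0 0])" by metis
  then show "pg ! 0 = Inc 1" "pg ! 1 = Rst 3" "pg ! 2 = Rst 4" "code_at pg 3 (eval_code \<phi>)"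
  "pg ! q = Rst 6" "pg ! (q + 1) = Jeq 5 6 (q + 5)" "pg ! (q + 2) = Jeq 3 1 (q + 7)"
  "pg ! (q + 3) = Inc 3" "pg ! (q + 4) = Jeq 3 3 2" "pg ! (q + 5) = Inc 4" "pg ! (q + 6) = Jeq 4 4 3"
  "code_at pg (q + 7) (compile (clean_com \<phi>) (q + 7))"
  "pg ! (q + 7 + length (compile (clean_com \<phi>) (q + 7))) = Jeq 0 0 0"
    by (simp_all add: eval_nat_numeral)
  show "length pg = q + 8 + length (compile (clean_com \<phi>) (q + 7))"
    by (simp add: main_prog_def Let_def)
qed

lemma eval_phase:
  assumes "s 0 = p"
  shows "\<exists>s'. rel\<^sup>*\<^sup>* (3, s) (q + 1, s') \<and> (\<forall>r<5. s' r = s r) \<and> (s' 5 = s' 6 \<longleftrightarrow> \<not> holds (s 3) (s 4))"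
proof -
  let ?s = "csem A (cfm \<phi> 5) s"
  have "rel\<^sup>*\<^sup>* (3, s) (q, ?s)"
    using compile_correct[of "cfm \<phi> 5" pg 3] wfc_cfm[of 5 \<phi>] code(4) code(14)
    by (simp add: eval_code_def)
  also have "rel (q, ?s) (q + 1, ?s(6 := 0))"
    using mrel_Rst[OF code(5)] code(14) by simp
  finally have "rel\<^sup>*\<^sup>* (3, s) (q + 1, ?s(6 := 0))" .
  moreover have "?s 5 = (if holds (s 3) (s 4) then 1 else 0)"
    using csem_cfm[of 5 A \<phi> s] assms by simp
  moreover have "\<forall>r<5. (?s(6 := 0)) r = s r" by (simp add: csem_cfm_low)
  ultimately show ?thesis by (intro exI[of _ "?s(6 := 0)"]) auto
qed

lemma search_fail:
  assumes "s 0 = p" "\<not> holds (s 3) (s 4)"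
  shows "\<exists>s'. rel\<^sup>+\<^sup>+ (3, s) (3, s') \<and> (\<forall>r<4. s' r = s r) \<and> s' 4 = Suc (s 4)"
proof -
  obtain s' where s': "rel\<^sup>*\<^sup>* (3, s) (q + 1, s')" "\<forall>r<5. s' r = s r" "s' 5 = s' 6"
    using eval_phase[of s, OF assms(1)] assms(2) by blast
  note s'(1)
  also have "rel (q + 1, s') (q + 5, s')" using mrel_Jeq[OF code(6)] s'(3) code(14) by simp
  also have "rel (q + 5, s') (q + 6, s'(4 := Suc (s' 4)))"
    using mrel_Inc[OF code(10)] code(14) by simp
  finally have "rel\<^sup>*\<^sup>* (3, s) (q + 6, s'(4 := Suc (s' 4)))" .
  moreover have "rel (q + 6, s'(4 := Suc (s' 4))) (3, s'(4 := Suc (s' 4)))"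
    using mrel_Jeq[OF code(11)] code(14) by simp
  ultimately have "rel\<^sup>+\<^sup>+ (3, s) (3, s'(4 := Suc (s' 4)))" by simp
  then show ?thesis using s'(2) by (intro exI[of _ "s'(4 := Suc (s' 4))"]) auto
qed

text \<open>Induction on the length of a supposed halting run: each failed test returns to label 3
  after at least one step.\<close>

lemma search_diverges:
  assumes "s 0 = p" "\<And>v. \<not> holds (s 3) v"
  shows "\<not> (rel ^^ n) (3, s) (0, t)"
  using assms
proof (induction n arbitrary: s rule: less_induct)
  case (less n)
  obtain s' where s': "rel\<^sup>+\<^sup>+ (3, s) (3, s')" "\<forall>r<4. s' r = s r"
    using search_fail[of s, OF less.prems(1)] less.prems(2) by blast
  show ?case
  proof
    assume "(rel ^^ n) (3, s) (0, t)"
    from mrel_halt_after_plus[OF s'(1) this] obtain m where "m < n" "(rel ^^ m) (3, s') (0, t)" by blast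
    with less.IH[of m s'] less.prems s'(2) show False by simp
  qed
qed

lemma search_success:
  assumes "s 0 = p" "holds (s 3) v" "s 4 \<le> v"
  shows "\<exists>s'. rel\<^sup>*\<^sup>* (3, s) (q + 2, s') \<and> (\<forall>r<4. s' r = s r)"
  using assms
proof (induction "v - s 4" arbitrary: s rule: less_induct)
  case less
  show ?case
  proof (cases "holds (s 3) (s 4)")
    case True
    obtain s' where s': "rel\<^sup>*\<^sup>* (3, s) (q + 1, s')" "\<forall>r<5. s' r = s r" "s' 5 \<noteq> s' 6"
      using eval_phase[of s, OF less.prems(1)] True by blast
    note s'(1)
    also have "rel (q + 1, s') (q + 2, s')" using mrel_Jne[OF code(6)] s'(3) code(14) by simp
    finally show ?thesis using s'(2) by auto
  next
    case False
    then have "s 4 < v" using less.prems by (metis order_le_imp_less_or_eq)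
    obtain s' where s': "rel\<^sup>+\<^sup>+ (3, s) (3, s')" "\<forall>r<4. s' r = s r" "s' 4 = Suc (s 4)"
      using search_fail[of s, OF less.prems(1) False] by blast
    obtain t where t: "rel\<^sup>*\<^sup>* (3, s') (q + 2, t)" "\<forall>r<4. t r = s' r"
      using less.hyps[of s'] s' less.prems \<open>s 4 < v\<close> diff_less_mono2[of "s 4" "s' 4" v] by auto
    have "rel\<^sup>*\<^sup>* (3, s) (q + 2, t)" using s'(1) t(1) by (meson rtranclp_trans tranclp_into_rtranclp)
    then show ?thesis using t(2) s'(2) by auto
  qed
qed

lemma check_start: "rel (2, s) (3, s(4 := 0))"
  using mrel_Rst[OF code(3)] code(14) by simp

lemma check_success:
  assumes "s 0 = p" "\<exists>v. holds (s 3) v"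
  shows "\<exists>s'. rel\<^sup>*\<^sup>* (2, s) (q + 2, s') \<and> (\<forall>r<4. s' r = s r)"
proof -
  obtain v where "holds ((s(4 := 0)) 3) v" using assms by auto
  then obtain s' where s': "rel\<^sup>*\<^sup>* (3, s(4 := 0)) (q + 2, s')" "\<forall>r<4. s' r = (s(4 := 0)) r"
    using search_success[of "s(4 := 0)" v] assms by auto
  have "rel\<^sup>*\<^sup>* (2, s) (q + 2, s')" using check_start s'(1) by (meson converse_rtranclp_into_rtranclp)
  with s'(2) show ?thesis by auto
qed

lemma check_next:
  assumes "s 0 = p" "\<exists>v. holds (s 3) v" "s 3 \<noteq> s 1"
  shows "\<exists>s'. rel\<^sup>*\<^sup>* (2, s) (2, s') \<and> s' 0 = s 0 \<and> s' 1 = s 1 \<and> s' 3 = Suc (s 3)"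
proof -
  obtain s' where s': "rel\<^sup>*\<^sup>* (2, s) (q + 2, s')" "\<forall>r<4. s' r = s r"
    using check_success[of s, OF assms(1,2)] by blast
  note s'(1)
  also have "rel (q + 2, s') (q + 3, s')" using mrel_Jne[OF code(7)] s'(2) assms(3) code(14) by simp
  also have "rel (q + 3, s') (q + 4, s'(3 := Suc (s' 3)))"
    using mrel_Inc[OF code(8)] code(14) by simp
  also have "rel (q + 4, s'(3 := Suc (s' 3))) (2, s'(3 := Suc (s' 3)))"
    using mrel_Jeq[OF code(9)] code(14) by simp
  finally show ?thesis using s'(2) by (intro exI[of _ "s'(3 := Suc (s' 3))"]) auto
qed

lemma check_last:
  assumes "s 0 = p" "\<exists>v. holds (s 3) v" "s 3 = s 1"
  shows "\<exists>s'. rel\<^sup>*\<^sup>* (2, s) (0, s') \<and> s' 0 = p \<and> s' 1 = s 1 \<and> (\<forall>r. 3 \<le> r \<and> r < nregs \<phi> \<longrightarrow> s' r = p)"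
proof -
  obtain s' where s': "rel\<^sup>*\<^sup>* (2, s) (q + 2, s')" "\<forall>r<4. s' r = s r"
    using check_success[of s, OF assms(1,2)] by blast
  let ?t = "csem A (clean_com \<phi>) s'"
  let ?e = "q + 7 + length (compile (clean_com \<phi>) (q + 7))"
  note s'(1)
  also have "rel (q + 2, s') (q + 7, s')" using mrel_Jeq[OF code(7)] s'(2) assms(3) code(14) by simp
  also have "rel\<^sup>*\<^sup>* (q + 7, s') (?e, ?t)"
    using compile_correct[OF wfc_clean code(12)] code(14) by simp
  also have "rel (?e, ?t) (0, ?t)" using mrel_Jeq[OF code(13)] code(14) by simp
  finally show ?thesis using s'(2) assms by (intro exI[of _ ?t]) (simp add: csem_clean)
qed

lemma check_loop:
  assumes "s 0 = p" "s 3 \<le> s 1" "\<And>i. s 3 \<le> i \<Longrightarrow> i \<le> s 1 \<Longrightarrow> \<exists>v. holds i v"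
  shows "\<exists>s'. rel\<^sup>*\<^sup>* (2, s) (0, s') \<and> s' 0 = p \<and> s' 1 = s 1 \<and> (\<forall>r. 3 \<le> r \<and> r < nregs \<phi> \<longrightarrow> s' r = p)"
  using assms
proof (induction "s 1 - s 3" arbitrary: s rule: less_induct)
  case less
  show ?case
  proof (cases "s 3 = s 1")
    case True then show ?thesis using check_last[of s] less.prems by simp
  next
    case False
    then obtain s' where s': "rel\<^sup>*\<^sup>* (2, s) (2, s')" "s' 0 = s 0" "s' 1 = s 1" "s' 3 = Suc (s 3)"
      using check_next[of s] less.prems by auto
    obtain t where t: "rel\<^sup>*\<^sup>* (2, s') (0, t)" "t 0 = p" "t 1 = s' 1" "\<forall>r. 3 \<le> r \<and> r < nregs \<phi> \<longrightarrow> t r = p"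
      using less.hyps[of s'] s' less.prems False diff_less_mono2[of "s 3" "s' 3" "s 1"] by auto
    have "rel\<^sup>*\<^sup>* (2, s) (0, t)" using s'(1) t(1) by (rule rtranclp_trans)
    then show ?thesis using t(2-) s' by (intro exI[of _ t]) auto
  qed
qed

text \<open>Instances are checked in order up to i, and the first one without a witness, at the
  latest i, traps the run.\<close>

lemma check_diverges:
  assumes "s 0 = p" "s 3 \<le> i" "i \<le> s 1" "\<And>v. \<not> holds i v"
  shows "\<not> rel\<^sup>*\<^sup>* (2, s) (0, t)"
  using assms
proof (induction "i - s 3" arbitrary: s rule: less_induct)
  case less
  show ?case
  proof
    assume "rel\<^sup>*\<^sup>* (2, s) (0, t)"
    then obtain n where n: "(rel ^^ n) (2, s) (0, t)" by (meson rtranclp_imp_relpowp)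
    show False
    proof (cases "\<exists>v. holds (s 3) v")
      case True
      then have "s 3 < i" using less.prems by (metis order_le_imp_less_or_eq)
      then obtain s' where s': "rel\<^sup>*\<^sup>* (2, s) (2, s')" "s' 0 = s 0" "s' 1 = s 1" "s' 3 = Suc (s 3)"
        using check_next[of s] less.prems True by auto
      from mrel_halt_after_star[OF s'(1) n] have "rel\<^sup>*\<^sup>* (2, s') (0, t)" by (meson relpowp_imp_rtranclp)
      with less.hyps[of s'] s' less.prems \<open>s 3 < i\<close> diff_less_mono2[of "s 3" "s' 3" i] show False by auto
    next
      case False
      from mrel_halt_after_star[OF r_into_rtranclp[where r = rel, OF check_start[of s]] n]
      obtain m where "(rel ^^ m) (3, s(4 := 0)) (0, t)" by blast
      with search_diverges[of "s(4 := 0)" m t] less.prems False show False by auto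
    qed
  qed
qed

lemma display_step: "mstep pg A (0, s) = (1, s(1 := Suc (s 1)))"
  using code(1,14) by (simp add: mstep_def nxt_def)

lemma cycle_start: "rel (1, s) (2, s(3 := 0))"
  using mrel_Rst[OF code(2)] code(14) by (simp add: numeral_2_eq_2)

lemma cycle:
  assumes "s 0 = p" "\<And>i. i \<le> s 1 \<Longrightarrow> \<exists>v. holds i v"
  shows "\<exists>s'. rel\<^sup>*\<^sup>* (1, s) (0, s') \<and> s' 0 = p \<and> s' 1 = s 1 \<and> (\<forall>r. 3 \<le> r \<and> r < nregs \<phi> \<longrightarrow> s' r = p)"
proof -
  obtain s' where s': "rel\<^sup>*\<^sup>* (2, s(3 := 0)) (0, s')" "s' 0 = p" "s' 1 = s 1"
    "\<forall>r. 3 \<le> r \<and> r < nregs \<phi> \<longrightarrow> s' r = p"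
    using check_loop[of "s(3 := 0)"] assms by auto
  have "rel\<^sup>*\<^sup>* (1, s) (0, s')" using cycle_start s'(1) by (rule converse_rtranclp_into_rtranclp)
  with s' show ?thesis by blast
qed

lemma cycle_diverges:
  assumes "s 0 = p" "i \<le> s 1" "\<And>v. \<not> holds i v"
  shows "\<not> rel\<^sup>*\<^sup>* (1, s) (0, t)"
proof
  assume "rel\<^sup>*\<^sup>* (1, s) (0, t)"
  then obtain n where n: "(rel ^^ n) (1, s) (0, t)" by (meson rtranclp_imp_relpowp)
  from mrel_halt_after_star[OF r_into_rtranclp[where r = rel, OF cycle_start[of s]] n]
  have "rel\<^sup>*\<^sup>* (2, s(3 := 0)) (0, t)" by (meson relpowp_imp_rtranclp)
  with check_diverges[of "s(3 := 0)" i t] assms show False by simp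
qed

text \<open>If i had no witness, recurrence would still complete rounds, each raising register 1,
  until the bound reaches i; that round cannot end. Of the start state only the input is assumed, in
  particular nothing about register 1.\<close>

theorem recurrence_sound:
  assumes "s 0 = p" and inf: "\<And>n. \<exists>k\<ge>n. fst ((mstep pg A ^^ k) (1, s)) = 0"
  shows "\<exists>v. holds i v"
proof (rule ccontr)
  assume no: "\<nexists>v. holds i v"
  have hit: "\<exists>u. rel\<^sup>*\<^sup>* ((mstep pg A ^^ k) (1, s)) (0, u)" for k
  proof -
    obtain k' where "k' \<ge> k" "fst ((mstep pg A ^^ k') (1, s)) = 0" using inf by blast
    then have "fst ((mstep pg A ^^ (k' - k)) ((mstep pg A ^^ k) (1, s))) = 0"
      by (metis comp_apply funpow_add le_add_diff_inverse2)
    then show ?thesis by (rule funpow_halt_mrel)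
  qed
  have "\<exists>k u. (mstep pg A ^^ k) (1, s) = (1, u) \<and> u 0 = p \<and> m \<le> u 1" for m
  proof (induction m)
    case 0 then show ?case using assms(1) by (intro exI[of _ 0]) auto
  next
    case (Suc m)
    then obtain k u where k: "(mstep pg A ^^ k) (1, s) = (1, u)" "u 0 = p" "m \<le> u 1" by blast
    obtain w where "rel\<^sup>*\<^sup>* (1, u) (0, w)" using hit[of k] k(1) by auto
    \<comment> \<open>Since this round ends, all instances up to its bound have witnesses.\<close>
    then have "\<exists>v. holds j v" if "j \<le> u 1" for j using cycle_diverges[of u j w] k(2) that by blast
    then obtain u' where u': "rel\<^sup>*\<^sup>* (1, u) (0, u')" "u' 0 = p" "u' 1 = u 1"
      using cycle[of u] k(2) by blast
    obtain k' where "(0, u') = (mstep pg A ^^ k') (1, u)" using mrel_star_funpow[OF u'(1)] by blast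
    then have "(mstep pg A ^^ (Suc (k' + k))) (1, s) = (1, u'(1 := Suc (u' 1)))"
      using k(1) display_step[of u'] by (simp add: funpow_add)
    then show ?case using u' k(3) by (intro exI[of _ "Suc (k' + k)"] exI[of _ "u'(1 := Suc (u' 1))"]) auto
  qed
  then obtain k u where k: "(mstep pg A ^^ k) (1, s) = (1, u)" "u 0 = p" "i \<le> u 1" by blast
  obtain w where "rel\<^sup>*\<^sup>* (1, u) (0, w)" using hit[of k] k(1) by auto
  with cycle_diverges[of u i w] k no show False by blast
qed

text \<open>The conclusion \<open>s 1 < u 1\<close> serves to keep mark 1 out of the displayed
  cells.\<close>

theorem recurrence_complete:
  assumes "s 0 = p" and "\<And>i. \<exists>v. holds i v"
  shows "\<exists>k\<ge>n. \<exists>u. (mstep pg A ^^ k) (0, s) = (0, u) \<and> u 0 = p \<and> s 1 < u 1 \<and>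
    (\<forall>r. 3 \<le> r \<and> r < nregs \<phi> \<longrightarrow> u r = p)"
proof -
  have again: "\<exists>k\<ge>1. \<exists>u. (mstep pg A ^^ k) (0, s) = (0, u) \<and> u 0 = p \<and> s 1 < u 1 \<and>
    (\<forall>r. 3 \<le> r \<and> r < nregs \<phi> \<longrightarrow> u r = p)" if sp: "s 0 = p" for s
  proof -
    let ?s = "s(1 := Suc (s 1))"
    obtain u where u: "rel\<^sup>*\<^sup>* (1, ?s) (0, u)" "u 0 = p" "u 1 = ?s 1" "\<forall>r. 3 \<le> r \<and> r < nregs \<phi> \<longrightarrow> u r = p"
      using cycle[of ?s] assms(2) sp by auto
    obtain k where "(0, u) = (mstep pg A ^^ k) (1, ?s)" using mrel_star_funpow[OF u(1)] by blast
    then have "(mstep pg A ^^ (Suc k)) (0, s) = (0, u)"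
      by (simp only: funpow_Suc_right o_apply display_step)
    with u show ?thesis by (intro exI[of _ "Suc k"]) auto
  qed
  show ?thesis
  proof (induction n)
    case 0 show ?case using again[of s, OF assms(1)] by auto
  next
    case (Suc n)
    then obtain k u where k: "k \<ge> n" "(mstep pg A ^^ k) (0, s) = (0, u)" "u 0 = p" "s 1 < u 1" by blast
    obtain k' u' where k': "k' \<ge> 1" "(mstep pg A ^^ k') (0, u) = (0, u')" "u' 0 = p" "u 1 < u' 1"
      "\<forall>r. 3 \<le> r \<and> r < nregs \<phi> \<longrightarrow> u' r = p" using again[of u, OF k(3)] by blast
    have "(mstep pg A ^^ (k' + k)) (0, s) = (0, u')" using k(2) k'(2) by (simp add: funpow_add)
    then show ?case using k k' by (intro exI[of _ "k' + k"]) auto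
  qed
qed

end

section \<open>Counter machines in a cellular automaton\<close>

text \<open>The machine lives to the right of an \<open>Org\<close> cell. Register \<open>r\<close> holds the distance from \<open>Org\<close> to the
  leftmost mark \<open>r\<close>; further marks \<open>r\<close> are garbage which increments swallow. Accordingly, resetting a
  register only adds a mark on the \<open>Org\<close> cell. A head \<open>Rt l\<close> runs to the cell where instruction \<open>l\<close> takes
  effect and returns as \<open>Lf l b\<close> with the outcome \<open>b\<close> of the test.\<close>

datatype region = Out | Org | Ins
datatype head = No | Rt nat | Lf nat bool
datatype cell = Cell (cty: region) (cmk: "nat set") (chd: head)

text \<open>The default for labels out of range writes nothing, so bounds on written marks hold for
  every label.\<close>

definition fetch :: "instr list \<Rightarrow> nat \<Rightarrow> instr" where
  "fetch prog l = (if l < length prog then prog ! l else Jeq 0 0 0)"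

fun stops :: "instr \<Rightarrow> nat set \<Rightarrow> bool" where
  "stops (Inc r) S = (r \<in> S)"
| "stops (Rst r) S = True"
| "stops (Jeq a b l) S = (a \<in> S \<or> b \<in> S)"
| "stops (Jin r l) S = (r \<in> S)"

text \<open>The first cell with mark a or b carries both exactly if the registers agree. Mark 2 is
  the oracle track.\<close>

fun answer :: "instr \<Rightarrow> nat set \<Rightarrow> bool" where
  "answer (Jeq a b l) S = (a \<in> S \<and> b \<in> S)"
| "answer (Jin r l) S = (2 \<in> S)"
| "answer _ S = False"

fun act :: "instr \<Rightarrow> nat set \<Rightarrow> nat set" where
  "act (Inc r) S = S - {r}"
| "act (Rst r) S = insert r S"
| "act _ S = S"

text \<open>The pushed mark is united with the marks of the next cell; this merging is how
  increments swallow garbage.\<close>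

fun push :: "instr \<Rightarrow> nat set" where
  "push (Inc r) = {r}"
| "push _ = {}"

fun reads :: "instr \<Rightarrow> nat set" where
  "reads (Inc r) = {r}" | "reads (Rst r) = {}" | "reads (Jeq a b l) = {a, b}" | "reads (Jin r l) = {r}"

fun writes :: "instr \<Rightarrow> nat set" where
  "writes (Inc r) = {r}" | "writes (Rst r) = {r}" | "writes _ = {}"

text \<open>Unlike \<open>upd\<close>, this refers to the cell where the head stopped and not to the
  old value, so it also applies to a register whose value was unknown.\<close>

fun place :: "instr \<Rightarrow> nat \<Rightarrow> (nat \<Rightarrow> nat) \<Rightarrow> (nat \<Rightarrow> nat)" where
  "place (Inc r) i s = s(r := Suc i)" | "place (Rst r) i s = s(r := 0)" | "place _ i s = s"

definition running :: "instr list \<Rightarrow> cell \<Rightarrow> bool" where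
  "running prog c \<longleftrightarrow> (\<exists>l. chd c = Rt l \<and> \<not> stops (fetch prog l) (cmk c))"

text \<open>Nothing enters a cell from an \<open>Out\<close> neighbour on its left, right-moving heads annihilate left-moving
  ones, and everything to the right of \<open>Org\<close> is turned into \<open>Ins\<close> at speed 1.\<close>

definition rule :: "instr list \<Rightarrow> cell \<Rightarrow> cell \<Rightarrow> cell \<Rightarrow> cell" where
  "rule prog l c r = Cell
    (if cty l \<noteq> Out then Ins else cty c)
    ((case chd c of Rt a \<Rightarrow> if stops (fetch prog a) (cmk c) then act (fetch prog a) (cmk c) else cmk c
        | _ \<Rightarrow> cmk c) \<union>
     (if cty l \<noteq> Out then (case chd l of Rt a \<Rightarrow> if stops (fetch prog a) (cmk l) then push (fetch prog a) else {}
        | _ \<Rightarrow> {}) else {}))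
    (if cty l \<noteq> Out \<and> running prog l then chd l
     else (case chd c of
        Rt a \<Rightarrow> if stops (fetch prog a) (cmk c) then Lf a (answer (fetch prog a) (cmk c)) else No
      | Lf a b \<Rightarrow> if cty c = Org \<and> cty l = Out then Rt (nxt prog a b)
          else (case chd r of Lf a' b' \<Rightarrow> Lf a' b' | _ \<Rightarrow> No)
      | No \<Rightarrow> (case chd r of Lf a' b' \<Rightarrow> Lf a' b' | _ \<Rightarrow> No)))"

text \<open>The evolution to the right of a permanent \<open>Out\<close> cell. Any such cell may be
  put in, because \<open>rule\<close> ignores everything else about an \<open>Out\<close> neighbour
  on its left.\<close>

definition half :: "instr list \<Rightarrow> (nat \<Rightarrow> cell) \<Rightarrow> nat \<Rightarrow> cell" where
  "half prog z j = rule prog (case j of 0 \<Rightarrow> Cell Out {} No | Suc i \<Rightarrow> z i) (z j) (z (Suc j))"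

locale ca_prog =
  fixes prog :: "instr list"
  assumes nonempty: "0 < length prog"
begin

abbreviation "G \<equiv> half prog"
abbreviation "ins \<equiv> fetch prog"

text \<open>\<open>F\<close> steps after the observation starts, the first \<open>F\<close> cells contain no right-moving head except the
  one emitted by \<open>Org\<close>: foreign ones were ahead of it and move at the same speed. Hence registers whose
  value is at most \<open>F\<close> are out of reach of the garbage in the initial configuration.\<close>

definition front :: "nat \<Rightarrow> (nat \<Rightarrow> cell) \<Rightarrow> bool" where
  "front F z \<longleftrightarrow> cty (z 0) = Org \<and> (\<forall>j. 0 < j \<and> j \<le> F \<longrightarrow> cty (z j) = Ins)"

definition regok :: "nat \<Rightarrow> nat set \<Rightarrow> (nat \<Rightarrow> nat) \<Rightarrow> (nat \<Rightarrow> cell) \<Rightarrow> bool" where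
  "regok F V s z \<longleftrightarrow> (\<forall>r\<in>V. s r \<le> F \<and> r \<in> cmk (z (s r)) \<and> (\<forall>j<s r. r \<notin> cmk (z j)))"

text \<open>With B false, foreign left-moving heads beyond i are tolerated, as needed for unknown
  configurations. With B true there is no other head at all, as needed to produce an exact
  display.\<close>

definition quiet :: "bool \<Rightarrow> nat \<Rightarrow> nat \<Rightarrow> (nat \<Rightarrow> cell) \<Rightarrow> bool" where
  "quiet B F i z \<longleftrightarrow> (\<forall>j<i. chd (z j) = No) \<and> (\<forall>j>i. j \<le> F \<longrightarrow> (\<forall>l. chd (z j) \<noteq> Rt l)) \<and>
    (B \<longrightarrow> (\<forall>j>i. chd (z j) = No))"

definition outbound :: "bool \<Rightarrow> nat \<Rightarrow> nat \<Rightarrow> nat \<Rightarrow> nat set \<Rightarrow> (nat \<Rightarrow> nat) \<Rightarrow> (nat \<Rightarrow> cell) \<Rightarrow> bool" where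
  "outbound B F i l V s z \<longleftrightarrow> front F z \<and> i \<le> F \<and> quiet B F i z \<and> chd (z i) = Rt l \<and>
    (\<forall>j<i. \<not> stops (ins l) (cmk (z j))) \<and> regok F V s z"

definition inbound :: "bool \<Rightarrow> nat \<Rightarrow> nat \<Rightarrow> nat \<Rightarrow> bool \<Rightarrow> nat set \<Rightarrow> (nat \<Rightarrow> nat) \<Rightarrow> (nat \<Rightarrow> cell) \<Rightarrow> bool" where
  "inbound B F i l b V s z \<longleftrightarrow> front F z \<and> i \<le> F \<and> quiet B F i z \<and> chd (z i) = Lf l b \<and> regok F V s z"

section \<open>Single steps on the half-line\<close>

lemma front_step: "front F z \<Longrightarrow> front (Suc F) (G z)"
  unfolding front_def half_def rule_def
  by (auto split: nat.splits) (metis le_zero_eq not0_implies_Suc not_less_eq_eq region.distinct zero_less_Suc Suc_le_mono neq0_conv)+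

lemma front_nonOut: "front F z \<Longrightarrow> j \<le> F \<Longrightarrow> cty (z j) \<noteq> Out"
  unfolding front_def by (cases j) auto

lemma Rt_origin:
  assumes "front F z" "j \<le> F" "chd (G z (Suc j)) = Rt l"
  shows "chd (z j) = Rt l \<and> running prog (z j)"
  using assms front_nonOut[OF assms(1,2)]
  by (auto simp: half_def rule_def split: if_splits head.splits)

lemma marks_same:
  assumes "\<And>l. chd (z j) = Rt l \<Longrightarrow> \<not> stops (ins l) (cmk (z j))"
    and "\<And>i l. j = Suc i \<Longrightarrow> chd (z i) = Rt l \<Longrightarrow> \<not> stops (ins l) (cmk (z i))"
  shows "cmk (G z j) = cmk (z j)"
  using assms by (auto simp: half_def rule_def split: head.splits nat.splits)

lemma quiet_no_Rt:
  "quiet B F i z \<Longrightarrow> j \<le> F \<Longrightarrow> j \<noteq> i \<Longrightarrow> chd (z j) \<noteq> Rt l"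
  unfolding quiet_def by (metis head.distinct(1) linorder_neqE_nat)

lemma head_step:
  assumes "j \<noteq> i" "\<And>k. j = Suc k \<Longrightarrow> \<not> running prog (z k)" "chd (z j) = No"
  shows "chd (G z j) = (case chd (z (Suc j)) of Lf a b \<Rightarrow> Lf a b | _ \<Rightarrow> No)"
  using assms by (auto simp: half_def rule_def running_def split: head.splits nat.splits)

lemma advance:
  assumes R: "outbound B F i l V s z" and ns: "\<not> stops (ins l) (cmk (z i))"
  shows "outbound B (Suc F) (Suc i) l V s (G z)"
proof -
  have fr: "front F z" and iF: "i \<le> F" and q: "quiet B F i z" and h: "chd (z i) = Rt l"
    and st: "\<And>j. j < i \<Longrightarrow> \<not> stops (ins l) (cmk (z j))" and rg: "regok F V s z"
    using R by (auto simp: outbound_def)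
  have run: "running prog (z i)" using h ns by (auto simp: running_def)
  have same: "cmk (G z j) = cmk (z j)" if "j \<le> F" for j
  proof (rule marks_same)
    show "\<not> stops (ins a) (cmk (z j))" if "chd (z j) = Rt a" for a
      using quiet_no_Rt[OF q \<open>j \<le> F\<close>] that h ns by (cases "j = i") auto
    show "\<not> stops (ins a) (cmk (z k))" if "j = Suc k" "chd (z k) = Rt a" for k a
      using quiet_no_Rt[OF q, of k] that \<open>j \<le> F\<close> h ns by (cases "k = i") auto
  qed
  have head: "chd (G z (Suc i)) = Rt l"
    using run front_nonOut[OF fr iF] h by (auto simp: half_def rule_def)
  have nr: "\<not> running prog (z k)" if "k \<le> F" "k \<noteq> i" for k
    using quiet_no_Rt[OF q that(1,2)] by (auto simp: running_def)
  have "quiet B (Suc F) (Suc i) (G z)"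
    unfolding quiet_def
  proof (intro conjI allI impI)
    fix j assume "j < Suc i"
    show "chd (G z j) = No"
    proof (cases "j = i")
      case True
      have "\<not> running prog (z k)" if "j = Suc k" for k using that True iF nr[of k] by auto
      then show ?thesis using True h ns
        by (auto simp: half_def rule_def split: nat.splits head.splits)
    next
      case False
      then have "j < i" using \<open>j < Suc i\<close> by simp
      have No: "chd (z j) = No" using q \<open>j < i\<close> by (simp add: quiet_def)
      have "chd (G z j) = (case chd (z (Suc j)) of Lf a b \<Rightarrow> Lf a b | _ \<Rightarrow> No)"
        by (rule head_step[where i = i]) (use False No nr \<open>j < i\<close> iF in auto)
      moreover have "chd (z (Suc j)) = No \<or> chd (z (Suc j)) = Rt l"
        using q h \<open>j < i\<close> unfolding quiet_def by (metis Suc_lessI)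
      ultimately show ?thesis by auto
    qed
  next
    fix j l' assume j: "Suc i < j" "j \<le> Suc F"
    then obtain k where k: "j = Suc k" "i < k" "k \<le> F" by (cases j) auto
    show "chd (G z j) \<noteq> Rt l'" using Rt_origin[OF fr k(3), of l'] nr[OF k(3)] k by auto
  next
    fix j assume B: B and j: "Suc i < j"
    then obtain k where k: "j = Suc k" "i < k" by (cases j) auto
    have No: "chd (z j) = No" "chd (z k) = No" "chd (z (Suc j)) = No"
      using q B j k by (auto simp: quiet_def)
    have "chd (G z j) = (case chd (z (Suc j)) of Lf a b \<Rightarrow> Lf a b | _ \<Rightarrow> No)"
      by (rule head_step[where i = i]) (use No k in \<open>auto simp: running_def\<close>)
    then show "chd (G z j) = No" using No by simp
  qed
  moreover have "regok (Suc F) V s (G z)"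
    using rg same unfolding regok_def by (metis le_SucI less_imp_le_nat order_trans)
  moreover have "\<not> stops (ins l) (cmk (G z j))" if "j < Suc i" for j
    using same[of j] st[of j] ns that iF by (cases "j = i") auto
  ultimately show ?thesis using front_step[OF fr] iF head by (simp add: outbound_def)
qed

text \<open>For \<open>Inc r\<close>, no cell before i carried r and cell i has just lost it, so the
  leftmost r is now at \<open>Suc i\<close>, whatever lies beyond. The register thus becomes known
  even if it was not in V.\<close>

lemma turn:
  assumes R: "outbound B F i l V s z" and st: "stops (ins l) (cmk (z i))"
  shows "inbound B (Suc F) i l (answer (ins l) (cmk (z i))) (V \<union> writes (ins l)) (place (ins l) i s) (G z)"
proof -
  have fr: "front F z" and iF: "i \<le> F" and q: "quiet B F i z" and h: "chd (z i) = Rt l"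
    and nst: "\<And>j. j < i \<Longrightarrow> \<not> stops (ins l) (cmk (z j))" and rg: "regok F V s z"
    using R by (auto simp: outbound_def)
  have nr: "\<not> running prog (z k)" if "k \<le> F" for k
    using quiet_no_Rt[OF q that] h st by (cases "k = i") (auto simp: running_def)
  have same: "cmk (G z j) = cmk (z j)" if "j \<le> F" "j \<noteq> i" "j \<noteq> Suc i" for j
    by (rule marks_same) (use that quiet_no_Rt[OF q] Suc_leD in fastforce)+
  have at_i: "cmk (G z i) = act (ins l) (cmk (z i))"
  proof -
    have "\<not> (\<exists>a. chd (z k) = Rt a)" if "i = Suc k" for k using quiet_no_Rt[OF q, of k] that iF by auto
    then show ?thesis using h st by (auto simp: half_def rule_def split: nat.splits head.splits)
  qed
  have push_i: "push (ins l) \<subseteq> cmk (G z (Suc i))"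
    using h st front_nonOut[OF fr iF] by (auto simp: half_def rule_def)
  have at_Si: "cmk (G z (Suc i)) = cmk (z (Suc i)) \<union> push (ins l)" if "Suc i \<le> F"
    using quiet_no_Rt[OF q that] h st front_nonOut[OF fr iF]
    by (auto simp: half_def rule_def split: head.splits)
  have head: "chd (G z i) = Lf l (answer (ins l) (cmk (z i)))"
  proof -
    have "\<not> running prog (z k)" if "i = Suc k" for k using nr[of k] that iF by auto
    then show ?thesis using h st by (auto simp: half_def rule_def split: nat.splits)
  qed
  have "quiet B (Suc F) i (G z)"
    unfolding quiet_def
  proof (intro conjI allI impI)
    fix j assume "j < i"
    have No: "chd (z j) = No" using q \<open>j < i\<close> by (simp add: quiet_def)
    have "chd (G z j) = (case chd (z (Suc j)) of Lf a b \<Rightarrow> Lf a b | _ \<Rightarrow> No)"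
      by (rule head_step[where i = i]) (use No nr \<open>j < i\<close> iF in auto)
    moreover have "chd (z (Suc j)) = No \<or> chd (z (Suc j)) = Rt l"
      using q h \<open>j < i\<close> unfolding quiet_def by (metis Suc_lessI)
    ultimately show "chd (G z j) = No" by auto
  next
    fix j l' assume j: "i < j" "j \<le> Suc F"
    then obtain k where k: "j = Suc k" "k \<le> F" by (cases j) auto
    show "chd (G z j) \<noteq> Rt l'" using Rt_origin[OF fr k(2), of l'] nr[OF k(2)] k by auto
  next
    fix j assume B: B and j: "i < j"
    then obtain k where k: "j = Suc k" "i \<le> k" by (cases j) auto
    have No: "chd (z j) = No" "chd (z (Suc j)) = No" using q B j by (auto simp: quiet_def)
    have nrk: "\<not> running prog (z k)"
    proof (cases "k = i")
      case True then show ?thesis using nr iF by simp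
    next
      case False then show ?thesis using q B k by (auto simp: quiet_def running_def)
    qed
    have "chd (G z j) = (case chd (z (Suc j)) of Lf a b \<Rightarrow> Lf a b | _ \<Rightarrow> No)"
      by (rule head_step[where i = i]) (use No k nrk in auto)
    then show "chd (G z j) = No" using No by simp
  qed
  moreover have "regok (Suc F) (V \<union> writes (ins l)) (place (ins l) i s) (G z)"
  proof -
    have other: "s r \<le> Suc F \<and> r \<in> cmk (G z (s r)) \<and> (\<forall>j<s r. r \<notin> cmk (G z j))"
      if "r \<in> V" "r \<notin> writes (ins l)" for r
    proof -
      have r: "s r \<le> F" "r \<in> cmk (z (s r))" "\<And>j. j < s r \<Longrightarrow> r \<notin> cmk (z j)"
        using rg that(1) by (auto simp: regok_def)
      have eq: "r \<in> cmk (G z j) \<longleftrightarrow> r \<in> cmk (z j)" if "j \<le> F" for j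
      proof (cases "j = i")
        case True then show ?thesis using at_i \<open>r \<notin> writes (ins l)\<close> by (cases "ins l") auto
      next
        case False
        show ?thesis
        proof (cases "j = Suc i")
          case True then show ?thesis using at_Si \<open>r \<notin> writes (ins l)\<close> that by (cases "ins l") auto
        qed (use same that False in auto)
      qed
      show ?thesis using r eq by (meson le_SucI less_imp_le_nat order_trans)
    qed
    have marksi: "r \<notin> cmk (G z j)" if "ins l = Inc r" "j < Suc i" for r j
    proof (cases "j = i")
      case True then show ?thesis using at_i that by simp
    next
      case False
      then have "j < i" using that by simp
      then show ?thesis using same[of j] nst[of j] that iF by simp
    qed
    \<comment> \<open>\<open>Rst\<close> stops in every cell, so a head carrying it cannot have left
      the origin.\<close>
    have Rst0: "i = 0" if "ins l = Rst r" for r using nst[of 0] that by (cases i) auto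
    show ?thesis
    proof (cases "ins l")
      case (Inc r)
      then show ?thesis using other marksi[OF Inc] push_i iF by (auto simp: regok_def)
    next
      case (Rst r)
      then show ?thesis using other Rst0[OF Rst] at_i by (auto simp: regok_def)
    qed (use other in \<open>auto simp: regok_def\<close>)
  qed
  ultimately show ?thesis using front_step[OF fr] iF head by (simp add: inbound_def)
qed

lemma return:
  assumes L: "inbound B F (Suc i) l b V s z"
  shows "inbound B (Suc F) i l b V s (G z)"
proof -
  have fr: "front F z" and iF: "Suc i \<le> F" and q: "quiet B F (Suc i) z" and h: "chd (z (Suc i)) = Lf l b"
    and rg: "regok F V s z" using L by (auto simp: inbound_def)
  have nRt: "chd (z k) \<noteq> Rt a" if "k \<le> F" for k a
    using quiet_no_Rt[OF q that] h by (cases "k = Suc i") auto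
  then have nr: "\<not> running prog (z k)" if "k \<le> F" for k using that by (auto simp: running_def)
  have same: "cmk (G z j) = cmk (z j)" if "j \<le> F" for j
    by (rule marks_same) (use that nRt Suc_leD in blast)+
  have low: "chd (G z j) = (case chd (z (Suc j)) of Lf a b \<Rightarrow> Lf a b | _ \<Rightarrow> No)" if "j \<le> i" for j
    by (rule head_step[where i = "Suc i"]) (use that nr iF q in \<open>auto simp: quiet_def\<close>)
  have "quiet B (Suc F) i (G z)"
    unfolding quiet_def
  proof (intro conjI allI impI)
    fix j assume "j < i"
    then show "chd (G z j) = No" using low[of j] q by (simp add: quiet_def)
  next
    fix j l' assume j: "i < j" "j \<le> Suc F"
    then obtain k where k: "j = Suc k" "k \<le> F" by (cases j) auto
    show "chd (G z j) \<noteq> Rt l'" using Rt_origin[OF fr k(2), of l'] nr[OF k(2)] k by auto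
  next
    fix j assume B: B and j: "i < j"
    then obtain k where k: "j = Suc k" by (cases j) auto
    have No: "chd (z (Suc j)) = No" using q B j by (auto simp: quiet_def)
    have nrk: "\<not> running prog (z k)"
      using q B j k nr[of k] iF by (cases "k = i \<or> k = Suc i") (auto simp: quiet_def running_def)
    show "chd (G z j) = No"
    proof (cases "j = Suc i")
      case True
      have "cty (z i) \<noteq> Out" using front_nonOut[OF fr] iF by simp
      then show ?thesis using True h nrk k No by (auto simp: half_def rule_def)
    next
      case False
      then have "chd (z j) = No" using q B j by (auto simp: quiet_def)
      have "chd (G z j) = (case chd (z (Suc j)) of Lf a b \<Rightarrow> Lf a b | _ \<Rightarrow> No)"
        by (rule head_step[where i = "Suc i"]) (use False \<open>chd (z j) = No\<close> k nrk in auto)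
      then show ?thesis using No by simp
    qed
  qed
  moreover have "chd (G z i) = Lf l b" using low[of i] h by simp
  moreover have "regok (Suc F) V s (G z)"
    using rg same unfolding regok_def by (metis le_SucI less_imp_le_nat order_trans)
  ultimately show ?thesis using front_step[OF fr] iF by (simp add: inbound_def)
qed

lemma emit:
  assumes L: "inbound B F 0 l b V s z"
  shows "outbound B (Suc F) 0 (nxt prog l b) V s (G z)"
proof -
  have fr: "front F z" and q: "quiet B F 0 z" and h: "chd (z 0) = Lf l b"
    and rg: "regok F V s z" using L by (auto simp: inbound_def)
  have nRt: "chd (z k) \<noteq> Rt a" if "k \<le> F" for k a
    using quiet_no_Rt[OF q that] h by (cases "k = 0") auto
  then have nr: "\<not> running prog (z k)" if "k \<le> F" for k using that by (auto simp: running_def)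
  have same: "cmk (G z j) = cmk (z j)" if "j \<le> F" for j
    by (rule marks_same) (use that nRt Suc_leD in blast)+
  have "chd (G z 0) = Rt (nxt prog l b)"
    using h fr by (simp add: half_def rule_def front_def)
  moreover have "quiet B (Suc F) 0 (G z)"
    unfolding quiet_def
  proof (intro conjI allI impI)
    fix j l' assume j: "0 < j" "j \<le> Suc F"
    then obtain k where k: "j = Suc k" "k \<le> F" by (cases j) auto
    show "chd (G z j) \<noteq> Rt l'" using Rt_origin[OF fr k(2), of l'] nr[OF k(2)] k by auto
  next
    fix j :: nat assume B: B and j: "0 < j"
    then obtain k where k: "j = Suc k" by (cases j) auto
    have No: "chd (z j) = No" "chd (z (Suc j)) = No" using q B j by (auto simp: quiet_def)
    have nrk: "\<not> running prog (z k)"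
      using q B k nr[of 0] by (cases "k = 0") (auto simp: quiet_def running_def)
    have "chd (G z j) = (case chd (z (Suc j)) of Lf a b \<Rightarrow> Lf a b | _ \<Rightarrow> No)"
      by (rule head_step[where i = 0]) (use No k nrk in auto)
    then show "chd (G z j) = No" using No by simp
  qed auto
  moreover have "regok (Suc F) V s (G z)"
    using rg same unfolding regok_def by (metis le_SucI less_imp_le_nat order_trans)
  ultimately show ?thesis using front_step[OF fr] by (simp add: outbound_def)
qed

end

section \<open>Round trips and simulation of the machine\<close>

locale ca_machine = ca_prog +
  fixes V :: "nat set"
  assumes reads_V: "i \<in> set prog \<Longrightarrow> reads i \<subseteq> V"
    and writes_V: "i \<in> set prog \<Longrightarrow> writes i \<subseteq> V"
    and oracle_V: "2 \<notin> V"
begin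

lemma fetch_writes: "writes (ins l) \<subseteq> V"
  using writes_V[of "prog ! l"] by (simp add: fetch_def)

text \<open>Instructions write only marks in V; for mark 2 this says that the oracle track is
  constant.\<close>

lemma mark_static:
  assumes "r \<notin> V" shows "r \<in> cmk (G z j) \<longleftrightarrow> r \<in> cmk (z j)"
proof -
  have "r \<in> act (ins l) S \<longleftrightarrow> r \<in> S" "r \<notin> push (ins l)" for l S
    using fetch_writes[of l] assms by (cases "ins l"; auto)+
  then show ?thesis by (auto simp: half_def rule_def split: head.splits nat.splits)
qed

lemma mark_static_funpow: "r \<notin> V \<Longrightarrow> r \<in> cmk ((G ^^ n) z j) \<longleftrightarrow> r \<in> cmk (z j)"
  by (induction n) (auto simp: mark_static)

lemma walk:
  assumes "outbound B F i l U s z" "\<And>m. m < n \<Longrightarrow> \<not> stops (ins l) (cmk ((G ^^ m) z (i + m)))"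
  shows "outbound B (F + n) (i + n) l U s ((G ^^ n) z)"
  using assms(2) by (induction n) (use assms(1) advance in auto)

lemma walk_back:
  assumes "inbound B F i l b U s z" "m \<le> i"
  shows "inbound B (F + m) (i - m) l b U s ((G ^^ m) z)"
  using assms(2)
proof (induction m)
  case (Suc m)
  then have "inbound B (F + m) (Suc (i - Suc m)) l b U s ((G ^^ m) z)" by (simp add: Suc_diff_Suc)
  from return[OF this] show ?case by simp
qed (use assms(1) in simp)

text \<open>The head takes c steps out, one to turn, c back and one to be emitted again.\<close>

lemma trip:
  assumes R: "outbound B F 0 l U s z" and ns: "\<And>m. m < c \<Longrightarrow> \<not> stops (ins l) (cmk ((G ^^ m) z m))"
    and st: "stops (ins l) (cmk ((G ^^ c) z c))"
  shows "outbound B (F + (2 * c + 2)) 0 (nxt prog l (answer (ins l) (cmk ((G ^^ c) z c)))) (U \<union> writes (ins l))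
      (place (ins l) c s) ((G ^^ (2 * c + 2)) z)"
    and "0 < m \<Longrightarrow> m < 2 * c + 2 \<Longrightarrow> chd ((G ^^ m) z 0) \<noteq> Rt l'"
proof -
  have R': "outbound B (F + n) n l U s ((G ^^ n) z)" if "n \<le> c" for n
    using walk[OF R, of n] ns that by simp
  let ?b = "answer (ins l) (cmk ((G ^^ c) z c))"
  have "inbound B (Suc (F + c)) c l ?b (U \<union> writes (ins l)) (place (ins l) c s) (G ((G ^^ c) z))"
    using turn[OF R' st] by simp
  then have L: "inbound B (Suc (F + c) + n) (c - n) l ?b (U \<union> writes (ins l)) (place (ins l) c s)
      ((G ^^ n) ((G ^^ Suc c) z))" if "n \<le> c" for n
    using walk_back[of B "Suc (F + c)" c l] that by simp
  have "outbound B (Suc (Suc (F + c) + c)) 0 (nxt prog l ?b) (U \<union> writes (ins l)) (place (ins l) c s)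
      (G ((G ^^ c) ((G ^^ Suc c) z)))"
    using emit L[of c] by simp
  moreover have "G ((G ^^ c) ((G ^^ Suc c) z)) = (G ^^ (2 * c + 2)) z"
  proof -
    have "(G ^^ (2 * c + 2)) z = (G ^^ (Suc c + Suc c)) z" by (simp add: mult_2)
    also have "\<dots> = G ((G ^^ c) ((G ^^ Suc c) z))" by (simp only: funpow_add o_apply funpow.simps(2))
    finally show ?thesis by simp
  qed
  moreover have "Suc (Suc (F + c) + c) = F + (2 * c + 2)" by simp
  ultimately show "outbound B (F + (2 * c + 2)) 0 (nxt prog l ?b) (U \<union> writes (ins l))
      (place (ins l) c s) ((G ^^ (2 * c + 2)) z)" by metis
  assume m: "0 < m" "m < 2 * c + 2"
  show "chd ((G ^^ m) z 0) \<noteq> Rt l'"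
  proof (cases "m \<le> c")
    case True
    then show ?thesis using R'[OF True] m(1) by (auto simp: outbound_def quiet_def)
  next
    case False
    then obtain n where n: "m = n + Suc c" by (metis add.commute le_Suc_ex not_less_eq_eq)
    then have "n \<le> c" using m(2) by simp
    have eq: "(G ^^ m) z = (G ^^ n) ((G ^^ Suc c) z)" unfolding n by (simp only: funpow_add o_apply)
    show ?thesis using L[OF \<open>n \<le> c\<close>] unfolding eq
      by (cases "c - n") (auto simp: inbound_def quiet_def)
  qed
qed

text \<open>A head that never stopped would leave the origin without any head forever. No knowledge
  of the registers enters.\<close>

lemma emits_imp_stops:
  assumes R: "outbound B F 0 l U s z" and t: "0 < t" "chd ((G ^^ t) z 0) = Rt l'"
  shows "\<exists>c. (\<forall>m<c. \<not> stops (ins l) (cmk ((G ^^ m) z m))) \<and> stops (ins l) (cmk ((G ^^ c) z c)) \<and> 2 * c + 2 \<le> t"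
proof -
  have "\<exists>c. stops (ins l) (cmk ((G ^^ c) z c))"
  proof (rule ccontr)
    assume "\<nexists>c. stops (ins l) (cmk ((G ^^ c) z c))"
    then have "outbound B (F + t) t l U s ((G ^^ t) z)" using walk[OF R, of t] by simp
    with t show False by (auto simp: outbound_def quiet_def)
  qed
  then obtain c where c: "stops (ins l) (cmk ((G ^^ c) z c))" "\<forall>m<c. \<not> stops (ins l) (cmk ((G ^^ m) z m))"
    using exists_least_iff[of "\<lambda>c. stops (ins l) (cmk ((G ^^ c) z c))"] by blast
  have "\<not> t < 2 * c + 2" using trip(2)[OF R _ c(1), of t l'] c(2) t by blast
  with c show ?thesis by (intro exI[of _ c]) auto
qed

lemma outbound_mono: "outbound B F i l U s z \<Longrightarrow> U' \<subseteq> U \<Longrightarrow> outbound B F i l U' s z"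
  by (auto simp: outbound_def regok_def)

text \<open>Every emission at the origin ends a trip of the original head or of a successor. What is
  gained is a clean region of size F + t, from which a later display can fix the registers.\<close>

lemma emits_outbound:
  assumes "outbound B F 0 l U s z" "chd ((G ^^ t) z 0) = Rt l'"
  shows "\<exists>s'. outbound B (F + t) 0 l' {} s' ((G ^^ t) z)"
  using assms
proof (induction t arbitrary: F l U s z rule: less_induct)
  case (less t)
  show ?case
  proof (cases "t = 0")
    case True
    then have "l' = l" using less.prems by (simp add: outbound_def)
    then show ?thesis using True outbound_mono[OF less.prems(1), of "{}"] by auto
  next
    case False
    then obtain c where c: "\<forall>m<c. \<not> stops (ins l) (cmk ((G ^^ m) z m))" "stops (ins l) (cmk ((G ^^ c) z c))"
      "2 * c + 2 \<le> t" using emits_imp_stops[OF less.prems(1) _ less.prems(2)] by blast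
    let ?n = "2 * c + 2"
    have eq: "(G ^^ (t - ?n)) ((G ^^ ?n) z) = (G ^^ t) z"
      using c(3) by (metis comp_apply funpow_add le_add_diff_inverse2)
    have "t - ?n < t" using False by simp
    from less.IH[OF this trip(1)[OF less.prems(1) _ c(2)]] c(1) less.prems(2)
    have "\<exists>s'. outbound B (F + ?n + (t - ?n)) 0 l' {} s' ((G ^^ (t - ?n)) ((G ^^ ?n) z))" unfolding eq by blast
    moreover have "F + ?n + (t - ?n) = F + t" using c(3) by simp
    ultimately show ?thesis unfolding eq by metis
  qed
qed

lemma stops_reads: "r \<in> reads i \<Longrightarrow> r \<in> S \<Longrightarrow> stops i S"
  by (cases i) auto

text \<open>Once the head has passed cell \<open>s r\<close> for a register r that it reads, it must
  have met the mark there. \<open>Rst\<close> reads nothing but stops at once.\<close>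

lemma first_stop:
  assumes R: "outbound B F 0 l V s z" and l: "l < length prog"
  shows "\<exists>c. (\<forall>m<c. \<not> stops (ins l) (cmk ((G ^^ m) z m))) \<and> stops (ins l) (cmk ((G ^^ c) z c))"
proof -
  have "\<exists>c. stops (ins l) (cmk ((G ^^ c) z c))"
  proof (rule ccontr)
    assume no: "\<nexists>c. stops (ins l) (cmk ((G ^^ c) z c))"
    then have W: "outbound B (F + n) n l V s ((G ^^ n) z)" for n using walk[OF R, of n] by simp
    have "\<exists>r. r \<in> reads (ins l)" using no by (cases "ins l") auto
    then obtain r where r: "r \<in> reads (ins l)" ..
    then have "r \<in> V" using reads_V[of "ins l"] l by (auto simp: fetch_def)
    then have "r \<in> cmk ((G ^^ Suc (s r)) z (s r))" using W[of "Suc (s r)"] by (auto simp: outbound_def regok_def)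
    moreover have "\<not> stops (ins l) (cmk ((G ^^ Suc (s r)) z (s r)))"
      using W[of "Suc (s r)"] by (auto simp: outbound_def)
    ultimately show False using stops_reads[OF r] by blast
  qed
  then show ?thesis using exists_least_iff[of "\<lambda>c. stops (ins l) (cmk ((G ^^ c) z c))"] by blast
qed

lemma simulate_step:
  assumes R: "outbound B F 0 l V s z" and l: "l < length prog"
  defines "\<sigma> \<equiv> mstep prog {j. 2 \<in> cmk (z j)} (l, s)"
  shows "\<exists>n>0. outbound B (F + n) 0 (fst \<sigma>) V (snd \<sigma>) ((G ^^ n) z) \<and>
    (\<forall>m l'. 0 < m \<and> m < n \<longrightarrow> chd ((G ^^ m) z 0) \<noteq> Rt l')"
proof -
  obtain c where ns: "\<And>m. m < c \<Longrightarrow> \<not> stops (ins l) (cmk ((G ^^ m) z m))" and st: "stops (ins l) (cmk ((G ^^ c) z c))"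
    using first_stop[OF R l] by blast
  let ?y = "(G ^^ c) z"
  have Rc: "outbound B (F + c) c l V s ?y" using walk[OF R, of c] ns by simp
  \<comment> \<open>The head got to c without stopping, so no register that it reads has a value
    below c, and mark r is present at c exactly if its value is c.\<close>
  have at: "r \<in> cmk (?y c) \<longleftrightarrow> s r = c" and ge: "c \<le> s r" if "r \<in> reads (ins l)" for r
  proof -
    have "r \<in> V" using that reads_V[of "ins l"] l by (auto simp: fetch_def)
    then have *: "r \<in> cmk (?y (s r))" "\<And>j. j < s r \<Longrightarrow> r \<notin> cmk (?y j)" using Rc by (auto simp: outbound_def regok_def)
    have "\<not> s r < c" using Rc stops_reads[OF that *(1)] by (auto simp: outbound_def)
    then show "c \<le> s r" by simp
    then show "r \<in> cmk (?y c) \<longleftrightarrow> s r = c" using * by (metis order_le_imp_less_or_eq)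
  qed
  have ora: "2 \<in> cmk (?y j) \<longleftrightarrow> 2 \<in> cmk (z j)" for j by (rule mark_static_funpow[OF oracle_V])
  have i: "prog ! l = ins l" using l by (simp add: fetch_def)
  have ans: "answer (ins l) (cmk (?y c)) = test {j. 2 \<in> cmk (z j)} (ins l) s"
    using at st ge ora by (cases "ins l") auto
  have "V \<union> writes (ins l) = V" using fetch_writes[of l] by blast
  moreover have "place (ins l) c s = upd (ins l) s" using at st by (cases "ins l") auto
  ultimately have "outbound B (F + (2 * c + 2)) 0 (fst \<sigma>) V (snd \<sigma>) ((G ^^ (2 * c + 2)) z)"
    using trip(1)[OF R ns st] ans by (simp add: \<sigma>_def mstep_def i)
  with trip(2)[OF R ns st] show ?thesis by (intro exI[of _ "2 * c + 2"]) auto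
qed

lemma fst_mstep_less: "fst (mstep prog A \<sigma>) < length prog"
  using nonempty by (simp add: mstep_def nxt_def Let_def)

lemma fst_mstep_funpow_less: "fst \<sigma> < length prog \<Longrightarrow> fst ((mstep prog A ^^ k) \<sigma>) < length prog"
  by (cases k) (auto simp: fst_mstep_less)

lemma simulate:
  assumes "outbound B F 0 l V s z" "l < length prog"
  defines "\<sigma> k \<equiv> (mstep prog {j. 2 \<in> cmk (z j)} ^^ k) (l, s)"
  shows "\<exists>n\<ge>k. outbound B (F + n) 0 (fst (\<sigma> k)) V (snd (\<sigma> k)) ((G ^^ n) z)"
proof (induction k)
  case 0 then show ?case using assms by (intro exI[of _ 0]) (auto simp: \<sigma>_def)
next
  case (Suc k)
  then obtain n where n: "n \<ge> k" "outbound B (F + n) 0 (fst (\<sigma> k)) V (snd (\<sigma> k)) ((G ^^ n) z)" by blast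
  have "fst (\<sigma> k) < length prog" using fst_mstep_funpow_less assms(2) by (simp add: \<sigma>_def)
  from simulate_step[OF n(2) this] obtain m where m: "m > 0"
    "outbound B (F + n + m) 0 (fst (\<sigma> (Suc k))) V (snd (\<sigma> (Suc k))) ((G ^^ m) ((G ^^ n) z))"
    by (auto simp: \<sigma>_def mark_static_funpow[OF oracle_V])
  then have "outbound B (F + (m + n)) 0 (fst (\<sigma> (Suc k))) V (snd (\<sigma> (Suc k))) ((G ^^ (m + n)) z)"
    by (simp add: funpow_add ac_simps)
  then show ?case using m(1) n(1) by (intro exI[of _ "m + n"]) auto
qed

text \<open>By \<open>simulate_step\<close> nothing is emitted between two machine steps, so every
  emission belongs to a state of the run.\<close>

lemma emits_imp_state:
  assumes "outbound B F 0 l V s z" "l < length prog" "chd ((G ^^ t) z 0) = Rt l'"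
  shows "\<exists>k. fst ((mstep prog {j. 2 \<in> cmk (z j)} ^^ k) (l, s)) = l'"
  using assms
proof (induction t arbitrary: F l s z rule: less_induct)
  case (less t)
  let ?A = "{j. 2 \<in> cmk (z j)}"
  show ?case
  proof (cases "t = 0")
    case True
    then have "l' = l" using less.prems(1,3) by (simp add: outbound_def)
    then have "fst ((mstep prog ?A ^^ 0) (l, s)) = l'" by simp
    then show ?thesis by blast
  next
    case False
    let ?\<sigma> = "mstep prog ?A (l, s)"
    obtain n where n: "n > 0" "outbound B (F + n) 0 (fst ?\<sigma>) V (snd ?\<sigma>) ((G ^^ n) z)"
      "\<And>m l'. 0 < m \<Longrightarrow> m < n \<Longrightarrow> chd ((G ^^ m) z 0) \<noteq> Rt l'"
      using simulate_step[OF less.prems(1,2)] by blast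
    have "n \<le> t" using n(3)[of t l'] less.prems(3) False by (meson not_less zero_less_iff_neq_zero)
    then have eq: "(G ^^ (t - n)) ((G ^^ n) z) = (G ^^ t) z"
      by (metis comp_apply funpow_add le_add_diff_inverse2)
    have A: "{j. 2 \<in> cmk ((G ^^ n) z j)} = ?A" by (simp add: mark_static_funpow[OF oracle_V])
    have "\<exists>k. fst ((mstep prog {j. 2 \<in> cmk ((G ^^ n) z j)} ^^ k) (fst ?\<sigma>, snd ?\<sigma>)) = l'"
    proof (rule less.IH[OF _ n(2) fst_mstep_less])
      show "t - n < t" using n(1) \<open>n \<le> t\<close> by simp
      show "chd ((G ^^ (t - n)) ((G ^^ n) z) 0) = Rt l'" unfolding eq by (rule less.prems(3))
    qed
    then obtain k where "fst ((mstep prog ?A ^^ k) ?\<sigma>) = l'" unfolding A prod.collapse by blast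
    then have "fst ((mstep prog ?A ^^ Suc k) (l, s)) = l'" by (simp only: funpow_Suc_right o_apply)
    then show ?thesis by blast
  qed
qed

lemma recurrent_emission:
  assumes "outbound B F 0 l V s z" "l < length prog" "\<And>n. \<exists>t\<ge>n. chd ((G ^^ t) z 0) = Rt l'"
  shows "\<exists>k\<ge>n. fst ((mstep prog {j. 2 \<in> cmk (z j)} ^^ k) (l, s)) = l'"
proof -
  let ?A = "{j. 2 \<in> cmk (z j)}"
  let ?\<sigma> = "(mstep prog ?A ^^ n) (l, s)"
  obtain m where m: "outbound B (F + m) 0 (fst ?\<sigma>) V (snd ?\<sigma>) ((G ^^ m) z)" using simulate[OF assms(1,2)] by blast
  obtain t where t: "t \<ge> m" "chd ((G ^^ t) z 0) = Rt l'" using assms(3) by blast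
  then have "chd ((G ^^ (t - m)) ((G ^^ m) z) 0) = Rt l'"
    by (metis comp_apply funpow_add le_add_diff_inverse2)
  from emits_imp_state[OF m fst_mstep_funpow_less this] assms(2)
  obtain k where "fst ((mstep prog ?A ^^ k) ?\<sigma>) = l'"
    by (auto simp: mark_static_funpow[OF oracle_V])
  then have "fst ((mstep prog ?A ^^ (k + n)) (l, s)) = l'" by (simp add: funpow_add)
  then show ?thesis by (intro exI[of _ "k + n"]) auto
qed

end

section \<open>Hardness\<close>

lemma regs_cexp: "regs (cexp t d) \<subseteq> {0, 3, 4} \<union> {d..}"
  by (induction t arbitrary: d) (fastforce simp: unpair_com_def)+

lemma regs_cfm: "regs (cfm f d) \<subseteq> {0, 3, 4} \<union> {d..}"
proof (induction f arbitrary: d)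
  case (Eq a b) then show ?case using regs_cexp[of a d] regs_cexp[of b "d + 1"] by fastforce
next
  case (In a) then show ?case using regs_cexp[of a d] by fastforce
next
  case (Nand f g) then show ?case by fastforce
qed

lemma finite_regs: "finite (regs c)"
  by (induction c) auto

lemma compile_regs: "i \<in> set (compile c pc) \<Longrightarrow> reads i \<union> writes i \<subseteq> regs c"
  by (induction c arbitrary: pc) (fastforce simp: Let_def)+

lemma regs_cfm_nregs: "regs (cfm \<phi> 5) \<subseteq> {..<nregs \<phi>}" and nregs_ge: "7 \<le> nregs \<phi>"
proof -
  have fin: "finite (insert 6 (regs (cfm \<phi> 5)))" by (simp add: finite_regs)
  show "regs (cfm \<phi> 5) \<subseteq> {..<nregs \<phi>}"
    using Max_ge[OF fin] by (auto simp: nregs_def less_Suc_eq_le)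
  show "7 \<le> nregs \<phi>" using Max_ge[OF fin, of 6] by (simp add: nregs_def)
qed

lemma regs_clean: "regs (clean_com \<phi>) \<subseteq> {0} \<union> {3..<nregs \<phi>}"
proof -
  have "regs (cseq (map (\<lambda>r. CFor r 0 CSkip) rs)) \<subseteq> {0} \<union> set rs" for rs :: "nat list"
    by (induction rs) auto
  from this[of "[3..<nregs \<phi>]"] show ?thesis by (simp add: clean_com_def)
qed

lemma main_prog_regs:
  assumes "i \<in> set (main_prog \<phi>)" shows "reads i \<union> writes i \<subseteq> {..<nregs \<phi>} - {2}"
proof -
  have r: "regs (cfm \<phi> 5) \<subseteq> {..<nregs \<phi>} - {2}" using regs_cfm[of \<phi> 5] regs_cfm_nregs[of \<phi>] by fastforce
  have r': "regs (clean_com \<phi>) \<subseteq> {..<nregs \<phi>} - {2}" using regs_clean[of \<phi>] nregs_ge[of \<phi>] by fastforce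
  from assms consider "i \<in> set (compile (cfm \<phi> 5) 3)" |
    "i \<in> set (compile (clean_com \<phi>) (3 + length (eval_code \<phi>) + 7))" |
    "reads i \<union> writes i \<subseteq> {0, 1, 3, 4, 5, 6}"
    unfolding main_prog_def eval_code_def Let_def by auto
  then show ?thesis
  proof cases
    case 1 then show ?thesis using compile_regs r by blast
  next
    case 2 then show ?thesis using compile_regs r' by blast
  next
    case 3 then show ?thesis using nregs_ge[of \<phi>] by fastforce
  qed
qed

section \<open>The two-sided automaton and its finite alphabet\<close>

definition global :: "instr list \<Rightarrow> (int \<Rightarrow> cell) \<Rightarrow> int \<Rightarrow> cell" where
  "global prog y i = rule prog (y (i - 1)) (y i) (y (i + 1))"

definition cells :: "nat \<Rightarrow> nat \<Rightarrow> cell set" where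
  "cells K L = {c. cmk c \<subseteq> {..<K} \<and> (case chd c of No \<Rightarrow> True | Rt l \<Rightarrow> l < L | Lf l b \<Rightarrow> l < L)}"

lemma finite_cells: "finite (cells K L)"
proof -
  have "UNIV = {Out, Org, Ins}" using region.exhaust by auto
  then have "finite (UNIV :: region set)" by (metis finite.simps)
  then have "finite ((\<lambda>(t, S, h). Cell t S h) ` (UNIV \<times> Pow {..<K} \<times>
    ({No} \<union> Rt ` {..<L} \<union> (\<lambda>(l, b). Lf l b) ` ({..<L} \<times> UNIV))))" by auto
  moreover have "c \<in> (\<lambda>(t, S, h). Cell t S h) ` (UNIV \<times> Pow {..<K} \<times>
    ({No} \<union> Rt ` {..<L} \<union> (\<lambda>(l, b). Lf l b) ` ({..<L} \<times> UNIV)))" if "c \<in> cells K L" for c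
  proof (rule image_eqI)
    show "c = (\<lambda>(t, S, h). Cell t S h) (cty c, cmk c, chd c)" by simp
    have "chd c \<in> {No} \<union> Rt ` {..<L} \<union> (\<lambda>(l, b). Lf l b) ` ({..<L} \<times> UNIV)"
      using that by (cases "chd c") (auto simp: cells_def)
    then show "(cty c, cmk c, chd c) \<in> UNIV \<times> Pow {..<K} \<times>
      ({No} \<union> Rt ` {..<L} \<union> (\<lambda>(l, b). Lf l b) ` ({..<L} \<times> UNIV))"
      using that by (simp add: cells_def)
  qed
  then have "cells K L \<subseteq> (\<lambda>(t, S, h). Cell t S h) ` (UNIV \<times> Pow {..<K} \<times>
    ({No} \<union> Rt ` {..<L} \<union> (\<lambda>(l, b). Lf l b) ` ({..<L} \<times> UNIV)))" by (rule subsetI)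
  ultimately show ?thesis by (rule rev_finite_subset)
qed

lemma global_funpow_Suc: "(global prog ^^ Suc t) y i =
    rule prog ((global prog ^^ t) y (i - 1)) ((global prog ^^ t) y i) ((global prog ^^ t) y (i + 1))"
  by (simp add: global_def)

lemma half_global:
  assumes "cty (y (- 1)) = Out"
  shows "(\<lambda>j. global prog y (int j)) = half prog (\<lambda>j. y (int j))"
proof
  fix j
  show "global prog y (int j) = half prog (\<lambda>j. y (int j)) j"
  proof (cases j)
    case 0
    then show ?thesis using assms by (auto simp: global_def half_def rule_def split: head.splits)
  next
    case (Suc i)
    then show ?thesis by (simp add: global_def half_def add.commute)
  qed
qed

lemma half_global_funpow:
  assumes "\<And>t. cty ((global prog ^^ t) y (- 1)) = Out"
  shows "(\<lambda>j. (global prog ^^ t) y (int j)) = (half prog ^^ t) (\<lambda>j. y (int j))"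
proof (induction t)
  case (Suc t)
  then show ?case using half_global[of "(global prog ^^ t) y", OF assms] by simp
qed simp

locale recurrent_ca =
  fixes \<phi> :: fm
begin

abbreviation "pg \<equiv> main_prog \<phi>"
abbreviation "K \<equiv> nregs \<phi>"
abbreviation "V \<equiv> {..<K} - {2}"
abbreviation "D \<equiv> {..<K} - {1, 2}"
abbreviation "CS \<equiv> cells K (length pg)"

lemma length_pg: "1 < length pg" by (simp add: main_prog_def Let_def)

sublocale ca_machine pg V
  by unfold_locales (use length_pg main_prog_regs[of _ \<phi>] in auto)

text \<open>At label 0 all registers except the bound in register 1 equal the input \<open>Suc n\<close>, so that the first
  \<open>n + 2\<close> cells do not depend on the oracle, whose marks start after them.\<close>

definition pattern :: "nat \<Rightarrow> cell list" where
  "pattern n = Cell Org {} (Rt 0) # replicate n (Cell Ins {} No) @ [Cell Ins D No]"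

lemma pattern_nth:
  "pattern n ! 0 = Cell Org {} (Rt 0)" "0 < j \<Longrightarrow> j \<le> n \<Longrightarrow> pattern n ! j = Cell Ins {} No"
  "pattern n ! Suc n = Cell Ins D No" "length (pattern n) = Suc (Suc n)"
  by (auto simp: pattern_def nth_append nth_Cons split: nat.splits)

definition displays :: "nat \<Rightarrow> (int \<Rightarrow> cell) \<Rightarrow> bool" where
  "displays n y \<longleftrightarrow> (\<forall>j<length (pattern n). y (int j) = pattern n ! j)"

lemma set_pattern: "set (pattern n) \<subseteq> CS"
  using length_pg by (auto simp: pattern_def cells_def)

lemma rule_cells:
  assumes "l \<in> CS" "c \<in> CS" "r \<in> CS" shows "rule pg l c r \<in> CS"
proof -
  have "act (ins i) S \<subseteq> {..<K}" "push (ins i) \<subseteq> {..<K}" if "S \<subseteq> {..<K}" for i S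
    using fetch_writes[of i] that by (cases "ins i"; auto)+
  moreover have "nxt pg i b < length pg" for i b using length_pg by (auto simp: nxt_def Let_def)
  ultimately show ?thesis using assms unfolding cells_def
    by (auto simp: rule_def split: head.splits if_splits; blast)
qed

text \<open>Three displays are used. The first starts the observation; the second comes so late that
  the front covers cell p, and it fixes the registers in D; the third shows that the trip of
  \<open>Inc 1\<close> begun at the second one ends, which fixes register 1.\<close>

lemma displays_sound:
  assumes rec: "\<And>n. \<exists>t\<ge>n. displays N ((global pg ^^ t) y)"
  shows "\<exists>T. \<forall>m. \<exists>l. fval T (Suc N) m l \<phi>"
proof -
  let ?Y = "\<lambda>t. (global pg ^^ t) y"
  let ?p = "Suc N"
  have disp0: "?Y t 0 = Cell Org {} (Rt 0)" if "displays N (?Y t)" for t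
    using that unfolding displays_def by (metis of_nat_0 pattern_nth(1,4) zero_less_Suc)
  \<comment> \<open>\<open>Org\<close> cells are never created, so a cell that is \<open>Org\<close>
    later was \<open>Org\<close> before.\<close>
  have Org: "cty (?Y t 0) = Org" for t
  proof -
    obtain u where u: "u \<ge> t" "displays N (?Y u)" using rec by blast
    have Org_before: "cty (?Y (Suc t) 0) = Org \<Longrightarrow> cty (?Y t 0) = Org" for t
      by (auto simp: global_def rule_def split: if_splits)
    have "cty (?Y (t + d) 0) = Org \<Longrightarrow> cty (?Y t 0) = Org" for d
      by (induction d) (use Org_before in auto)
    from this[of "u - t"] u disp0[OF u(2)] show ?thesis by simp
  qed
  \<comment> \<open>Any other left neighbour would turn the origin into \<open>Ins\<close>.\<close>
  have Out: "cty (?Y t (- 1)) = Out" for t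
    using Org[of "Suc t"] by (auto simp: global_def rule_def split: if_splits)
  obtain t0 where t0: "displays N (?Y t0)" using rec by blast
  define z0 where "z0 = (\<lambda>j. ?Y t0 (int j))"
  have z0: "(G ^^ t) z0 = (\<lambda>j. ?Y (t + t0) (int j))" for t
    using half_global_funpow[of pg "?Y t0" t] Out
    by (simp add: z0_def flip: funpow_add[unfolded o_def, THEN fun_cong])
  have rec0: "\<exists>t\<ge>n. displays N (?Y (t + t0))" for n
  proof -
    obtain t where "t \<ge> n + t0" "displays N (?Y t)" using rec by blast
    then show ?thesis by (intro exI[of _ "t - t0"]) auto
  qed
  have "outbound False 0 0 0 {} (\<lambda>_. 0) z0"
    using disp0[OF t0] by (auto simp: outbound_def front_def quiet_def regok_def z0_def)
  \<comment> \<open>Waiting at least p steps makes the value p admissible in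
    \<open>regok\<close>.\<close>
  moreover obtain t1 where t1: "t1 \<ge> ?p" "displays N (?Y (t1 + t0))" using rec0 by blast
  define z1 where "z1 = (G ^^ t1) z0"
  have "chd (z1 0) = Rt 0" using disp0[OF t1(2)] by (simp add: z1_def z0)
  ultimately obtain s' where R1: "outbound False t1 0 0 {} s' z1"
    using emits_outbound[of False 0 0 "{}" _ z0 t1 0] unfolding z1_def by auto
  have z1: "z1 j = pattern N ! j" if "j \<le> ?p" for j
    using t1(2) that by (simp add: displays_def z1_def z0 pattern_nth)
  have "regok t1 D (\<lambda>_. ?p) z1"
    unfolding regok_def
  proof (intro ballI conjI allI impI)
    fix r assume "r \<in> D"
    then show "r \<in> cmk (z1 ?p)" using z1[of ?p] by (simp add: pattern_nth)
    fix j assume "j < ?p"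
    then show "r \<notin> cmk (z1 j)" using z1[of j] by (cases "j = 0") (auto simp: pattern_nth)
  qed (use t1 in simp)
  then have R1: "outbound False t1 0 0 D (\<lambda>_. ?p) z1" using R1 by (simp add: outbound_def)
  have rec1: "\<exists>t\<ge>n. chd ((G ^^ t) z1 0) = Rt 0" for n
  proof -
    obtain t where t: "t \<ge> n + t1" "displays N (?Y (t + t0))" using rec0 by blast
    have "(G ^^ (t - t1)) z1 = (G ^^ t) z0"
      unfolding z1_def using t(1) by (metis add_leD2 comp_apply funpow_add le_add_diff_inverse2)
    then have "chd ((G ^^ (t - t1)) z1 0) = Rt 0" using disp0[OF t(2)] by (simp add: z0)
    then show ?thesis using t(1) by (intro exI[of _ "t - t1"]) auto
  qed
  have ins0: "ins 0 = Inc 1" using length_pg by (simp add: fetch_def main_prog_def Let_def)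
  obtain t2 where t2: "t2 \<ge> 1" "chd ((G ^^ t2) z1 0) = Rt 0" using rec1 by blast
  then obtain c where c: "\<And>m. m < c \<Longrightarrow> \<not> stops (ins 0) (cmk ((G ^^ m) z1 m))"
    "stops (ins 0) (cmk ((G ^^ c) z1 c))"
    using emits_imp_stops[OF R1, of t2 0] by auto
  \<comment> \<open>Mark 1 is first met in cell c, wherever the configuration had it, and is moved
    to \<open>Suc c\<close>; from then on this is the value of register 1.\<close>
  let ?s = "(\<lambda>_. ?p)(1 := Suc c)"
  let ?n = "2 * c + 2"
  have "nxt pg 0 False = 1" using length_pg by (simp add: nxt_def)
  moreover have "D \<union> {1} = V" using nregs_ge[of \<phi>] by auto
  ultimately have R2: "outbound False (t1 + ?n) 0 1 V ?s ((G ^^ ?n) z1)"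
    using trip(1)[OF R1 c] by (simp add: ins0)
  have rec2: "\<exists>t\<ge>n. chd ((G ^^ t) ((G ^^ ?n) z1) 0) = Rt 0" for n
  proof -
    obtain t where t: "t \<ge> n + ?n" "chd ((G ^^ t) z1 0) = Rt 0" using rec1 by blast
    have "(G ^^ (t - ?n)) ((G ^^ ?n) z1) = (G ^^ t) z1"
      using t(1) by (metis add_leD2 comp_apply funpow_add le_add_diff_inverse2)
    then show ?thesis using t by (intro exI[of _ "t - ?n"]) auto
  qed
  let ?A = "{j. 2 \<in> cmk ((G ^^ ?n) z1 j)}"
  interpret run: main_run \<phi> ?A ?p .
  have "\<exists>k\<ge>n. fst ((mstep pg ?A ^^ k) (1, ?s)) = 0" for n
    using recurrent_emission[OF R2 length_pg rec2] by blast
  from run.recurrence_sound[OF _ this] have "\<exists>v. fval {e. e + ?p + 1 \<in> ?A} ?p i v \<phi>" for i by simp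
  then show ?thesis by blast
qed

text \<open>Register 1 starts at p + 1, just outside the display, and e in T is marked at p + 1 + e,
  where \<open>cfm\<close> looks it up.\<close>

definition start :: "nat set \<Rightarrow> nat \<Rightarrow> int \<Rightarrow> cell" where
  "start T N i = (if i < 0 then Cell Out {} No else
    let j = nat i; p = Suc N in Cell (if j = 0 then Org else Ins)
      ((if j = p then D else {}) \<union> (if j = Suc p then {1} else {}) \<union> (if p < j \<and> j - Suc p \<in> T then {2} else {}))
      (if j = 0 then Rt 0 else No))"

lemma start_cells: "start T N i \<in> CS"
  using length_pg nregs_ge[of \<phi>] by (auto simp: start_def Let_def cells_def)

lemma global_cells: "(\<And>i. y i \<in> CS) \<Longrightarrow> (global pg ^^ t) y i \<in> CS"
  by (induction t arbitrary: i) (auto simp: global_def rule_cells)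

lemma displays_complete:
  assumes T: "\<forall>m. \<exists>l. fval T (Suc N) m l \<phi>"
  shows "\<exists>t\<ge>n. displays N ((global pg ^^ t) (start T N))"
proof -
  let ?Y = "\<lambda>t. (global pg ^^ t) (start T N)"
  let ?p = "Suc N"
  have "cty (?Y t i) = Out" if "i < 0" for t i
    using that by (induction t arbitrary: i) (auto simp: global_def rule_def start_def)
  then have Y: "(\<lambda>j. ?Y t (int j)) = (G ^^ t) (\<lambda>j. start T N (int j))" for t
    by (intro half_global_funpow) auto
  let ?z = "\<lambda>j. start T N (int j)"
  let ?s = "(\<lambda>_. ?p)(1 := Suc ?p)"
  \<comment> \<open>The front must reach p + 1, the largest register value. The flag is true because
    the only head is the one at the origin.\<close>
  have R: "outbound True (Suc ?p) 0 0 V ?s ?z"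
    by (auto simp: outbound_def front_def quiet_def regok_def start_def Let_def)
  have A: "{e. e + ?p + 1 \<in> {j. 2 \<in> cmk (?z j)}} = T"
    by (auto simp: start_def Let_def)
  let ?A = "{j. 2 \<in> cmk (?z j)}"
  interpret run: main_run \<phi> ?A ?p .
  obtain k u where k: "k \<ge> n" "(mstep pg ?A ^^ k) (0, ?s) = (0, u)" "u 0 = ?p" "?s 1 < u 1"
    "\<And>r. 3 \<le> r \<Longrightarrow> r < K \<Longrightarrow> u r = ?p"
    using run.recurrence_complete[of ?s n] T unfolding A by auto
  obtain t where t: "t \<ge> k" "outbound True (Suc ?p + t) 0 0 V u ((G ^^ t) ?z)"
    using simulate[OF R nonempty, of k] k(2) by auto
  let ?w = "(G ^^ t) ?z"
  have fr: "front (Suc ?p + t) ?w" and q: "quiet True (Suc ?p + t) 0 ?w" and h: "chd (?w 0) = Rt 0"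
    and rg: "regok (Suc ?p + t) V u ?w" using t(2) by (auto simp: outbound_def)
  have D: "u r = ?p" if "r \<in> D" for r using k(3,5) that by (cases "r = 0") auto
  have sub: "cmk (?w j) \<subseteq> {..<K}" for j
    using global_cells[of "start T N" t "int j", OF start_cells] unfolding cells_def
    using fun_cong[OF Y[of t], of j] by simp
  have no2: "2 \<notin> cmk (?w j)" if "j \<le> ?p" for j
    using that by (subst mark_static_funpow) (auto simp: start_def Let_def)
  \<comment> \<open>Register 1 now exceeds its initial value p + 1, so its leftmost mark lies behind
    the displayed cells.\<close>
  have no1: "1 \<notin> cmk (?w j)" if "j \<le> ?p" for j
    using rg k(4) that nregs_ge[of \<phi>] unfolding regok_def by auto
  have low: "cmk (?w j) = {}" if "j < ?p" for j
  proof -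
    have "r \<notin> cmk (?w j)" if "r \<in> D" for r
      using rg D[OF that] that \<open>j < ?p\<close> unfolding regok_def by auto
    then show ?thesis using sub[of j] no1[of j] no2[of j] that by auto
  qed
  have "r \<in> cmk (?w ?p)" if "r \<in> D" for r
  proof -
    have "r \<in> cmk (?w (u r))" using rg that unfolding regok_def by blast
    then show ?thesis by (simp only: D[OF that])
  qed
  then have top: "cmk (?w ?p) = D" using sub[of ?p] no1[of ?p] no2[of ?p] by auto
  have "?w j = pattern N ! j" if jl: "j < length (pattern N)" for j
  proof -
    consider "j = 0" | "0 < j" "j \<le> N" | "j = ?p" using jl by (fastforce simp: pattern_nth)
    then show ?thesis
    proof cases
      case 1 then show ?thesis using fr h low[of 0] by (intro cell.expand) (auto simp: pattern_nth front_def)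
    next
      case 2 then show ?thesis using fr q low[of j]
        by (intro cell.expand) (auto simp: pattern_nth front_def quiet_def)
    next
      case 3 then show ?thesis using fr q top
        by (intro cell.expand) (auto simp: pattern_nth front_def quiet_def)
    qed
  qed
  then have "displays N (?Y t)" unfolding displays_def using fun_cong[OF Y[of t]] by auto
  then show ?thesis using t(1) k(1) by (intro exI[of _ t]) auto
qed

section \<open>Transfer to numbered letters\<close>

definition enc :: "cell \<Rightarrow> nat" where
  "enc = (SOME h. bij_betw h CS {0..<card CS})"

abbreviation "dec \<equiv> inv_into CS enc"
abbreviation "asize \<equiv> card CS"

definition local_rule :: "nat \<Rightarrow> nat \<Rightarrow> nat \<Rightarrow> nat" where
  "local_rule a b c = enc (rule pg (dec a) (dec b) (dec c))"

lemma enc_bij: "bij_betw enc CS {0..<asize}"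
  unfolding enc_def using ex_bij_betw_finite_nat[OF finite_cells] by (rule someI_ex)

lemma enc_less: "c \<in> CS \<Longrightarrow> enc c < asize" using enc_bij by (auto simp: bij_betw_def)
lemma dec_enc [simp]: "c \<in> CS \<Longrightarrow> dec (enc c) = c" using enc_bij by (simp add: bij_betw_def)
lemma enc_dec [simp]: "a < asize \<Longrightarrow> enc (dec a) = a" using enc_bij by (simp add: bij_betw_def f_inv_into_f)
lemma dec_cells: "a < asize \<Longrightarrow> dec a \<in> CS" using enc_bij by (simp add: bij_betw_def inv_into_into)

lemma local_rule_less: "a < asize \<Longrightarrow> b < asize \<Longrightarrow> c < asize \<Longrightarrow> local_rule a b c < asize"
  unfolding local_rule_def by (intro enc_less rule_cells dec_cells)

lemma asize_pos: "1 \<le> asize"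
  using set_pattern[of 0] finite_cells[of K "length pg"] by (auto simp: pattern_def Suc_le_eq card_gt_0_iff)

abbreviation "ca \<equiv> radius1 local_rule"

lemma ca_global:
  assumes "\<And>i. y i \<in> CS"
  shows "(ca ^^ t) (\<lambda>i. enc (y i)) = (\<lambda>i. enc ((global pg ^^ t) y i))"
proof (induction t)
  case (Suc t)
  show ?case
  proof
    fix i
    show "(ca ^^ Suc t) (\<lambda>i. enc (y i)) i = enc ((global pg ^^ Suc t) y i)"
      by (simp only: funpow_radius1_Suc Suc local_rule_def dec_enc[OF global_cells[of y, OF assms]] global_funpow_Suc)
  qed
qed simp

lemma language_pattern_iff:
  "map enc (pattern N) \<in> language (asymptotic_set asize ca) \<longleftrightarrow> (\<exists>T. \<forall>m. \<exists>l. fval T (Suc N) m l \<phi>)"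
proof -
  have stable: "ca ` full_shift asize \<subseteq> full_shift asize"
    using local_rule_less by (auto simp: full_shift_def radius1_def)
  have pat: "pattern N ! i \<in> CS" if "i < length (pattern N)" for i
    using set_pattern nth_mem[OF that] by blast
  have show_iff: "(\<forall>i<length (map enc (pattern N)). (ca ^^ t) (\<lambda>i. enc (y i)) (int i) = map enc (pattern N) ! i) \<longleftrightarrow>
      displays N ((global pg ^^ t) y)" if "\<And>i. y i \<in> CS" for y t
  proof -
    have "enc ((global pg ^^ t) y (int i)) = enc (pattern N ! i) \<longleftrightarrow> (global pg ^^ t) y (int i) = pattern N ! i"
      if "i < length (pattern N)" for i
      using pat[OF that] global_cells[of y t "int i", OF \<open>\<And>i. y i \<in> CS\<close>] dec_enc by metis
    then show ?thesis unfolding ca_global[OF that] displays_def by simp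
  qed
  have "(\<exists>x\<in>full_shift asize. \<forall>n. \<exists>j\<ge>n. \<forall>i<length (map enc (pattern N)). (ca ^^ j) x (int i) = map enc (pattern N) ! i)
    \<longleftrightarrow> (\<exists>T. \<forall>m. \<exists>l. fval T (Suc N) m l \<phi>)"
  proof
    assume "\<exists>x\<in>full_shift asize. \<forall>n. \<exists>j\<ge>n. \<forall>i<length (map enc (pattern N)). (ca ^^ j) x (int i) = map enc (pattern N) ! i"
    then obtain x where x: "x \<in> full_shift asize"
      and rec: "\<And>n. \<exists>j\<ge>n. \<forall>i<length (map enc (pattern N)). (ca ^^ j) x (int i) = map enc (pattern N) ! i" by blast
    let ?y = "\<lambda>i. dec (x i)"
    have y: "?y i \<in> CS" for i using x dec_cells by (simp add: full_shift_def)
    have "x = (\<lambda>i. enc (?y i))" using x by (simp add: full_shift_def)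
    then have "\<exists>t\<ge>n. displays N ((global pg ^^ t) ?y)" for n
      using rec[of n] show_iff[of ?y, OF y] by metis
    then show "\<exists>T. \<forall>m. \<exists>l. fval T (Suc N) m l \<phi>" by (rule displays_sound)
  next
    assume "\<exists>T. \<forall>m. \<exists>l. fval T (Suc N) m l \<phi>"
    then obtain T where T: "\<forall>m. \<exists>l. fval T (Suc N) m l \<phi>" ..
    have "(\<lambda>i. enc (start T N i)) \<in> full_shift asize" using enc_less start_cells by (simp add: full_shift_def)
    moreover have "\<forall>n. \<exists>j\<ge>n. \<forall>i<length (map enc (pattern N)).
        (ca ^^ j) (\<lambda>i. enc (start T N i)) (int i) = map enc (pattern N) ! i"
      using displays_complete[OF T] show_iff[of "start T N", OF start_cells] by blast
    ultimately show "\<exists>x\<in>full_shift asize. \<forall>n. \<exists>j\<ge>n. \<forall>i<length (map enc (pattern N)).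
        (ca ^^ j) x (int i) = map enc (pattern N) ! i" by blast
  qed
  then show ?thesis using language_asymptotic_iff[OF stable] by simp
qed

lemma language_letters:
  assumes "w \<in> language (asymptotic_set asize ca)" shows "set w \<subseteq> {..<asize}"
proof -
  have stable: "ca ` full_shift asize \<subseteq> full_shift asize"
    using local_rule_less by (auto simp: full_shift_def radius1_def)
  obtain x j where "x \<in> full_shift asize" "\<forall>i<length w. (ca ^^ j) x (int i) = w ! i"
    using assms language_asymptotic_iff[OF stable] by blast
  then have "w ! i < asize" if "i < length w" for i
    using funpow_radius1_full_shift[where k = asize and \<rho> = local_rule and x = x, OF local_rule_less] that by metis
  then show ?thesis by (auto simp: in_set_conv_nth)
qed

lemma lang_code_pattern_iff:
  "word_code asize (map enc (pattern N)) \<in> lang_code asize (language (asymptotic_set asize ca)) \<longleftrightarrow>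
    (\<exists>T. \<forall>m. \<exists>l. fval T (Suc N) m l \<phi>)"
proof -
  have letters: "set (map enc (pattern N)) \<subseteq> {..<asize}" using set_pattern enc_less by auto
  have "map enc (pattern N) \<in> language (asymptotic_set asize ca)"
    if mem: "word_code asize (map enc (pattern N)) \<in> lang_code asize (language (asymptotic_set asize ca))"
  proof -
    obtain w where w: "w \<in> language (asymptotic_set asize ca)" "word_code asize w = word_code asize (map enc (pattern N))"
      using mem unfolding lang_code_def by auto
    then show ?thesis using word_code_inj[OF asize_pos language_letters[OF w(1)] letters] by simp
  qed
  then show ?thesis unfolding language_pattern_iff[symmetric] by (auto simp: lang_code_def)
qed

text \<open>The word uses three letters, so the arbitrarily chosen \<open>enc\<close> enters only
  through three constants; repeating the middle letter is a primitive recursion on the code.\<close>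

lemma definable_pattern_code:
  assumes "definable a F" shows "definable a (\<lambda>C xs. word_code asize (map enc (pattern (F C xs))))"
proof -
  define w where "w n = word_code asize (map enc (replicate n (Cell Ins {} No) @ [Cell Ins D No]))" for n
  have "definable 1 (\<lambda>C xs. w (xs ! 0))"
    by (rule definable_rec[where H = "\<lambda>C xs n. w n" and N = "\<lambda>C xs. xs ! 0"
          and F = "\<lambda>C xs. Suc (enc (Cell Ins D No))"
          and G = "\<lambda>C xs. Suc (enc (Cell Ins {} No)) + asize * (xs ! 0)"])
      (auto intro!: definable_proj definable_const definable_add definable_mult_const definable_Suc simp: w_def)
  then have "definable a (\<lambda>C xs. w (F C xs))" using assms by (rule definable_comp1)
  then have "definable a (\<lambda>C xs. Suc (enc (Cell Org {} (Rt 0))) + asize * w (F C xs))"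
    by (intro definable_add definable_const definable_mult_const)
  then show ?thesis by (simp add: w_def pattern_def)
qed

end

text \<open>The automaton does not depend on P. The program e for P enters only through the root
  statement \<open>Top (code e) w 0\<close>, whose successor is the input displayed.\<close>

lemma sigma11_reduces_to_recurrent_ca:
  assumes "sigma11 P"
  shows "many_one_reducible P (lang_code (card (cells (nregs univ_fm) (length (main_prog univ_fm))))
    (language (asymptotic_set (card (cells (nregs univ_fm) (length (main_prog univ_fm))))
      (radius1 (recurrent_ca.local_rule univ_fm)))))"
proof -
  interpret recurrent_ca univ_fm .
  obtain R e where e: "\<And>C m l w. reval C e [m, l, w] (if R C m l w then 1 else 0)"
    and P: "\<And>w. w \<in> P \<longleftrightarrow> (\<exists>C. \<forall>m. \<exists>l. R C m l w)"
    using assms unfolding sigma11_def recursive_pred_def by blast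
  define g where "g w = word_code asize (map enc (pattern (Top (code e) w 0)))" for w
  have "definable 1 (\<lambda>C xs. g (xs ! 0))"
    unfolding g_def fact4_def
    by (intro definable_pattern_code definable_prod_encode definable_const definable_proj) simp
  then have "computable g" by (rule computable_if_definable)
  moreover have "w \<in> P \<longleftrightarrow> g w \<in> lang_code asize (language (asymptotic_set asize ca))" for w
    unfolding P sigma11_iff_supported[OF e] g_def lang_code_pattern_iff supported_iff_univ_fm ..
  ultimately show ?thesis unfolding many_one_reducible_def by blast
qed

theorem theorem1:
  shows "(\<forall>P. sigma11 P \<longrightarrow>
            (\<exists>k f. cellular_automaton k f \<and>
               many_one_reducible P (lang_code k (language (asymptotic_set k f)))))
       \<and> (\<exists>k f. cellular_automaton k f \<and>
               sigma11_complete (lang_code k (language (asymptotic_set k f))))"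
proof -
  interpret recurrent_ca univ_fm .
  have "cellular_automaton asize ca"
    by (rule cellular_automaton_radius1[where \<rho> = local_rule, OF asize_pos local_rule_less])
  moreover have "sigma11_complete (lang_code asize (language (asymptotic_set asize ca)))"
    unfolding sigma11_complete_def
    using sigma11_language_radius1[where \<rho> = local_rule, OF asize_pos local_rule_less] sigma11_reduces_to_recurrent_ca by blast
  ultimately show ?thesis unfolding sigma11_complete_def by blast
qed

end
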